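(* Let $X$ be a smooth manifold and let $Z\subset X$ be a submanifold of codimension $1$. Then $\mathrm{TC}(X)$ coincides with the smallest positive integer $k$ for which the product $X\times X$ is covered by $k$ open subsets $X\times X=U_1\cup\cdots\cup U_k$ such that for each $i=1,2,\ldots,k$ there exists a continuous map $s_i\colon U_i\to X^{[0,1]}$ that is a section of $e_2^X$ over $U_i$ (i.e., $e_2^X\circ s_i$ is the inclusion $U_i\hookrightarrow X\times X$) and satisfies $\widetilde{s_i}\pitchfork Z$, where $\widetilde{s_i}\colon U_i\times[0,1]\to X$ is given by $\widetilde{s_i}(u,t)=s_i(u)(t)$ for any $u\in U_i$ and $t\in[0,1]$.
   Context: Smooth manifolds and submanifolds ($X$ and $Z$) are without boundary. $X^{[0,1]}$ is the space of all continuous paths $[0,1]\to X$ with the compact-open topology, and $e_2^X\colon X^{[0,1]}\to X\times X$ is the end-points evaluation fibration $e_2^X(\gamma)=(\gamma(0),\gamma(1))$. Farber's topological complexity $\mathrm{TC}(X)$ is the (non-reduced) sectional category of $e_2^X$: the smallest number $k$ of open sets covering $X\times X$ on each of which $e_2^X$ admits a continuous local section. For either of the two numbers being compared, if no such $k$ exists the number is $\infty$. For a map $F\colon U\times[0,1]\to X$, with $U\subset X\times X$ open, $F\pitchfork Z$ ($F$ is transversal to $Z$) means that $F$ is smooth (on the manifold with boundary $U\times[0,1]$) and, for every $p\in U\times[0,1]$ with $F(p)\in Z$, $\operatorname{im}(dF_p)+T_{F(p)}Z=T_{F(p)}X$. *)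

theory Defs
  imports "HOL-Analysis.Analysis" "HOL-Library.Extended_Nat"
begin

section \<open>Sectional category and topological complexity\<close>

text \<open>The compact-open topology on the set of continuous paths in \<open>X\<close>. Paths are made
  extensional (\<open>undefined\<close> off the unit interval), so that a path is determined by its values
  on \<open>{0..1}\<close>. The subbasic set with \<open>K = {}\<close> is the whole path set.\<close>

definition path_space :: "'a topology \<Rightarrow> (real \<Rightarrow> 'a) topology" where
  "path_space X = topology_generated_by
     {{\<gamma> \<in> extensional {0..1}. pathin X \<gamma> \<and> \<gamma> ` K \<subseteq> V} | K V.
        compact K \<and> K \<subseteq> {0..1} \<and> openin X V}"

definition endpoints :: "(real \<Rightarrow> 'a) \<Rightarrow> 'a \<times> 'a" where
  "endpoints \<gamma> = (\<gamma> 0, \<gamma> 1)"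

definition local_section ::
  "'t topology \<Rightarrow> 'b topology \<Rightarrow> ('t \<Rightarrow> 'b) \<Rightarrow> 'b set \<Rightarrow> ('b \<Rightarrow> 't) \<Rightarrow> bool" where
  "local_section T B p U s \<longleftrightarrow>
     continuous_map (subtopology B U) T s \<and> (\<forall>u\<in>U. p (s u) = u)"

definition open_cover :: "'b topology \<Rightarrow> nat \<Rightarrow> (nat \<Rightarrow> 'b set) \<Rightarrow> bool" where
  "open_cover B k U \<longleftrightarrow> (\<forall>i\<in>{1..k}. openin B (U i)) \<and> topspace B = (\<Union>i\<in>{1..k}. U i)"

text \<open>Non-reduced sectional category. The infimum of the empty set of \<open>enat\<close> is \<open>\<infinity>\<close>.
  The number of open sets is taken positive, which matters only for an empty base.\<close>

definition sectional_category :: "'t topology \<Rightarrow> 'b topology \<Rightarrow> ('t \<Rightarrow> 'b) \<Rightarrow> enat" where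
  "sectional_category T B p = Inf {enat k | k. 0 < k \<and>
     (\<exists>U. open_cover B k U \<and> (\<forall>i\<in>{1..k}. \<exists>s. local_section T B p (U i) s))}"

definition topological_complexity :: "'a topology \<Rightarrow> enat" where
  "topological_complexity X = sectional_category (path_space X) (prod_topology X X) endpoints"

section \<open>Smooth functions on subsets of Euclidean spaces\<close>

text \<open>\<open>C_on k W f\<close> says that \<open>f\<close> is \<open>k\<close> times continuously differentiable;
  it is meaningful for open \<open>W\<close> only.\<close>

primrec C_on ::
  "nat \<Rightarrow> 'm::euclidean_space set \<Rightarrow> ('m \<Rightarrow> 'n::euclidean_space) \<Rightarrow> bool" where
  "C_on 0 W f \<longleftrightarrow> continuous_on W f"
| "C_on (Suc k) W f \<longleftrightarrow> (\<forall>x\<in>W. f differentiable at x) \<and>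
     (\<forall>v. C_on k W (\<lambda>x. frechet_derivative f (at x) v))"

text \<open>On an arbitrary set, smoothness means local extendability to a smooth function on an
  open set. This is the usual notion at boundary points of a manifold with boundary.\<close>

definition smooth_on :: "'m::euclidean_space set \<Rightarrow> ('m \<Rightarrow> 'n::euclidean_space) \<Rightarrow> bool" where
  "smooth_on S f \<longleftrightarrow> (\<forall>x\<in>S. \<exists>W g. open W \<and> x \<in> W \<and> (\<forall>k. C_on k W g) \<and>
     (\<forall>y\<in>S \<inter> W. g y = f y))"

section \<open>Charts, atlases and smooth manifolds\<close>

text \<open>A chart is its domain together with the coordinate map; only the values of the
  coordinate map on the domain matter.\<close>

type_synonym ('a, 'e) chart = "'a set \<times> ('a \<Rightarrow> 'e)"

definition chart_inv :: "('a, 'e) chart \<Rightarrow> 'e \<Rightarrow> 'a" where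
  "chart_inv c = inv_into (fst c) (snd c)"

definition is_chart ::
  "'a::topological_space set \<Rightarrow> ('a, 'e::euclidean_space) chart \<Rightarrow> bool" where
  "is_chart M c \<longleftrightarrow> openin (top_of_set M) (fst c) \<and> open (snd c ` fst c) \<and>
     homeomorphism (fst c) (snd c ` fst c) (snd c) (chart_inv c)"

text \<open>Coordinate representation of a map with respect to charts \<open>b\<close> (source) and \<open>a\<close> (target),
  and the set on which it is defined. For \<open>F = (\<lambda>x. x)\<close> it is the coordinate change.\<close>

definition local_rep ::
  "('p, 'd) chart \<Rightarrow> ('a, 'e) chart \<Rightarrow> ('p \<Rightarrow> 'a) \<Rightarrow> 'd \<Rightarrow> 'e" where
  "local_rep b a F = snd a \<circ> F \<circ> chart_inv b"

definition local_dom ::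
  "('p, 'd) chart \<Rightarrow> ('a, 'e) chart \<Rightarrow> ('p \<Rightarrow> 'a) \<Rightarrow> 'd set" where
  "local_dom b a F = snd b ` (fst b \<inter> F -` fst a)"

definition compatible ::
  "('a, 'e::euclidean_space) chart \<Rightarrow> ('a, 'e) chart \<Rightarrow> bool" where
  "compatible c d \<longleftrightarrow> smooth_on (local_dom c d (\<lambda>x. x)) (local_rep c d (\<lambda>x. x)) \<and>
     smooth_on (local_dom d c (\<lambda>x. x)) (local_rep d c (\<lambda>x. x))"

text \<open>A smooth manifold without boundary, of dimension \<open>DIM('e)\<close>: a Hausdorff second countable
  space \<open>M\<close> (given as a subspace of a type with these properties, possibly all of it) with a
  maximal smooth atlas \<open>A\<close>.\<close>

definition smooth_manifold ::
  "'a::{t2_space,second_countable_topology} set \<Rightarrow> ('a, 'e::euclidean_space) chart set \<Rightarrow> bool"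
  where
  "smooth_manifold M A \<longleftrightarrow>
     (\<forall>c\<in>A. is_chart M c) \<and> M = (\<Union>c\<in>A. fst c) \<and> (\<forall>c\<in>A. \<forall>d\<in>A. compatible c d) \<and>
     (\<forall>c. is_chart M c \<and> (\<forall>d\<in>A. compatible c d) \<longrightarrow> c \<in> A)"

definition restrict_atlas :: "'a set \<Rightarrow> ('a, 'e) chart set \<Rightarrow> ('a, 'e) chart set" where
  "restrict_atlas U A = {(fst c \<inter> U, snd c) | c. c \<in> A}"

definition prod_atlas ::
  "('a, 'd) chart set \<Rightarrow> ('b, 'e) chart set \<Rightarrow> ('a \<times> 'b, 'd \<times> 'e) chart set" where
  "prod_atlas A B = {(fst c \<times> fst d, map_prod (snd c) (snd d)) | c d. c \<in> A \<and> d \<in> B}"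

definition interval_atlas :: "(real, real) chart set" where
  "interval_atlas = {({0..1}, \<lambda>t. t)}"

text \<open>The (non-maximal) atlas of the manifold with boundary \<open>U \<times> [0,1]\<close> for \<open>U\<close> open in
  \<open>M \<times> M\<close>: its charts take values in the Euclidean space times \<open>{0..1}\<close>, instead of a half-space.\<close>

definition cylinder_atlas ::
  "('a \<times> 'a) set \<Rightarrow> ('a, 'e) chart set \<Rightarrow> (('a \<times> 'a) \<times> real, ('e \<times> 'e) \<times> real) chart set" where
  "cylinder_atlas U A = prod_atlas (restrict_atlas U (prod_atlas A A)) interval_atlas"

definition smooth_map ::
  "'p::topological_space set \<Rightarrow> ('p, 'd::euclidean_space) chart set \<Rightarrow>
   'a::topological_space set \<Rightarrow> ('a, 'e::euclidean_space) chart set \<Rightarrow> ('p \<Rightarrow> 'a) \<Rightarrow> bool" where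
  "smooth_map N B M A F \<longleftrightarrow> continuous_on N F \<and> F ` N \<subseteq> M \<and>
     (\<forall>b\<in>B. \<forall>a\<in>A. smooth_on (local_dom b a F) (local_rep b a F))"

section \<open>Tangent spaces, differentials and transversality\<close>

text \<open>Derivative at \<open>p\<close> of the coordinate representation. It is taken within the local domain,
  which determines it uniquely also at boundary points.\<close>

definition local_deriv ::
  "('p, 'd::euclidean_space) chart \<Rightarrow> ('a, 'e::euclidean_space) chart \<Rightarrow> ('p \<Rightarrow> 'a) \<Rightarrow> 'p \<Rightarrow>
   'd \<Rightarrow> 'e" where
  "local_deriv b a F p =
     frechet_derivative (local_rep b a F) (at (snd b p) within local_dom b a F)"

text \<open>A tangent vector at \<open>p\<close> assigns to each chart around \<open>p\<close> a coordinate vector, in such a way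
  that the coordinate vectors transform by the derivatives of the coordinate changes (and it
  is \<open>0\<close> on all other pairs). Vector space operations are pointwise.\<close>

type_synonym ('a, 'e) tangent_vector = "('a, 'e) chart \<Rightarrow> 'e"

definition tangent_space ::
  "('a, 'e::euclidean_space) chart set \<Rightarrow> 'a \<Rightarrow> ('a, 'e) tangent_vector set" where
  "tangent_space A p = {v.
     (\<forall>c. \<not> (c \<in> A \<and> p \<in> fst c) \<longrightarrow> v c = 0) \<and>
     (\<forall>c\<in>A. \<forall>d\<in>A. p \<in> fst c \<and> p \<in> fst d \<longrightarrow> v d = local_deriv c d (\<lambda>x. x) p (v c))}"

text \<open>The differential of \<open>F\<close> at \<open>p\<close>. By the chain rule it does not depend on the chosen
  chart around \<open>p\<close>.\<close>

definition differential ::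
  "('p, 'd::euclidean_space) chart set \<Rightarrow> ('a, 'e::euclidean_space) chart set \<Rightarrow> ('p \<Rightarrow> 'a) \<Rightarrow>
   'p \<Rightarrow> ('p, 'd) tangent_vector \<Rightarrow> ('a, 'e) tangent_vector" where
  "differential B A F p v = (\<lambda>a. if a \<in> A \<and> F p \<in> fst a
     then (let b = (SOME b. b \<in> B \<and> p \<in> fst b) in local_deriv b a F p (v b)) else 0)"

text \<open>A chart in which \<open>Z\<close> becomes the linear subspace \<open>S\<close>.\<close>

definition slice_chart ::
  "('a, 'e::euclidean_space) chart set \<Rightarrow> 'a set \<Rightarrow> 'e set \<Rightarrow> ('a, 'e) chart \<Rightarrow> bool" where
  "slice_chart A Z S c \<longleftrightarrow> c \<in> A \<and> subspace S \<and> snd c ` (fst c \<inter> Z) = snd c ` fst c \<inter> S"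

text \<open>Embedded submanifolds without boundary; not required to be closed.\<close>

definition submanifold ::
  "'a set \<Rightarrow> ('a, 'e::euclidean_space) chart set \<Rightarrow> nat \<Rightarrow> 'a set \<Rightarrow> bool" where
  "submanifold M A codim Z \<longleftrightarrow> Z \<subseteq> M \<and>
     (\<forall>q\<in>Z. \<exists>S c. slice_chart A Z S c \<and> q \<in> fst c \<and> dim S + codim = DIM('e))"

text \<open>The tangent space of a submanifold \<open>Z\<close>, as a subspace of the ambient tangent space.\<close>

definition submanifold_tangent_space ::
  "('a, 'e::euclidean_space) chart set \<Rightarrow> 'a set \<Rightarrow> 'a \<Rightarrow> ('a, 'e) tangent_vector set" where
  "submanifold_tangent_space A Z q =
     {v \<in> tangent_space A q. \<exists>S c. slice_chart A Z S c \<and> q \<in> fst c \<and> v c \<in> S}"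

definition transversal ::
  "'p::topological_space set \<Rightarrow> ('p, 'd::euclidean_space) chart set \<Rightarrow>
   'a::topological_space set \<Rightarrow> ('a, 'e::euclidean_space) chart set \<Rightarrow> ('p \<Rightarrow> 'a) \<Rightarrow>
   'a set \<Rightarrow> bool" where
  "transversal N B M A F Z \<longleftrightarrow> smooth_map N B M A F \<and>
     (\<forall>p\<in>N. F p \<in> Z \<longrightarrow>
        {\<lambda>c. v c + w c | v w. v \<in> differential B A F p ` tangent_space B p \<and>
                              w \<in> submanifold_tangent_space A Z (F p)}
        = tangent_space A (F p))"

end

theory Submission
  imports Defs
begin

text \<open>A continuous section over \<open>U\<close> is the same as a continuous map \<open>F\<close> on \<open>U \<times> [0,1]\<close> with
  \<open>F (u, 0) = fst u\<close> and \<open>F (u, 1) = snd u\<close>, so it is enough to replace \<open>F\<close> by a smooth map that is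
  transversal to \<open>Z\<close> and has the same ends; the sets \<open>U\<^sub>i\<close> of a cover need not be changed.
  After a reparametrisation \<open>F\<close> is the first projection for \<open>t < 1/3\<close> and the second one for
  \<open>t > 2/3\<close>; these are submersions. The rest is corrected successively in the boxes of a locally
  finite family of coordinate balls. In a box, where \<open>F\<close> takes values in one chart of \<open>X\<close>, it is
  replaced by \<open>F + \<beta> (g - F + \<alpha> x + v)\<close> with a bump function \<open>\<beta>\<close>, a polynomial approximation \<open>g\<close> of
  \<open>F\<close> and a small affine map \<open>x \<mapsto> \<alpha> x + v\<close>. For generic \<open>(\<alpha>, v)\<close> the new map is transversal to \<open>Z\<close>
  wherever it is smooth and \<open>\<beta> > 0\<close>: as \<open>Z\<close> has codimension 1, this only uses that a differentiable
  map sends a null set to a null set, not Sard's theorem. Where \<open>\<beta> = 0\<close> the 1-jet of \<open>F\<close>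
  does not change. Hence no point at which \<open>F\<close> is smooth and transversal is ever lost, although
  transversality to \<open>Z\<close> is not an open condition when \<open>Z\<close> is not closed.\<close>

section \<open>Smooth functions and bump functions\<close>

text \<open>The dimension count behind the generic choice: let d and e be the dimensions of the
  source and of X. At a point x with value y in Z, transversality fails iff the normal covector of Z
  at y annihilates all d partial derivatives. If the linear part of the perturbation varies only by
  x \<mapsto> (v \<bullet> x) w, with a fixed vector w that the covector does not annihilate, these
  d equations determine v, and then the value y determines the translation. So the bad parameters
  are the image of pairs (x, y) under a map between spaces of the same dimension d + e, and the y
  fill only a null set. With translations alone the target would have dimension e, and a
  differentiable image there of a null set in dimension d + e may well be fat. The reparametrisation
  also keeps the boundary out of the corrections: every box that is really corrected lies over 0 < t
  < 1, and boundary points are met only where the map is a projection. Since goodness is preserved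
  exactly and not up to an estimate, corrections have to be small in the uniform sense only, just
  enough to keep every box in its target chart.\<close>

lemma C_on_subset: "C_on k W f \<Longrightarrow> V \<subseteq> W \<Longrightarrow> C_on k V f"
  by (induction k arbitrary: f) (auto intro: continuous_on_subset)

lemma C_on_imp_continuous_on: "C_on k W f \<Longrightarrow> continuous_on W f"
  by (cases k) (auto intro!: continuous_at_imp_continuous_on differentiable_imp_continuous_within)

lemma C_on_SucD: "C_on (Suc k) W f \<Longrightarrow> C_on k W f"
proof (induction k arbitrary: f)
  case 0
  then show ?case using C_on_imp_continuous_on by fastforce
next
  case (Suc k)
  then show ?case by (metis C_on.simps(2))
qed

text \<open>\<open>frechet_derivative\<close> is a choice, and near \<open>x\<close> both functions
  have the same set of derivatives to choose from.\<close>

lemma frechet_derivative_cong_open: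
  assumes "open W" "x \<in> W" "\<And>y. y \<in> W \<Longrightarrow> f y = g y"
  shows "frechet_derivative f (at x) = frechet_derivative g (at x)"
proof -
  have "(f has_derivative D) (at x) \<longleftrightarrow> (g has_derivative D) (at x)" for D
    using assms has_derivative_transform_within_open[of _ D x UNIV W]
    by (metis (no_types, lifting))
  then show ?thesis by (simp add: frechet_derivative_def)
qed

lemma C_on_cong:
  assumes "open W" "\<And>y. y \<in> W \<Longrightarrow> f y = g y" "C_on k W f"
  shows "C_on k W g"
  using assms(2,3)
proof (induction k arbitrary: f g)
  case 0
  then show ?case by (simp cong: continuous_on_cong)
next
  case (Suc k)
  have "g differentiable at x" if "x \<in> W" for x
  proof -
    have "f differentiable at x" using Suc.prems that by simp
    then show ?thesis
      using Suc.prems(1) that assms(1) unfolding differentiable_def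
      by (metis (no_types, lifting) has_derivative_transform_within_open)
  qed
  moreover have "C_on k W (\<lambda>x. frechet_derivative g (at x) v)" for v
  proof (rule Suc.IH)
    show "C_on k W (\<lambda>x. frechet_derivative f (at x) v)" using Suc.prems(2) by simp
    show "frechet_derivative f (at x) v = frechet_derivative g (at x) v" if "x \<in> W" for x
      using frechet_derivative_cong_open[OF assms(1) that] Suc.prems(1) by metis
  qed
  ultimately show ?case by simp
qed

lemma C_on_const: "C_on k W (\<lambda>x. c)"
  by (induction k arbitrary: c) (auto simp: frechet_derivative_const)

lemma C_on_bounded_linear:
  assumes "bounded_linear f" shows "C_on k W f"
proof (cases k)
  case 0
  then show ?thesis using assms by (simp add: linear_continuous_on)
next
  case (Suc n)
  have "frechet_derivative f (at x) = f" for x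
    using assms bounded_linear_imp_has_derivative frechet_derivative_at by metis
  then show ?thesis
    using Suc assms by (auto simp: C_on_const intro: bounded_linear_imp_differentiable)
qed

text \<open>Lets the closure properties below work with explicit derivatives: \<open>D x\<close>
  coincides with \<open>frechet_derivative f (at x)\<close> on \<open>W\<close>, and
  \<open>C_on_cong\<close> carries the regularity over.\<close>

lemma C_on_SucI:
  assumes "open W" "\<And>x. x \<in> W \<Longrightarrow> (f has_derivative D x) (at x)"
    "\<And>v. C_on k W (\<lambda>x. D x v)"
  shows "C_on (Suc k) W f"
proof -
  have "C_on k W (\<lambda>x. frechet_derivative f (at x) v)" for v
    by (rule C_on_cong[OF assms(1) _ assms(3)[of v]]) (metis assms(2) frechet_derivative_at)
  then show ?thesis using assms(2) by (auto simp: differentiable_def)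
qed

lemma C_on_Suc_has_derivative:
  "C_on (Suc k) W f \<Longrightarrow> x \<in> W \<Longrightarrow> (f has_derivative frechet_derivative f (at x)) (at x)"
  by (simp add: frechet_derivative_works)

lemma C_on_add:
  assumes "open W" "C_on k W f" "C_on k W g"
  shows "C_on k W (\<lambda>x. f x + g x)"
  using assms(2,3)
proof (induction k arbitrary: f g)
  case (Suc k)
  show ?case
    by (rule C_on_SucI[OF assms(1) has_derivative_add[OF C_on_Suc_has_derivative C_on_Suc_has_derivative]])
      (use Suc in auto)
qed (auto intro: continuous_intros)

lemma C_on_sum:
  assumes "open W" "\<And>i. i \<in> I \<Longrightarrow> C_on k W (f i)"
  shows "C_on k W (\<lambda>x. \<Sum>i\<in>I. f i x)"
  using assms(2)
  by (induction I rule: infinite_finite_induct) (auto simp: C_on_const intro!: C_on_add[OF assms(1)])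

text \<open>Leibniz rule and induction: the derivative is a sum of two products with one
  differentiated factor each, and \<open>C_on_SucD\<close> lowers the order of the other
  factor.\<close>

lemma C_on_bilinear:
  assumes "bounded_bilinear prd" "open W" "C_on k W f" "C_on k W g"
  shows "C_on k W (\<lambda>x. prd (f x) (g x))"
  using assms(3,4)
proof (induction k arbitrary: f g)
  case 0
  then show ?case by (auto intro: bounded_bilinear.continuous_on[OF assms(1)])
next
  case (Suc k)
  show ?case
  proof (rule C_on_SucI[OF assms(2)])
    fix x assume "x \<in> W"
    then show "((\<lambda>x. prd (f x) (g x)) has_derivative
      (\<lambda>v. prd (f x) (frechet_derivative g (at x) v) + prd (frechet_derivative f (at x) v) (g x))) (at x)"
      by (intro bounded_bilinear.FDERIV[OF assms(1)] C_on_Suc_has_derivative[OF Suc.prems(1)]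
          C_on_Suc_has_derivative[OF Suc.prems(2)])
  next
    fix v
    show "C_on k W (\<lambda>x. prd (f x) (frechet_derivative g (at x) v) + prd (frechet_derivative f (at x) v) (g x))"
      by (intro C_on_add[OF assms(2)] Suc.IH C_on_SucD[OF Suc.prems(1)] C_on_SucD[OF Suc.prems(2)])
        (use Suc.prems in auto)
  qed
qed

lemmas C_on_scaleR = C_on_bilinear[OF bounded_bilinear_scaleR]
lemmas C_on_inner = C_on_bilinear[OF bounded_bilinear_inner]

lemma C_on_linear_compose:
  assumes "bounded_linear l" "open W" "C_on k W f"
  shows "C_on k W (\<lambda>x. l (f x))"
  using assms(3)
proof (induction k arbitrary: f)
  case 0
  then show ?case by (auto intro: bounded_linear.continuous_on[OF assms(1)])
next
  case (Suc k)
  show ?case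
    by (rule C_on_SucI[OF assms(2) bounded_linear.has_derivative[OF assms(1) C_on_Suc_has_derivative]])
      (use Suc in auto)
qed

lemma C_on_compose:
  assumes "open W" "open V" "f ` W \<subseteq> V" "C_on k W f" "C_on k V g"
  shows "C_on k W (\<lambda>x. g (f x))"
  using assms(4,5)
proof (induction k arbitrary: g)
  case 0
  then show ?case using assms(3) by (auto intro: continuous_on_compose2)
next
  case (Suc k)
  let ?D = "\<lambda>x v. frechet_derivative g (at (f x)) (frechet_derivative f (at x) v)"
  have f: "(f has_derivative frechet_derivative f (at x)) (at x)" if "x \<in> W" for x
    using C_on_Suc_has_derivative Suc.prems(1) that .
  have g: "(g has_derivative frechet_derivative g (at (f x))) (at (f x))" if "x \<in> W" for x
    using C_on_Suc_has_derivative Suc.prems(2) that assms(3) by blast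
  \<comment> \<open>The derivative of \<open>g\<close> occurs at a moving point and in a moving
    direction. Expanding the direction in \<open>Basis\<close> leaves only maps
    \<open>frechet_derivative g (at _) i\<close> with fixed \<open>i\<close>, composed with
    \<open>f\<close>, to which the induction hypothesis applies.\<close>
  have D: "(\<Sum>i\<in>Basis. (frechet_derivative f (at x) v \<bullet> i) *\<^sub>R frechet_derivative g (at (f x)) i) = ?D x v"
    if "x \<in> W" for x v
  proof -
    interpret linear "frechet_derivative g (at (f x))"
      using g[OF that] has_derivative_linear by blast
    show ?thesis
      by (subst (2) euclidean_representation[symmetric, of "frechet_derivative f (at x) v"])
        (simp only: sum scale)
  qed
  show ?case
  proof (rule C_on_SucI[OF assms(1)])
    show "((\<lambda>x. g (f x)) has_derivative ?D x) (at x)" if "x \<in> W" for x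
      using diff_chain_at[OF f[OF that] g[OF that]] by (simp add: comp_def)
    fix v
    have "C_on k W (\<lambda>x. \<Sum>i\<in>Basis. (frechet_derivative f (at x) v \<bullet> i) *\<^sub>R frechet_derivative g (at (f x)) i)"
      using Suc.prems
      by (intro C_on_sum[OF assms(1)] C_on_scaleR[OF assms(1)] C_on_inner[OF assms(1)] C_on_const
          Suc.IH C_on_SucD[OF Suc.prems(1)]) auto
    then show "C_on k W (\<lambda>x. ?D x v)"
      by (rule C_on_cong[OF assms(1), rotated]) (use D in auto)
  qed
qed

lemma C_on_inverse: "C_on k (- {0::real}) inverse"
proof (induction k)
  case 0
  then show ?case by (auto intro: continuous_intros)
next
  case (Suc k)
  have op: "open (- {0::real})" by auto
  show ?case
  proof (rule C_on_SucI[OF op])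
    fix x :: real assume "x \<in> - {0}"
    then show "(inverse has_derivative (\<lambda>v. (- v) *\<^sub>R (inverse x *\<^sub>R inverse x))) (at x)"
      using has_derivative_inverse'[of x UNIV] by (simp add: mult_ac)
  next
    fix v :: real
    show "C_on k (- {0}) (\<lambda>x. (- v) *\<^sub>R (inverse x *\<^sub>R inverse x))"
      by (intro C_on_scaleR[OF op] C_on_const Suc)
  qed
qed

text \<open>The functions \<open>exp (- 1 / x) / x ^ n\<close>, extended by 0, are all needed, since the derivative
  of one of them is a linear combination of others.\<close>

definition flat_fun :: "nat \<Rightarrow> real \<Rightarrow> real" where
  "flat_fun n x = (if x \<le> 0 then 0 else exp (- (1 / x)) / x ^ n)"

lemma flat_fun_tendsto: "((\<lambda>x. flat_fun n x) \<longlongrightarrow> 0) (at 0)"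
proof -
  have "((\<lambda>x::real. exp (- (1 / x)) / x ^ n) \<longlongrightarrow> 0) (at_right 0)"
  proof -
    have "((\<lambda>y::real. y ^ n / exp y) \<longlongrightarrow> 0) at_top" by (rule tendsto_power_div_exp_0)
    then have "((\<lambda>x::real. inverse x ^ n / exp (inverse x)) \<longlongrightarrow> 0) (at_right 0)"
      by (rule filterlim_compose[OF _ filterlim_inverse_at_top_right])
    then show ?thesis
      by (simp add: exp_minus field_simps)
  qed
  then have "(flat_fun n \<longlongrightarrow> 0) (at_right 0)"
    by (rule Lim_transform_eventually) (auto simp: flat_fun_def eventually_at_right_less
        intro!: eventually_mono[OF eventually_at_right_less])
  moreover have "(flat_fun n \<longlongrightarrow> 0) (at_left 0)"
    by (rule Lim_transform_eventually[OF tendsto_const])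
      (auto simp: flat_fun_def eventually_at_filter)
  ultimately show ?thesis by (simp add: filterlim_split_at)
qed

lemma flat_fun_has_derivative:
  "(flat_fun n has_real_derivative (flat_fun (n + 2) x - real n * flat_fun (n + 1) x)) (at x)"
proof -
  consider "x < 0" | "x = 0" | "x > 0" by linarith
  then show ?thesis
  proof cases
    case 1
    have "((\<lambda>x. 0) has_real_derivative 0) (at x)" by simp
    then have "(flat_fun n has_real_derivative 0) (at x)"
      by (rule has_field_derivative_transform_within_open[where S = "{..<0}"])
        (use 1 in \<open>auto simp: flat_fun_def\<close>)
    then show ?thesis using 1 by (simp add: flat_fun_def)
  next
    case 2
    \<comment> \<open>At 0 the difference quotient of \<open>flat_fun n\<close> is
      \<open>flat_fun (Suc n)\<close>, whose limit is known.\<close>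
    have "((\<lambda>h. (flat_fun n (0 + h) - flat_fun n 0) / h) \<longlongrightarrow> 0) (at 0)"
      using flat_fun_tendsto[of "Suc n"]
      by (rule Lim_transform_eventually) (auto simp: flat_fun_def field_simps eventually_at_filter)
    then show ?thesis using 2 by (simp add: DERIV_def flat_fun_def)
  next
    case 3
    have "((\<lambda>x. exp (- (1 / x)) / x ^ n) has_real_derivative
        (flat_fun (n + 2) x - real n * flat_fun (n + 1) x)) (at x)"
      using 3
      by (auto intro!: derivative_eq_intros simp: flat_fun_def, cases n,
          auto simp: field_simps power2_eq_square)
    then show ?thesis
      by (rule has_field_derivative_transform_within_open[where S = "{0<..}"])
        (use 3 in \<open>auto simp: flat_fun_def\<close>)
  qed
qed

lemma C_on_flat_fun: "C_on k UNIV (flat_fun n)"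
proof (induction k arbitrary: n)
  case 0
  then show ?case
    using flat_fun_has_derivative[of n] DERIV_isCont continuous_at_imp_continuous_on by (metis C_on.simps(1))
next
  case (Suc k)
  show ?case
  proof (rule C_on_SucI)
    fix x :: real
    show "(flat_fun n has_derivative (\<lambda>v. v *\<^sub>R (flat_fun (n + 2) x + (- real n) *\<^sub>R flat_fun (n + 1) x))) (at x)"
      using flat_fun_has_derivative[of n x] by (simp add: has_field_derivative_def mult_commute_abs)
  next
    fix v :: real
    show "C_on k UNIV (\<lambda>x. v *\<^sub>R (flat_fun (n + 2) x + (- real n) *\<^sub>R flat_fun (n + 1) x))"
      by (intro C_on_scaleR C_on_add C_on_const Suc) auto
  qed auto
qed

text \<open>The quotient u / (u + v), with u positive exactly inside radius 2r and v positive
  exactly outside radius r; the two regions cover the space, so the denominator is positive. Squared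
  distances keep the arguments of \<open>flat_fun\<close> smooth at the centre.\<close>

lemma smooth_bump:
  fixes x0 :: "'d::euclidean_space"
  assumes "r > 0"
  obtains \<beta> :: "'d \<Rightarrow> real" where "\<And>k. C_on k UNIV \<beta>" "\<And>x. 0 \<le> \<beta> x" "\<And>x. \<beta> x \<le> 1"
    "\<And>x. x \<in> cball x0 r \<Longrightarrow> \<beta> x = 1" "\<And>x. x \<notin> ball x0 (2 * r) \<Longrightarrow> \<beta> x = 0"
proof -
  define q where "q x = (x - x0) \<bullet> (x - x0)" for x
  define u where "u x = flat_fun 0 ((2 * r)\<^sup>2 + - 1 *\<^sub>R q x)" for x
  define v where "v x = flat_fun 0 (q x + - (r\<^sup>2))" for x
  define \<beta> where "\<beta> x = u x *\<^sub>R inverse (u x + v x)" for x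
  have pos: "flat_fun 0 s > 0 \<longleftrightarrow> s > 0" "flat_fun 0 s \<ge> 0" "flat_fun 0 s = 0 \<longleftrightarrow> s \<le> 0" for s
    by (auto simp: flat_fun_def)
  have r4: "(2 * r)\<^sup>2 > r\<^sup>2" using assms by (simp add: power_mult_distrib)
  have uv: "u x + v x > 0" for x
  proof (cases "q x < (2 * r)\<^sup>2")
    case True
    then show ?thesis using pos unfolding u_def v_def by (intro add_pos_nonneg) auto
  next
    case False
    then have "r\<^sup>2 < q x" using r4 by linarith
    then show ?thesis using pos unfolding u_def v_def by (intro add_nonneg_pos) auto
  qed
  have Cq: "C_on k UNIV q" for k
  proof -
    have "C_on k UNIV (\<lambda>x. x + - x0)"
      by (intro C_on_add C_on_const C_on_bounded_linear) (auto intro: bounded_linear_ident)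
    then show ?thesis unfolding q_def by (intro C_on_inner) auto
  qed
  have Cu: "C_on k UNIV u" for k
    unfolding u_def
    by (intro C_on_compose[OF _ _ _ _ C_on_flat_fun] C_on_add C_on_const C_on_scaleR Cq open_UNIV subset_UNIV)
  have Cv: "C_on k UNIV v" for k
    unfolding v_def
    by (intro C_on_compose[OF _ _ _ _ C_on_flat_fun] C_on_add C_on_const C_on_scaleR Cq open_UNIV subset_UNIV)
  have "C_on k UNIV \<beta>" for k
    unfolding \<beta>_def
    by (intro C_on_scaleR Cu C_on_compose[OF _ _ _ _ C_on_inverse] C_on_add Cv)
      (use uv in \<open>auto simp: less_le\<close>)
  moreover have "0 \<le> u x" "0 \<le> v x" for x using pos by (auto simp: u_def v_def)
  then have "0 \<le> \<beta> x" "\<beta> x \<le> 1" for x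
    using uv[of x] by (auto simp: \<beta>_def divide_simps)
  moreover have "\<beta> x = 1" if "x \<in> cball x0 r" for x
  proof -
    have "q x \<le> r\<^sup>2"
      using that by (simp add: q_def dist_norm norm_minus_commute power_mono flip: power2_norm_eq_inner)
    then have "v x = 0" by (simp add: v_def pos)
    then show ?thesis using uv[of x] by (simp add: \<beta>_def)
  qed
  moreover have "\<beta> x = 0" if "x \<notin> ball x0 (2 * r)" for x
  proof -
    have "q x \<ge> (2 * r)\<^sup>2"
      using power_mono[of "2 * r" "norm (x - x0)" 2] that assms
      by (simp add: q_def dist_norm norm_minus_commute flip: power2_norm_eq_inner)
    then have "u x = 0" by (simp add: u_def pos)
    then show ?thesis by (simp add: \<beta>_def)
  qed
  ultimately show ?thesis using that by blast
qed

section \<open>Generic affine perturbations\<close>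

lemma negligible_Times_right:
  fixes A :: "'d::euclidean_space set" and B :: "'e::euclidean_space set"
  assumes "negligible B"
  shows "negligible (A \<times> B)"
proof -
  obtain N where N: "N \<in> null_sets lborel" "B \<subseteq> N"
    using assms by (auto simp: negligible_iff_null_sets null_sets_completion_iff2)
  then have "UNIV \<times> N \<in> null_sets (lborel \<Otimes>\<^sub>M lborel)"
    by (intro lborel.times_in_null_sets2) auto
  then have "negligible (UNIV \<times> N :: ('d \<times> 'e) set)"
    by (metis lborel_prod negligible_iff_null_sets null_sets_completionI)
  then show ?thesis
    by (rule negligible_subset) (use N in auto)
qed

text \<open>Projection along a compact factor is a closed map. This makes the set of bad parameters
  closed once the points x and y are confined to compact sets.\<close>

lemma closed_compact_projection:
  fixes T :: "('a::t2_space \<times> 'b::topological_space) set"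
  assumes "compact C" "closed T" "T \<subseteq> C \<times> UNIV"
  shows "closed (snd ` T)"
proof -
  have "closedin (top_of_set (C \<times> UNIV)) T"
    using assms by (intro closed_subset)
  moreover have "top_of_set (C \<times> UNIV) = prod_topology (top_of_set C) (euclidean :: 'b topology)"
    using prod_topology_subtopology_eu[of C "UNIV :: 'b set"] by simp
  moreover have "closed_map (prod_topology (top_of_set C) (euclidean :: 'b topology)) euclidean snd"
    using assms(1) by (intro closed_map_snd) (simp add: compact_space_subtopology)
  ultimately show ?thesis by (auto simp: closed_map_def)
qed

lemma differentiable_on_inner:
  assumes "f differentiable_on S" "g differentiable_on S"
  shows "(\<lambda>x. f x \<bullet> g x) differentiable_on S"
  using assms by (auto simp: differentiable_on_def intro: differentiable_inner)

lemma differentiable_on_Pair: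
  assumes "f differentiable_on S" "g differentiable_on S"
  shows "(\<lambda>x. (f x, g x)) differentiable_on S"
  using assms unfolding differentiable_on_def differentiable_def by (blast intro: has_derivative_Pair)

lemma differentiable_on_sum:
  assumes "\<And>i. i \<in> I \<Longrightarrow> f i differentiable_on S"
  shows "(\<lambda>x. \<Sum>i\<in>I. f i x) differentiable_on S"
  using assms by (induction I rule: infinite_finite_induct) auto

text \<open>The parameters \<open>v\<close> and \<open>b\<close> can be recovered from \<open>x\<close> and \<open>y\<close>, so that the bad
  pairs form the image of the null set \<open>\<Omega> \<times> Y\<close> under a differentiable map.\<close>

lemma negligible_bad_slice:
  fixes f :: "'d::euclidean_space \<Rightarrow> 'e::euclidean_space"
  assumes "open \<Omega>"
    and f: "\<And>x. x \<in> \<Omega> \<Longrightarrow> f differentiable at x"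
    and Df: "\<And>i. i \<in> Basis \<Longrightarrow> (\<lambda>x. Df x i) differentiable_on \<Omega>"
    and \<beta>: "\<And>x. x \<in> \<Omega> \<Longrightarrow> \<beta> differentiable at x"
    and D\<beta>: "\<And>i. i \<in> Basis \<Longrightarrow> (\<lambda>x. D\<beta> x i) differentiable_on \<Omega>"
    and pos: "\<And>x. x \<in> \<Omega> \<Longrightarrow> \<beta> x > (0::real)"
    and Y: "negligible Y" "\<eta> differentiable_on Y" "\<And>y. y \<in> Y \<Longrightarrow> \<eta> y \<bullet> w \<noteq> 0"
  shows "negligible {(v, b). \<exists>x\<in>\<Omega>. \<exists>y\<in>Y. y = f x + \<beta> x *\<^sub>R ((v \<bullet> x) *\<^sub>R w + b) \<and>
    (\<forall>i\<in>Basis. \<eta> y \<bullet> (Df x i + D\<beta> x i *\<^sub>R ((v \<bullet> x) *\<^sub>R w + b) + \<beta> x *\<^sub>R ((v \<bullet> i) *\<^sub>R w)) = 0)}"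
    (is "negligible ?B")
proof -
  \<comment> \<open>Inverse of the parametrisation: \<open>z (x, y)\<close> is the perturbation (v
    \<bullet> x) w + b at x, read off from the value y. The critical equation for \<open>i\<close>
    is then linear in v \<bullet> i with coefficient
    \<open>\<beta> x * (\<eta> y \<bullet> w)\<close>, and \<open>c i\<close> solves it; removing
    the part due to v from \<open>z\<close> leaves b.\<close>
  define z where "z = (\<lambda>(x, y). inverse (\<beta> x) *\<^sub>R (y - f x))"
  define c where "c i = (\<lambda>(x, y). - (\<eta> y \<bullet> (Df x i + D\<beta> x i *\<^sub>R z (x, y))) * inverse (\<beta> x * (\<eta> y \<bullet> w)))" for i
  define V where "V p = (\<Sum>i\<in>Basis. c i p *\<^sub>R i)" for p
  define \<Psi> where "\<Psi> p = (V p, z p - (V p \<bullet> fst p) *\<^sub>R w)" for p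
  let ?S = "\<Omega> \<times> Y"
  have fst: "(\<lambda>p. g (fst p)) differentiable_on ?S" if "g differentiable_on \<Omega>"
    for g :: "'d \<Rightarrow> 'x::euclidean_space"
    by (rule differentiable_on_compose[of fst, unfolded comp_def])
      (auto intro: differentiable_on_subset[OF that] bounded_linear_imp_differentiable_on bounded_linear_fst)
  have snd: "(\<lambda>p. g (snd p)) differentiable_on ?S" if "g differentiable_on Y"
    for g :: "'e \<Rightarrow> 'x::euclidean_space"
    by (rule differentiable_on_compose[of snd, unfolded comp_def])
      (auto intro: differentiable_on_subset[OF that] bounded_linear_imp_differentiable_on bounded_linear_snd)
  have fd: "f differentiable_on \<Omega>" "\<beta> differentiable_on \<Omega>"
    using f \<beta> by (auto simp: differentiable_on_def intro: differentiable_at_withinI)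
  have ident: "fst differentiable_on ?S" "snd differentiable_on ?S"
    by (auto intro: bounded_linear_imp_differentiable_on bounded_linear_fst bounded_linear_snd)
  note parts = fst[OF fd(1)] fst[OF fd(2)] fst[OF Df] fst[OF D\<beta>] snd[OF Y(2)] ident
  have zd: "z differentiable_on ?S"
    unfolding z_def case_prod_unfold
    by (intro differentiable_on_scaleR differentiable_on_inverse differentiable_on_diff parts)
      (use pos in \<open>auto simp: less_le\<close>)
  have nz: "\<beta> (fst p) * (\<eta> (snd p) \<bullet> w) \<noteq> 0" if "p \<in> ?S" for p
    using pos[of "fst p"] Y(3)[of "snd p"] that by auto
  have cd: "c i differentiable_on ?S" if "i \<in> Basis" for i
    unfolding c_def case_prod_unfold prod.collapse
    by (intro differentiable_on_mult differentiable_on_minus differentiable_on_inner differentiable_on_add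
        differentiable_on_scaleR differentiable_on_inverse differentiable_on_const parts that zd nz)
  have "\<Psi> differentiable_on ?S"
    unfolding \<Psi>_def V_def
    by (intro differentiable_on_Pair differentiable_on_sum differentiable_on_scaleR differentiable_on_diff
        cd zd differentiable_on_const differentiable_on_inner ident)
  \<comment> \<open>Source and target of \<open>\<Psi>\<close> have the same dimension, so its
    differentiability makes images of null sets null.\<close>
  then have neg: "negligible (\<Psi> ` ?S)"
    by (intro negligible_differentiable_image_negligible negligible_Times_right Y) auto
  have "?B \<subseteq> \<Psi> ` ?S"
  proof clarsimp
    fix v b x
    let ?y = "f x + \<beta> x *\<^sub>R ((v \<bullet> x) *\<^sub>R w + b)"
    assume x: "x \<in> \<Omega>" and y: "?y \<in> Y"
      and crit: "\<forall>i\<in>Basis. \<eta> ?y \<bullet> (Df x i + D\<beta> x i *\<^sub>R ((v \<bullet> x) *\<^sub>R w + b) + (\<beta> x * (v \<bullet> i)) *\<^sub>R w) = 0"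
    have z: "z (x, ?y) = (v \<bullet> x) *\<^sub>R w + b" using pos[OF x] by (simp add: z_def)
    have "c i (x, ?y) = v \<bullet> i" if "i \<in> Basis" for i
    proof -
      have "\<eta> ?y \<bullet> (Df x i + D\<beta> x i *\<^sub>R z (x, ?y)) = - ((v \<bullet> i) * (\<beta> x * (\<eta> ?y \<bullet> w)))"
        using bspec[OF crit that] unfolding z by (simp add: inner_add_right algebra_simps)
      then show ?thesis using pos[OF x] Y(3)[OF y] unfolding c_def by (simp add: field_simps)
    qed
    then have "V (x, ?y) = v"
      unfolding V_def by (simp add: euclidean_representation)
    then have "\<Psi> (x, ?y) = (v, b)" by (simp add: \<Psi>_def z)
    then show "(v, b) \<in> \<Psi> ` ?S" using x y by (metis SigmaI image_eqI)
  qed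
  then show ?thesis using neg negligible_subset by blast
qed

text \<open>A zero set in the open set \<open>E\<close> is only relatively closed; a compact
  exhaustion of \<open>E\<close> cuts it into compact pieces, from which closed bad sets can be
  formed.\<close>

lemma sigma_compact_relclosed:
  fixes E :: "'e::euclidean_space set"
  assumes "open E" "continuous_on E h"
  shows "\<exists>Q :: nat \<Rightarrow> 'e set. (\<forall>n. compact (Q n)) \<and> (\<Union>n. Q n) = {y\<in>E. h y = (0::real)}"
proof -
  obtain D where D: "\<And>n. compact (D n)" "\<And>n. D n \<subseteq> E" "\<Union>(range (D::nat \<Rightarrow> 'e set)) = E"
    by (rule open_Union_compact_subsets[OF assms(1)]) (rule that)
  have "compact {y \<in> D n. h y = 0}" for n
  proof -
    have "closed (D n \<inter> h -` {0})"
      by (rule continuous_closed_preimage[OF continuous_on_subset[OF assms(2) D(2)] compact_imp_closed[OF D(1)]]) simp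
    then have "compact (D n \<inter> (D n \<inter> h -` {0}))" using D(1) by (intro compact_Int_closed) auto
    moreover have "D n \<inter> (D n \<inter> h -` {0}) = {y \<in> D n. h y = 0}" by auto
    ultimately show ?thesis by simp
  qed
  then show ?thesis using D by (intro exI[of _ "\<lambda>n. {y \<in> D n. h y = 0}"]) auto
qed

text \<open>Parameters avoiding the countably many bad sets are found with Baire's theorem. A bad set has
  empty interior since its slices in the directions \<open>(v, b) \<mapsto> (v \<bullet> x) w + b\<close> are negligible.\<close>

lemma generic_perturbation:
  fixes f :: "'d::euclidean_space \<Rightarrow> 'e::euclidean_space" and h :: "'i \<Rightarrow> 'e \<Rightarrow> real"
  assumes \<Omega>: "open \<Omega>"
    and f: "\<And>x. x \<in> \<Omega> \<Longrightarrow> (f has_derivative Df x) (at x)"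
    and Df: "\<And>i. i \<in> Basis \<Longrightarrow> (\<lambda>x. Df x i) differentiable_on \<Omega>"
    and \<beta>: "\<And>x. x \<in> \<Omega> \<Longrightarrow> (\<beta> has_derivative D\<beta> x) (at x)"
    and D\<beta>: "\<And>i. i \<in> Basis \<Longrightarrow> (\<lambda>x. D\<beta> x i) differentiable_on \<Omega>"
    and pos: "\<And>x. x \<in> \<Omega> \<Longrightarrow> \<beta> x > (0::real)"
    and M: "countable M"
    and E: "\<And>m. m \<in> M \<Longrightarrow> open (E m)"
    and h: "\<And>m. m \<in> M \<Longrightarrow> continuous_on (E m) (h m)"
    and neg: "\<And>m. m \<in> M \<Longrightarrow> negligible {y \<in> E m. h m y = 0}"
    and \<eta>: "\<And>m. m \<in> M \<Longrightarrow> \<eta> m differentiable_on E m"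
    and \<eta>0: "\<And>m y. m \<in> M \<Longrightarrow> y \<in> E m \<Longrightarrow> \<eta> m y \<noteq> 0"
    and "\<epsilon> > 0"
  obtains \<alpha> :: "'d \<Rightarrow>\<^sub>L 'e" and b where "norm \<alpha> < \<epsilon>" "norm b < \<epsilon>"
    "\<And>m x y. m \<in> M \<Longrightarrow> x \<in> \<Omega> \<Longrightarrow> y = f x + \<beta> x *\<^sub>R (blinfun_apply \<alpha> x + b) \<Longrightarrow> y \<in> E m \<Longrightarrow> h m y = 0 \<Longrightarrow>
      \<exists>i\<in>Basis. \<eta> m y \<bullet> (Df x i + D\<beta> x i *\<^sub>R (blinfun_apply \<alpha> x + b) + \<beta> x *\<^sub>R blinfun_apply \<alpha> i) \<noteq> 0"
proof -
  define F where "F P x = f x + \<beta> x *\<^sub>R (blinfun_apply (fst P) x + snd P)" for P :: "('d \<Rightarrow>\<^sub>L 'e) \<times> 'e" and x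
  define DF where "DF P x i = Df x i + D\<beta> x i *\<^sub>R (blinfun_apply (fst P) x + snd P) + \<beta> x *\<^sub>R blinfun_apply (fst P) i"
    for P :: "('d \<Rightarrow>\<^sub>L 'e) \<times> 'e" and x i
  have cont: "continuous_on \<Omega> f" "continuous_on \<Omega> \<beta>"
    by (rule has_derivative_continuous_on[OF has_derivative_at_withinI[OF f]], assumption)
      (rule has_derivative_continuous_on[OF has_derivative_at_withinI[OF \<beta>]], assumption)
  have contD: "continuous_on \<Omega> (\<lambda>x. Df x i)" "continuous_on \<Omega> (\<lambda>x. D\<beta> x i)" if "i \<in> Basis" for i
    by (rule differentiable_imp_continuous_on[OF Df[OF that]])
      (rule differentiable_imp_continuous_on[OF D\<beta>[OF that]])
  obtain K where K: "\<And>n. compact (K n)" "\<And>n. K n \<subseteq> \<Omega>" "\<Union>(range (K::nat \<Rightarrow> 'd set)) = \<Omega>"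
    by (rule open_Union_compact_subsets[OF \<Omega>]) (rule that)
  \<comment> \<open>A slice requires one direction \<open>w\<close> with
    \<open>\<eta> m y \<bullet> w \<noteq> 0\<close> for all \<open>y\<close> concerned. As
    \<open>\<eta> m\<close> has no zero, the sets \<open>E' m w\<close> with \<open>w\<close> in
    \<open>Basis\<close> cover \<open>E m\<close>.\<close>
  define E' where "E' m w = {y \<in> E m. \<eta> m y \<bullet> w \<noteq> 0}" for m w
  have \<eta>c: "continuous_on (E m) (\<eta> m)" if "m \<in> M" for m
    using \<eta>[OF that] by (rule differentiable_imp_continuous_on)
  have "open (E' m w)" if "m \<in> M" for m w
  proof -
    have "open (E m \<inter> (\<lambda>y. \<eta> m y \<bullet> w) -` (- {0}))"
      using E[OF that] \<eta>c[OF that] by (intro continuous_open_preimage) (auto intro: continuous_intros)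
    moreover have "E m \<inter> (\<lambda>y. \<eta> m y \<bullet> w) -` (- {0}) = E' m w" by (auto simp: E'_def)
    ultimately show ?thesis by simp
  qed
  note openE' = this
  define isQ where "isQ m w Q \<longleftrightarrow> (\<forall>n. compact (Q n)) \<and> (\<Union>n. Q n) = {y\<in>E' m w. h m y = 0}"
    for m w and Q :: "nat \<Rightarrow> 'e set"
  have "\<exists>Q. isQ m w Q" if "m \<in> M" for m w
  proof -
    have "continuous_on (E' m w) (h m)" by (rule continuous_on_subset[OF h[OF that]]) (auto simp: E'_def)
    then show ?thesis unfolding isQ_def by (rule sigma_compact_relclosed[OF openE'[OF that]])
  qed
  then obtain Q where "\<And>m w. m \<in> M \<Longrightarrow> isQ m w (Q m w)" by metis
  then have Q: "compact (Q m w n)" "(\<Union>n. Q m w n) = {y\<in>E' m w. h m y = 0}" if "m \<in> M" for m w n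
    using that by (simp_all only: isQ_def)
  \<comment> \<open>Confining x to \<open>K n\<close> and y to \<open>Q m w k\<close> makes each of
    these sets closed, at the price of countably many indices.\<close>
  define bad where "bad = (\<lambda>(m, w, n, k). {P. \<exists>x\<in>K n. \<exists>y\<in>Q m w k. y = F P x \<and> (\<forall>i\<in>Basis. \<eta> m y \<bullet> DF P x i = 0)})"
  let ?I = "M \<times> (Basis::'e set) \<times> (UNIV::nat set) \<times> (UNIV::nat set)"
  have closed_bad: "closed (bad (m, w, n, k))" if "m \<in> M" for m w n k
  proof -
    let ?C = "K n \<times> Q m w k"
    let ?X = "?C \<times> (UNIV :: (('d \<Rightarrow>\<^sub>L 'e) \<times> 'e) set)"
    have QE: "Q m w k \<subseteq> E m" using Q(2)[OF that, of w] by (auto simp: E'_def)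
    have cl: "closed ?X" using K(1) Q(1)[OF that] by (intro closed_Times) (auto intro: compact_imp_closed)
    have c1: "continuous_on ?X (\<lambda>q. g (fst (fst q)))" if "continuous_on \<Omega> g" for g :: "'d \<Rightarrow> 'x::euclidean_space"
      by (rule continuous_on_compose2[OF that]) (use K(2)[of n] in \<open>auto intro!: continuous_intros\<close>)
    have c2: "continuous_on ?X (\<lambda>q. \<eta> m (snd (fst q)))"
      by (rule continuous_on_compose2[OF \<eta>c[OF that]]) (use QE in \<open>auto intro!: continuous_intros\<close>)
    have cF: "continuous_on ?X (\<lambda>q. F (snd q) (fst (fst q)))"
      unfolding F_def by (intro continuous_intros c1[OF cont(1)] c1[OF cont(2)])
    have cD: "continuous_on ?X (\<lambda>q. \<eta> m (snd (fst q)) \<bullet> DF (snd q) (fst (fst q)) i)" if "i \<in> Basis" for i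
      unfolding DF_def
      by (intro continuous_intros c2 c1[OF cont(2)] c1[OF contD(1)[OF that]] c1[OF contD(2)[OF that]])
    let ?T = "{q \<in> ?X. snd (fst q) - F (snd q) (fst (fst q)) = 0} \<inter>
      (\<Inter>i\<in>Basis. {q \<in> ?X. \<eta> m (snd (fst q)) \<bullet> DF (snd q) (fst (fst q)) i = 0})"
    have pre: "closed {q \<in> ?X. g q = 0}" if "continuous_on ?X g"
      for g :: "_ \<Rightarrow> 'x::real_normed_vector"
    proof -
      have "closed (?X \<inter> g -` {0})" by (rule continuous_closed_preimage[OF that cl]) auto
      moreover have "?X \<inter> g -` {0} = {q \<in> ?X. g q = 0}" by auto
      ultimately show ?thesis by simp
    qed
    have "closed ?T"
      by (intro closed_Int closed_INT ballI pre cD continuous_intros cF)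
    then have "closed (snd ` ?T)"
      by (rule closed_compact_projection[OF compact_Times[OF K(1) Q(1)[OF that]]]) blast
    moreover have "snd ` ?T = bad (m, w, n, k)"
      unfolding bad_def by (force simp: image_iff)
    ultimately show ?thesis by simp
  qed
  have int_bad: "interior (bad (m, w, n, k)) = {}" if "m \<in> M" for m w n k
  proof (rule ccontr)
    assume "interior (bad (m, w, n, k)) \<noteq> {}"
    then obtain P0 where P0: "P0 \<in> interior (bad (m, w, n, k))" by auto
    \<comment> \<open>An affine slice through the interior point \<open>P0\<close>. Since
      \<open>F\<close> is affine in the parameter, the slice of the bad set is a bad set for the
      base map \<open>F P0\<close> in place of \<open>f\<close>, so it is null; but it contains an
      open neighbourhood of 0.\<close>
    define T where "T p = P0 + (blinfun_scaleR_left w o\<^sub>L blinfun_inner_right (fst p), snd p)" for p :: "'d \<times> 'e"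
    let ?f = "F P0" and ?Df = "DF P0"
    have Fd: "(?f has_derivative ?Df x) (at x)" if "x \<in> \<Omega>" for x
      unfolding F_def DF_def
      by (rule derivative_eq_intros f[OF that] \<beta>[OF that] | simp)+
        (auto simp: fun_eq_iff algebra_simps)
    let ?N = "{(v, b). \<exists>x\<in>\<Omega>. \<exists>y\<in>{y \<in> E m. h m y = 0 \<and> \<eta> m y \<bullet> w \<noteq> 0}. y = ?f x + \<beta> x *\<^sub>R ((v \<bullet> x) *\<^sub>R w + b) \<and>
      (\<forall>i\<in>Basis. \<eta> m y \<bullet> (?Df x i + D\<beta> x i *\<^sub>R ((v \<bullet> x) *\<^sub>R w + b) + \<beta> x *\<^sub>R ((v \<bullet> i) *\<^sub>R w)) = 0)}"
    have fd: "f differentiable_on \<Omega>" "\<beta> differentiable_on \<Omega>"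
      using f \<beta> by (auto simp: differentiable_on_def differentiable_def intro: has_derivative_at_withinI)
    have "negligible ?N"
    proof (rule negligible_bad_slice[OF \<Omega>])
      show "(\<lambda>x. ?Df x i) differentiable_on \<Omega>" if "i \<in> Basis" for i
        unfolding DF_def using that
        by (intro differentiable_on_add differentiable_on_scaleR Df D\<beta> fd differentiable_on_const
            bounded_linear_imp_differentiable_on blinfun.bounded_linear_right)
      show "negligible {y \<in> E m. h m y = 0 \<and> \<eta> m y \<bullet> w \<noteq> 0}"
        by (rule negligible_subset[OF neg[OF that]]) auto
      show "\<eta> m differentiable_on {y \<in> E m. h m y = 0 \<and> \<eta> m y \<bullet> w \<noteq> 0}"
        by (rule differentiable_on_subset[OF \<eta>[OF that]]) auto
    qed (use Fd \<beta> D\<beta> pos in \<open>auto simp: differentiable_def\<close>)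
    moreover have "T -` bad (m, w, n, k) \<subseteq> ?N"
    proof
      fix p assume p: "p \<in> T -` bad (m, w, n, k)"
      obtain v b where vb: "p = (v, b)" by fastforce
      from p obtain x y where xy: "x \<in> K n" "y \<in> Q m w k" "y = F (T (v, b)) x" "\<forall>i\<in>Basis. \<eta> m y \<bullet> DF (T (v, b)) x i = 0"
        by (auto simp: bad_def vb)
      have y: "y \<in> E m" "h m y = 0" "\<eta> m y \<bullet> w \<noteq> 0" using xy(2) Q(2)[OF that, of w] by (auto simp: E'_def)
      have "F (T (v, b)) x = ?f x + \<beta> x *\<^sub>R ((v \<bullet> x) *\<^sub>R w + b)"
        by (simp add: F_def T_def blinfun.add_left algebra_simps)
      moreover have "DF (T (v, b)) x i = ?Df x i + D\<beta> x i *\<^sub>R ((v \<bullet> x) *\<^sub>R w + b) + \<beta> x *\<^sub>R ((v \<bullet> i) *\<^sub>R w)" for i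
        by (simp add: DF_def T_def blinfun.add_left algebra_simps)
      ultimately have "\<exists>x\<in>\<Omega>. \<exists>y\<in>{y \<in> E m. h m y = 0 \<and> \<eta> m y \<bullet> w \<noteq> 0}. y = ?f x + \<beta> x *\<^sub>R ((v \<bullet> x) *\<^sub>R w + b) \<and>
          (\<forall>i\<in>Basis. \<eta> m y \<bullet> (?Df x i + D\<beta> x i *\<^sub>R ((v \<bullet> x) *\<^sub>R w + b) + \<beta> x *\<^sub>R ((v \<bullet> i) *\<^sub>R w)) = 0)"
        using xy y K(2) by (intro bexI[of _ x] bexI[of _ y]) auto
      then show "p \<in> ?N" unfolding vb by simp
    qed
    ultimately have "negligible (T -` interior (bad (m, w, n, k)))"
      using interior_subset by (blast intro: negligible_subset)
    moreover have "continuous_on UNIV T"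
      unfolding T_def
      by (intro continuous_intros bounded_linear.continuous_on[OF bounded_linear_blinfun_inner_right])
    then have "open (T -` interior (bad (m, w, n, k)))"
      by (simp add: open_vimage)
    moreover have "0 \<in> T -` interior (bad (m, w, n, k))"
    proof -
      have "blinfun_scaleR_left w o\<^sub>L blinfun_inner_right (0::'d) = 0" by (rule blinfun_eqI) simp
      then show ?thesis using P0 by (simp add: T_def flip: zero_prod_def)
    qed
    ultimately show False using open_not_negligible by blast
  qed
  have "(euclidean :: (('d \<Rightarrow>\<^sub>L 'e) \<times> 'e) topology) interior_of \<Union>(bad ` ?I) = {}"
  proof (rule Baire_category_alt)
    show "countable (bad ` ?I)" using M by (intro countable_image countable_SIGMA) (auto simp: countable_finite)
  qed (use closed_bad int_bad in \<open>auto simp: completely_metrizable_space_euclidean\<close>)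
  then have int: "interior (\<Union>(bad ` ?I)) = {}" by simp
  have "\<not> ball 0 \<epsilon> \<times> ball 0 \<epsilon> \<subseteq> \<Union>(bad ` ?I)"
  proof
    assume "ball 0 \<epsilon> \<times> ball 0 \<epsilon> \<subseteq> \<Union>(bad ` ?I)"
    then have "ball 0 \<epsilon> \<times> ball 0 \<epsilon> \<subseteq> interior (\<Union>(bad ` ?I))"
      by (intro interior_maximal open_Times open_ball)
    moreover have "(0, 0) \<in> ball (0 :: 'd \<Rightarrow>\<^sub>L 'e) \<epsilon> \<times> ball (0::'e) \<epsilon>" using \<open>\<epsilon> > 0\<close> by simp
    ultimately show False using int by blast
  qed
  then obtain P where P: "P \<in> ball 0 \<epsilon> \<times> ball 0 \<epsilon>" "P \<notin> \<Union>(bad ` ?I)" by blast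
  show ?thesis
  proof (rule that[of "fst P" "snd P"])
    show "norm (fst P) < \<epsilon>" "norm (snd P) < \<epsilon>" using P(1) by (auto simp: mem_Times_iff)
    fix m x y
    assume m: "m \<in> M" and x: "x \<in> \<Omega>" and y: "y = f x + \<beta> x *\<^sub>R (blinfun_apply (fst P) x + snd P)" "y \<in> E m" "h m y = 0"
    obtain w where w: "w \<in> Basis" "\<eta> m y \<bullet> w \<noteq> 0" using \<eta>0[OF m y(2)] by (metis euclidean_all_zero_iff)
    then have "y \<in> (\<Union>k. Q m w k)" using Q(2)[OF m] y by (auto simp: E'_def)
    then obtain k where k: "y \<in> Q m w k" by auto
    obtain n where n: "x \<in> K n" using x K(3) by auto
    have "P \<notin> bad (m, w, n, k)" using P(2) m w by auto
    then show "\<exists>i\<in>Basis. \<eta> m y \<bullet> (Df x i + D\<beta> x i *\<^sub>R (blinfun_apply (fst P) x + snd P) + \<beta> x *\<^sub>R blinfun_apply (fst P) i) \<noteq> 0"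
      using n k y(1) unfolding bad_def F_def DF_def by auto
  qed
qed

section \<open>Smoothness at a point\<close>

text \<open>The intermediate maps are smooth near some points and merely continuous elsewhere, so
  smoothness has to be recorded point by point.\<close>

definition smooth_within :: "'m::euclidean_space set \<Rightarrow> ('m \<Rightarrow> 'n::euclidean_space) \<Rightarrow> 'm \<Rightarrow> bool" where
  "smooth_within S f x \<longleftrightarrow> (\<exists>W g. open W \<and> x \<in> W \<and> (\<forall>k. C_on k W g) \<and> (\<forall>y\<in>S \<inter> W. g y = f y))"

lemma smooth_on_iff: "smooth_on S f \<longleftrightarrow> (\<forall>x\<in>S. smooth_within S f x)"
  by (simp add: smooth_on_def smooth_within_def)

lemma smooth_withinI:
  "open W \<Longrightarrow> x \<in> W \<Longrightarrow> (\<And>k. C_on k W f) \<Longrightarrow> smooth_within S f x"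
  unfolding smooth_within_def by blast

text \<open>Only germs at \<open>x\<close> matter: outside \<open>V\<close> the set \<open>T\<close>
  may exceed \<open>S\<close>. The rule serves for restriction, for passing from a relatively open
  piece to the whole set, and for replacing \<open>f\<close> by a locally equal function.\<close>

lemma smooth_within_transfer:
  assumes "smooth_within S f x" "open V" "x \<in> V" "\<And>y. y \<in> T \<Longrightarrow> y \<in> V \<Longrightarrow> y \<in> S \<and> f y = f' y"
  shows "smooth_within T f' x"
proof -
  obtain W g where W: "open W" "x \<in> W" "\<And>k. C_on k W g" "\<And>y. y \<in> S \<inter> W \<Longrightarrow> g y = f y"
    using assms(1) unfolding smooth_within_def by blast
  show ?thesis unfolding smooth_within_def
    using W assms(2-4) by (intro exI[of _ "W \<inter> V"] exI[of _ g]) (auto intro: C_on_subset)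
qed

lemma smooth_within_compose:
  assumes "smooth_within S f x" "smooth_within T g (f x)" "x \<in> S" "open V" "x \<in> V"
    "\<And>y. y \<in> S \<Longrightarrow> y \<in> V \<Longrightarrow> f y \<in> T"
  shows "smooth_within S (\<lambda>y. g (f y)) x"
proof -
  obtain W f' where W: "open W" "x \<in> W" "\<And>k. C_on k W f'" "\<And>y. y \<in> S \<inter> W \<Longrightarrow> f' y = f y"
    using assms(1) unfolding smooth_within_def by blast
  obtain W2 g' where W2: "open W2" "f x \<in> W2" "\<And>k. C_on k W2 g'" "\<And>y. y \<in> T \<inter> W2 \<Longrightarrow> g' y = g y"
    using assms(2) unfolding smooth_within_def by blast
  let ?U = "V \<inter> (W \<inter> f' -` W2)"
  have op: "open ?U"
    using W W2 assms(4) C_on_imp_continuous_on[OF W(3)]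
    by (intro open_Int continuous_open_preimage) auto
  have "C_on k ?U (\<lambda>y. g' (f' y))" for k
    by (rule C_on_compose[OF op W2(1) _ C_on_subset[OF W(3)] W2(3)]) auto
  then show ?thesis
    unfolding smooth_within_def using op W W2 assms(3-6)
    by (intro exI[of _ ?U] exI[of _ "\<lambda>y. g' (f' y)"]) auto
qed

lemma smooth_within_linear_compose:
  assumes "bounded_linear l" "smooth_within S f x"
  shows "smooth_within S (\<lambda>y. l (f y)) x"
  using assms(2) C_on_linear_compose[OF assms(1)] unfolding smooth_within_def by metis

lemma smooth_within_const: "smooth_within S (\<lambda>y. c) x"
  by (rule smooth_withinI[OF open_UNIV UNIV_I C_on_const])

lemma smooth_within_bounded_linear: "bounded_linear f \<Longrightarrow> smooth_within S f x"
  by (rule smooth_withinI[OF open_UNIV UNIV_I C_on_bounded_linear])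

lemma smooth_within_add:
  assumes "smooth_within S f x" "smooth_within S g x"
  shows "smooth_within S (\<lambda>y. f y + g y) x"
proof -
  obtain W f' where W: "open W" "x \<in> W" "\<And>k. C_on k W f'" "\<And>y. y \<in> S \<inter> W \<Longrightarrow> f' y = f y"
    using assms(1) unfolding smooth_within_def by blast
  obtain V g' where V: "open V" "x \<in> V" "\<And>k. C_on k V g'" "\<And>y. y \<in> S \<inter> V \<Longrightarrow> g' y = g y"
    using assms(2) unfolding smooth_within_def by blast
  have "C_on k (W \<inter> V) (\<lambda>y. f' y + g' y)" for k
    using W V by (intro C_on_add C_on_subset[OF W(3)] C_on_subset[OF V(3)]) auto
  then show ?thesis
    unfolding smooth_within_def using W V
    by (intro exI[of _ "W \<inter> V"] exI[of _ "\<lambda>y. f' y + g' y"]) auto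
qed

lemma smooth_within_scaleR:
  assumes "smooth_within S f x" "smooth_within S g x"
  shows "smooth_within S (\<lambda>y. f y *\<^sub>R g y) x"
proof -
  obtain W f' where W: "open W" "x \<in> W" "\<And>k. C_on k W f'" "\<And>y. y \<in> S \<inter> W \<Longrightarrow> f' y = f y"
    using assms(1) unfolding smooth_within_def by blast
  obtain V g' where V: "open V" "x \<in> V" "\<And>k. C_on k V g'" "\<And>y. y \<in> S \<inter> V \<Longrightarrow> g' y = g y"
    using assms(2) unfolding smooth_within_def by blast
  have "C_on k (W \<inter> V) (\<lambda>y. f' y *\<^sub>R g' y)" for k
    using W V by (intro C_on_scaleR C_on_subset[OF W(3)] C_on_subset[OF V(3)]) auto
  then show ?thesis
    unfolding smooth_within_def using W V
    by (intro exI[of _ "W \<inter> V"] exI[of _ "\<lambda>y. f' y *\<^sub>R g' y"]) auto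
qed

lemma smooth_within_Pair:
  assumes "smooth_within S f x" "smooth_within S g x"
  shows "smooth_within S (\<lambda>y. (f y, g y)) x"
proof -
  have "smooth_within S (\<lambda>y. (f y, 0) + (0, g y)) x"
    by (intro smooth_within_add smooth_within_linear_compose[OF _ assms(1), of "\<lambda>a. (a, 0)"]
        smooth_within_linear_compose[OF _ assms(2), of "\<lambda>a. (0, a)"])
      (auto intro!: bounded_linear_Pair bounded_linear_ident bounded_linear_zero)
  then show ?thesis by simp
qed

lemma smooth_within_UNIV_iff:
  "smooth_within UNIV f x \<longleftrightarrow> (\<exists>W. open W \<and> x \<in> W \<and> (\<forall>k. C_on k W f))"
  unfolding smooth_within_def using C_on_cong by (metis (no_types, lifting) Int_UNIV_left)

text \<open>The points at which a merely continuous map happens to be smooth thus form an open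
  domain, as the generic perturbation requires.\<close>

lemma open_smooth_points: "open {x. smooth_within UNIV f x}"
  unfolding smooth_within_UNIV_iff by (subst open_subopen) blast

lemma smooth_within_interior:
  assumes "smooth_within S f x" "x \<in> interior S"
  shows "smooth_within UNIV f x"
  by (rule smooth_within_transfer[OF assms(1) open_interior assms(2)]) (use interior_subset in auto)

lemma smooth_within_UNIV: "smooth_within UNIV f x \<Longrightarrow> smooth_within S f x"
  unfolding smooth_within_def by blast

lemma smooth_within_has_derivative:
  assumes "smooth_within S f x" "x \<in> S"
  obtains D where "(f has_derivative D) (at x within S)"
proof -
  obtain W g where W: "open W" "x \<in> W" "C_on (Suc 0) W g" "\<And>y. y \<in> S \<inter> W \<Longrightarrow> g y = f y"
    using assms(1) unfolding smooth_within_def by blast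
  have "(g has_derivative frechet_derivative g (at x)) (at x within S)"
    using C_on_Suc_has_derivative[OF W(3,2)] by (rule has_derivative_at_withinI)
  moreover obtain d where "d > 0" "ball x d \<subseteq> W" using W(1,2) open_contains_ball by blast
  ultimately have "(f has_derivative frechet_derivative g (at x)) (at x within S)"
    using W(4) assms(2) by (elim has_derivative_transform_within[of _ _ _ _ d]) (auto simp: dist_commute subset_iff)
  then show ?thesis using that by blast
qed

lemma smooth_polynomial_function:
  fixes g :: "'d::euclidean_space \<Rightarrow> 'e::euclidean_space"
  assumes "polynomial_function g" shows "C_on k UNIV g"
proof -
  have real: "C_on k UNIV p" if "real_polynomial_function p" for p :: "'d \<Rightarrow> real"
    using that
  proof induction
    case (mult f g)
    then show ?case using C_on_scaleR[OF open_UNIV mult(3,4)] by simp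
  qed (auto intro: C_on_bounded_linear C_on_const C_on_add)
  have "C_on k UNIV (\<lambda>x. \<Sum>i\<in>Basis. (g x \<bullet> i) *\<^sub>R i)"
    using assms
    by (intro C_on_sum C_on_scaleR C_on_const real)
      (auto simp: polynomial_function_def comp_def bounded_linear_inner_left)
  then show ?thesis by (simp add: euclidean_representation)
qed

text \<open>A chain rule for germs: \<open>f\<close> maps into \<open>T\<close>, and
  \<open>h\<close> equals the composite, only near \<open>x\<close>. Coordinate representations and
  coordinate changes come in this form.\<close>

lemma has_derivative_compose_local:
  assumes "(f has_derivative f') (at x within S)" "(g has_derivative g') (at (f x) within T)"
    "x \<in> S" "open V" "x \<in> V" "\<And>y. y \<in> S \<Longrightarrow> y \<in> V \<Longrightarrow> f y \<in> T \<and> h y = g (f y)"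
  shows "(h has_derivative (\<lambda>v. g' (f' v))) (at x within S)"
proof -
  obtain d where d: "d > 0" "ball x d \<subseteq> V" using assms(4,5) open_contains_ball by blast
  have eq: "at x within S = at x within (S \<inter> V)"
    by (rule at_within_nhd[OF assms(5,4)]) auto
  have "(f has_derivative f') (at x within S \<inter> V)" using assms(1) eq by simp
  moreover have "(g has_derivative g') (at (f x) within f ` (S \<inter> V))"
    by (rule has_derivative_subset[OF assms(2)]) (use assms(6) in auto)
  ultimately have "(g \<circ> f has_derivative g' \<circ> f') (at x within S \<inter> V)"
    by (rule diff_chain_within)
  then have "(h has_derivative g' \<circ> f') (at x within S \<inter> V)"
    by (rule has_derivative_transform[rotated 2]) (use assms in auto)
  then show ?thesis using eq by (simp add: comp_def)
qed

lemma has_derivative_cong_local: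
  assumes "(f has_derivative f') (at x within S)"
    "x \<in> S" "open V" "x \<in> V" "\<And>y. y \<in> S \<Longrightarrow> y \<in> V \<Longrightarrow> h y = f y"
  shows "(h has_derivative f') (at x within S)"
  using has_derivative_compose_local[OF has_derivative_ident assms(1-4), of h] assms(5) by auto

section \<open>Charts and transversality at a point\<close>

text \<open>The charts take values in \<open>H\<close>, which is \<open>UNIV\<close> for a manifold without boundary and
  \<open>UNIV \<times> {0..1}\<close> for a cylinder. The last assumption makes derivatives within \<open>H\<close> unique.\<close>

locale charts =
  fixes N :: "'p::{t2_space,second_countable_topology} set"
    and B :: "('p, 'd::euclidean_space) chart set"
    and H :: "'d set"
  assumes open_dom: "b \<in> B \<Longrightarrow> openin (top_of_set N) (fst b)"
    and open_img: "b \<in> B \<Longrightarrow> openin (top_of_set H) (snd b ` fst b)"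
    and homeo: "b \<in> B \<Longrightarrow> homeomorphism (fst b) (snd b ` fst b) (snd b) (chart_inv b)"
    and cover: "N = (\<Union>b\<in>B. fst b)"
    and compat: "b \<in> B \<Longrightarrow> c \<in> B \<Longrightarrow> smooth_on (local_dom b c (\<lambda>x. x)) (local_rep b c (\<lambda>x. x))"
    and thick: "x \<in> H \<Longrightarrow> i \<in> Basis \<Longrightarrow> e > 0 \<Longrightarrow> \<exists>d. 0 < \<bar>d\<bar> \<and> \<bar>d\<bar> < e \<and> x + d *\<^sub>R i \<in> H"
begin

lemma chart_inv_chart [simp]: "b \<in> B \<Longrightarrow> p \<in> fst b \<Longrightarrow> chart_inv b (snd b p) = p"
  using homeo by (simp add: homeomorphism_def)

lemma chart_chart_inv [simp]: "b \<in> B \<Longrightarrow> x \<in> snd b ` fst b \<Longrightarrow> snd b (chart_inv b x) = x"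
  using homeo by auto

lemma chart_inv_in [simp]: "b \<in> B \<Longrightarrow> x \<in> snd b ` fst b \<Longrightarrow> chart_inv b x \<in> fst b"
  by auto

lemma dom_subset: "b \<in> B \<Longrightarrow> fst b \<subseteq> N"
  using cover by auto

lemma chart_in_H: "b \<in> B \<Longrightarrow> p \<in> fst b \<Longrightarrow> snd b p \<in> H"
  using openin_imp_subset[OF open_img] by blast

lemma continuous_chart: "b \<in> B \<Longrightarrow> continuous_on (fst b) (snd b)"
  using homeo by (simp add: homeomorphism_def)

lemma continuous_chart_inv: "b \<in> B \<Longrightarrow> continuous_on (snd b ` fst b) (chart_inv b)"
  using homeo by (simp add: homeomorphism_def)

lemma open_img_Int:
  assumes "b \<in> B" "openin (top_of_set N) T"
  shows "openin (top_of_set H) (snd b ` (fst b \<inter> T))"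
proof -
  have "openin (top_of_set (fst b)) (fst b \<inter> T)"
    using assms open_dom[OF assms(1)] dom_subset[OF assms(1)]
    by (metis inf_le1 openin_Int openin_subset_trans)
  then have "openin (top_of_set (snd b ` fst b)) (snd b ` (fst b \<inter> T))"
    by (rule homeomorphism_imp_open_map[OF homeo[OF assms(1)]])
  then show ?thesis using open_img[OF assms(1)] openin_trans by blast
qed

lemma chart_nhd:
  assumes "b \<in> B" "p \<in> fst b" "openin (top_of_set N) T" "p \<in> T"
  obtains V where "open V" "snd b p \<in> V"
    "\<And>x. x \<in> H \<Longrightarrow> x \<in> V \<Longrightarrow> x \<in> snd b ` fst b \<and> chart_inv b x \<in> T"
proof -
  obtain V where V: "open V" "snd b ` (fst b \<inter> T) = H \<inter> V"
    using open_img_Int[OF assms(1,3)] by (metis openin_open)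
  show ?thesis
  proof (rule that[OF V(1)])
    show "snd b p \<in> V" using V assms by auto
    fix x assume "x \<in> H" "x \<in> V"
    then have "x \<in> snd b ` (fst b \<inter> T)" using V by auto
    then show "x \<in> snd b ` fst b \<and> chart_inv b x \<in> T" using assms(1) by auto
  qed
qed

lemma derivative_unique:
  "x \<in> H \<Longrightarrow> (f has_derivative D) (at x within H) \<Longrightarrow> (f has_derivative D') (at x within H) \<Longrightarrow> D = D'"
  using frechet_derivative_unique_within thick by metis

text \<open>The overlap of two charts is relatively open in \<open>H\<close>, so smoothness on it
  may be read within \<open>H\<close>. Derivatives in different charts then refer to one common
  set.\<close>

lemma transition_smooth:
  assumes "b \<in> B" "c \<in> B" "p \<in> fst b" "p \<in> fst c"
  shows "smooth_within H (local_rep b c (\<lambda>x. x)) (snd b p)"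
proof -
  have p: "p \<in> fst b \<inter> fst c" using assms by auto
  have "smooth_within (snd b ` (fst b \<inter> fst c)) (local_rep b c (\<lambda>x. x)) (snd b p)"
    using compat[OF assms(1,2)] p unfolding smooth_on_iff local_dom_def vimage_def by auto
  moreover obtain V where V: "open V" "snd b ` (fst b \<inter> fst c) = H \<inter> V"
    using open_img_Int[OF assms(1) open_dom[OF assms(2)]] by (metis openin_open)
  moreover have "snd b p \<in> V" using V p by auto
  ultimately show ?thesis
    by (elim smooth_within_transfer) auto
qed

end

section \<open>Maps between charted spaces: smoothness and transversality at one point\<close>

locale chart_maps = src: charts N B H + tgt: charts X A UNIV
  for N :: "'p::{t2_space,second_countable_topology} set"
    and B :: "('p, 'd::euclidean_space) chart set"
    and H :: "'d set"
    and X :: "'a::{t2_space,second_countable_topology} set"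
    and A :: "('a, 'e::euclidean_space) chart set" +
  fixes Z :: "'a set"
begin

definition cmap :: "('p \<Rightarrow> 'a) \<Rightarrow> bool" where
  "cmap F \<longleftrightarrow> continuous_on N F \<and> F ` N \<subseteq> X"

definition smooth_pt :: "('p \<Rightarrow> 'a) \<Rightarrow> 'p \<Rightarrow> bool" where
  "smooth_pt F p \<longleftrightarrow> (\<exists>b\<in>B. \<exists>a\<in>A. p \<in> fst b \<and> F p \<in> fst a \<and> smooth_within H (local_rep b a F) (snd b p))"

text \<open>\<open>S\<close> is a hyperplane, so transversality to \<open>Z\<close> just asks for
  one derivative vector outside \<open>S\<close>. The derivative is taken existentially; within
  \<open>H\<close> it is unique.\<close>

definition transv_at :: "('p \<Rightarrow> 'a) \<Rightarrow> 'p \<Rightarrow> ('p, 'd) chart \<Rightarrow> ('a, 'e) chart \<Rightarrow> 'e set \<Rightarrow> bool" where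
  "transv_at F p b c S \<longleftrightarrow> b \<in> B \<and> p \<in> fst b \<and> slice_chart A Z S c \<and> F p \<in> fst c \<and> dim S + 1 = DIM('e) \<and>
    (\<exists>D \<xi>. (local_rep b c F has_derivative D) (at (snd b p) within H) \<and> D \<xi> \<notin> S)"

text \<open>The set of good points is what only grows during the construction. Off \<open>Z\<close>
  goodness is mere smoothness.\<close>

definition good :: "('p \<Rightarrow> 'a) \<Rightarrow> 'p \<Rightarrow> bool" where
  "good F p \<longleftrightarrow> smooth_pt F p \<and> (F p \<in> Z \<longrightarrow> (\<exists>b c S. transv_at F p b c S))"

lemma preimage_open:
  assumes "cmap F" "openin (top_of_set X) U"
  shows "openin (top_of_set N) (N \<inter> F -` U)"
  using assms unfolding cmap_def by (intro continuous_openin_preimage) auto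

lemma rep_nhd:
  assumes "cmap F" "b \<in> B" "p \<in> fst b" "openin (top_of_set X) U" "F p \<in> U"
  obtains V where "open V" "snd b p \<in> V"
    "\<And>x. x \<in> H \<Longrightarrow> x \<in> V \<Longrightarrow> x \<in> snd b ` fst b \<and> F (chart_inv b x) \<in> U"
proof -
  have "p \<in> N \<inter> F -` U" using assms src.dom_subset[OF assms(2)] by auto
  from src.chart_nhd[OF assms(2,3) preimage_open[OF assms(1,4)] this]
  obtain V where V: "open V" "snd b p \<in> V"
    "\<And>x. x \<in> H \<Longrightarrow> x \<in> V \<Longrightarrow> x \<in> snd b ` fst b \<and> chart_inv b x \<in> N \<inter> F -` U" by blast
  show ?thesis by (rule that[OF V(1,2)]) (use V(3) in auto)
qed

lemma rep_change:
  assumes "cmap F" "b \<in> B" "p \<in> fst b" "b' \<in> B" "p \<in> fst b'"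
    "a \<in> A" "F p \<in> fst a" "a' \<in> A" "F p \<in> fst a'"
  obtains V where "open V" "snd b' p \<in> V"
    "\<And>x. x \<in> H \<Longrightarrow> x \<in> V \<Longrightarrow> local_rep b' b (\<lambda>x. x) x \<in> H \<and>
      local_rep b a F (local_rep b' b (\<lambda>x. x) x) = local_rep b' a F x \<and>
      local_rep a a' (\<lambda>x. x) (local_rep b' a F x) = local_rep b' a' F x"
proof -
  obtain V where V: "open V" "snd b' p \<in> V"
    "\<And>x. x \<in> H \<Longrightarrow> x \<in> V \<Longrightarrow> x \<in> snd b' ` fst b' \<and> F (chart_inv b' x) \<in> fst a"
    using rep_nhd[OF assms(1,4,5) tgt.open_dom[OF assms(6)] assms(7)] by metis
  obtain W where W: "open W" "snd b' p \<in> W"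
    "\<And>x. x \<in> H \<Longrightarrow> x \<in> W \<Longrightarrow> x \<in> snd b' ` fst b' \<and> chart_inv b' x \<in> fst b"
    using src.chart_nhd[OF assms(4,5) src.open_dom[OF assms(2)] assms(3)] by metis
  show ?thesis
  proof (rule that[of "V \<inter> W"])
    fix x assume "x \<in> H" "x \<in> V \<inter> W"
    then have "F (chart_inv b' x) \<in> fst a" "chart_inv b' x \<in> fst b" using V W by auto
    then show "local_rep b' b (\<lambda>x. x) x \<in> H \<and>
      local_rep b a F (local_rep b' b (\<lambda>x. x) x) = local_rep b' a F x \<and>
      local_rep a a' (\<lambda>x. x) (local_rep b' a F x) = local_rep b' a' F x"
      using assms by (simp add: local_rep_def src.chart_in_H)
  qed (use V W in auto)
qed

lemma local_rep_at: "b \<in> B \<Longrightarrow> p \<in> fst b \<Longrightarrow> local_rep b c F (snd b p) = snd c (F p)"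
  by (simp add: local_rep_def)

lemma local_rep_src_at: "b \<in> B \<Longrightarrow> p \<in> fst b \<Longrightarrow> local_rep b c (\<lambda>x. x) (snd b p) = snd c p"
  by (simp add: local_rep_def)

text \<open>Coordinate changes are smooth on both sides: compose first with the one in the source,
  then with the one in the target. So the existential charts in \<open>smooth_pt\<close> may be
  traded for any others.\<close>

lemma smooth_pt_rep:
  assumes "cmap F" "smooth_pt F p" "b \<in> B" "p \<in> fst b" "a \<in> A" "F p \<in> fst a"
  shows "smooth_within H (local_rep b a F) (snd b p)"
proof -
  obtain b1 a1 where 1: "b1 \<in> B" "a1 \<in> A" "p \<in> fst b1" "F p \<in> fst a1"
    and sm: "smooth_within H (local_rep b1 a1 F) (snd b1 p)"
    using assms(2) unfolding smooth_pt_def by blast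
  obtain V where V: "open V" "snd b p \<in> V"
    "\<And>x. x \<in> H \<Longrightarrow> x \<in> V \<Longrightarrow> local_rep b b1 (\<lambda>x. x) x \<in> H \<and>
      local_rep b1 a1 F (local_rep b b1 (\<lambda>x. x) x) = local_rep b a1 F x \<and>
      local_rep a1 a (\<lambda>x. x) (local_rep b a1 F x) = local_rep b a F x"
    using rep_change[OF assms(1) 1(1,3) assms(3,4) 1(2,4) assms(5,6)] by blast
  have bH: "snd b p \<in> H" using assms src.chart_in_H by blast
  have "smooth_within H (\<lambda>x. local_rep b1 a1 F (local_rep b b1 (\<lambda>x. x) x)) (snd b p)"
    using sm src.transition_smooth[OF assms(3) 1(1) assms(4) 1(3)] V bH
    by (intro smooth_within_compose[where V = V and T = H and f = "local_rep b b1 (\<lambda>x. x)" and g = "local_rep b1 a1 F"])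
      (simp_all add: local_rep_src_at[OF assms(3,4)])
  then have "smooth_within H (local_rep b a1 F) (snd b p)"
    by (rule smooth_within_transfer[OF _ V(1,2)]) (use V in auto)
  then have "smooth_within H (\<lambda>x. local_rep a1 a (\<lambda>x. x) (local_rep b a1 F x)) (snd b p)"
    using tgt.transition_smooth[OF 1(2) assms(5) 1(4) assms(6)] bH
    by (intro smooth_within_compose[where V = UNIV and T = UNIV and f = "local_rep b a1 F" and g = "local_rep a1 a (\<lambda>x. x)"])
      (simp_all add: local_rep_at[OF assms(3,4)])
  then show ?thesis
    by (rule smooth_within_transfer[OF _ V(1,2)]) (use V in auto)
qed

text \<open>Goodness depends on the germ of \<open>F\<close> only. This transports it to points away
  from a corrected box and to the limit of all corrections.\<close>

lemma good_cong:
  assumes "good F p" "openin (top_of_set N) T" "p \<in> T" "\<And>q. q \<in> T \<Longrightarrow> F q = F' q"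
  shows "good F' p"
proof -
  have eq: "F p = F' p" using assms by blast
  have near: "\<exists>V. open V \<and> snd b p \<in> V \<and> (\<forall>x\<in>H \<inter> V. local_rep b a F x = local_rep b a F' x)"
    if bp: "b \<in> B" "p \<in> fst b" for b and a :: "('a, 'e) chart"
  proof -
    obtain V where "open V" "snd b p \<in> V"
      "\<And>x. x \<in> H \<Longrightarrow> x \<in> V \<Longrightarrow> x \<in> snd b ` fst b \<and> chart_inv b x \<in> T"
      using src.chart_nhd[OF bp assms(2,3)] by blast
    then show ?thesis using assms(4) by (intro exI[of _ V]) (auto simp: local_rep_def)
  qed
  have "smooth_pt F' p"
  proof -
    obtain b a where 1: "b \<in> B" "a \<in> A" "p \<in> fst b" "F p \<in> fst a"
      "smooth_within H (local_rep b a F) (snd b p)"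
      using assms(1) unfolding good_def smooth_pt_def by blast
    obtain V where V: "open V" "snd b p \<in> V" "\<forall>x\<in>H \<inter> V. local_rep b a F x = local_rep b a F' x"
      using near[OF 1(1,3)] by blast
    have "smooth_within H (local_rep b a F') (snd b p)"
      by (rule smooth_within_transfer[OF 1(5) V(1,2)]) (use V(3) in auto)
    then show ?thesis unfolding smooth_pt_def using 1 eq by auto
  qed
  moreover have "\<exists>b c S. transv_at F' p b c S" if tr: "transv_at F p b c S" for b c S
  proof -
    obtain D \<xi> where 1: "b \<in> B" "p \<in> fst b"
      "(local_rep b c F has_derivative D) (at (snd b p) within H)" "D \<xi> \<notin> S"
      using tr unfolding transv_at_def by blast
    obtain V where V: "open V" "snd b p \<in> V" "\<forall>x\<in>H \<inter> V. local_rep b c F x = local_rep b c F' x"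
      using near[OF 1(1,2)] by blast
    have "(local_rep b c F' has_derivative D) (at (snd b p) within H)"
      by (rule has_derivative_cong_local[OF 1(3) src.chart_in_H[OF 1(1,2)] V(1,2)]) (use V(3) in auto)
    then show ?thesis using tr 1 eq unfolding transv_at_def by metis
  qed
  ultimately show ?thesis using assms(1) eq unfolding good_def by auto
qed

text \<open>By the chain rule \<open>D\<close> is \<open>D'\<close> after \<open>T\<close>, the
  derivative of the coordinate change, so \<open>T \<xi>\<close> is a witness in the new source
  chart; the slice chart stays.\<close>

lemma transv_change:
  assumes "cmap F" "smooth_pt F p" "transv_at F p b c S" "b' \<in> B" "p \<in> fst b'"
  shows "transv_at F p b' c S"
proof -
  obtain D \<xi> where 1: "b \<in> B" "p \<in> fst b" "slice_chart A Z S c" "F p \<in> fst c"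
      "(local_rep b c F has_derivative D) (at (snd b p) within H)" "D \<xi> \<notin> S"
    using assms(3) unfolding transv_at_def by blast
  have c: "c \<in> A" using 1 by (simp add: slice_chart_def)
  obtain D' where D': "(local_rep b' c F has_derivative D') (at (snd b' p) within H)"
    using smooth_within_has_derivative[OF smooth_pt_rep[OF assms(1,2,4,5) c 1(4)] src.chart_in_H[OF assms(4,5)]] .
  obtain T where T: "(local_rep b b' (\<lambda>x. x) has_derivative T) (at (snd b p) within H)"
    using smooth_within_has_derivative[OF src.transition_smooth[OF 1(1) assms(4) 1(2) assms(5)]
        src.chart_in_H[OF 1(1,2)]] .
  obtain V where V: "open V" "snd b p \<in> V"
    "\<And>x. x \<in> H \<Longrightarrow> x \<in> V \<Longrightarrow> local_rep b b' (\<lambda>x. x) x \<in> H \<and>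
      local_rep b' c F (local_rep b b' (\<lambda>x. x) x) = local_rep b c F x \<and>
      local_rep c c (\<lambda>x. x) (local_rep b c F x) = local_rep b c F x"
    by (rule rep_change[OF assms(1,4,5) 1(1,2) c 1(4) c 1(4)]) (rule that)
  have "(local_rep b c F has_derivative (\<lambda>v. D' (T v))) (at (snd b p) within H)"
    by (rule has_derivative_compose_local[where g = "local_rep b' c F" and T = H, OF T _ src.chart_in_H[OF 1(1,2)] V(1,2)])
      (use D' V(3) in \<open>simp_all add: local_rep_src_at[OF 1(1,2)]\<close>)
  then have "D = (\<lambda>v. D' (T v))"
    using src.derivative_unique[OF src.chart_in_H[OF 1(1,2)] 1(5)] by blast
  then show ?thesis using 1 D' assms unfolding transv_at_def by blast
qed

end

section \<open>Perturbation in a coordinate ball\<close>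

lemma smooth_within_UNIV_differentiable:
  assumes "smooth_within UNIV f x"
  shows "(f has_derivative frechet_derivative f (at x)) (at x)"
    "(\<lambda>y. frechet_derivative f (at y) v) differentiable (at x)"
proof -
  obtain W where W: "x \<in> W" "\<And>k. C_on k W f" using assms smooth_within_UNIV_iff by blast
  show "(f has_derivative frechet_derivative f (at x)) (at x)"
    using C_on_Suc_has_derivative[OF W(2) W(1)] .
  show "(\<lambda>y. frechet_derivative f (at y) v) differentiable (at x)"
    using W(1) W(2)[of "Suc (Suc 0)"] by simp
qed

text \<open>A Lebesgue number: it tells how far a map may be moved uniformly on a compact set
  without leaving \<open>U\<close>.\<close>

lemma compact_image_uniform_nhd:
  fixes f :: "'a::topological_space \<Rightarrow> 'b::heine_borel"
  assumes "compact C" "continuous_on C f" "open U" "f ` C \<subseteq> U"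
  shows "\<exists>e>0. \<forall>x\<in>C. \<forall>y. dist (f x) y < e \<longrightarrow> y \<in> U"
proof -
  have "compact (f ` C)" using assms by (intro compact_continuous_image)
  then obtain e where e: "e > 0" "(\<Union>x\<in>f ` C. ball x e) \<subseteq> U"
    using compact_subset_open_imp_ball_epsilon_subset[of "f ` C" U] assms by blast
  then show ?thesis by (intro exI[of _ e] conjI ballI allI impI) (auto simp: subset_iff)
qed

context chart_maps
begin

text \<open>In the coordinates \<open>a\<close>, the set \<open>Z\<close> is contained in the zero set of \<open>\<lambda>y. n \<bullet> \<tau> y\<close>,
  whose gradient is \<open>\<eta>\<close>.\<close>

lemma slice_function:
  assumes a: "a \<in> A" and c: "slice_chart A Z S c" and dim: "dim S + 1 = DIM('e)"
  shows "\<exists>n \<eta>. let E = snd a ` (fst a \<inter> fst c); \<tau> = local_rep a c (\<lambda>x. x) in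
    open E \<and> continuous_on E (\<lambda>y. n \<bullet> \<tau> y) \<and> negligible {y \<in> E. n \<bullet> \<tau> y = 0} \<and>
    \<eta> differentiable_on E \<and> (\<forall>y\<in>E. \<eta> y \<noteq> 0) \<and> S \<subseteq> {v. n \<bullet> v = 0} \<and>
    (\<forall>y\<in>E. (\<tau> has_derivative frechet_derivative \<tau> (at y)) (at y) \<and>
      (\<forall>v. \<eta> y \<bullet> v = n \<bullet> frechet_derivative \<tau> (at y) v))"
proof -
  have cA: "c \<in> A" using c by (simp add: slice_chart_def)
  define E where "E = snd a ` (fst a \<inter> fst c)"
  define \<tau> where "\<tau> = local_rep a c (\<lambda>x. x)"
  define \<sigma> where "\<sigma> = local_rep c a (\<lambda>x. x)"
  define T where "T y = frechet_derivative \<tau> (at y)" for y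
  obtain n :: 'e where n: "n \<noteq> 0" "S \<subseteq> {v. n \<bullet> v = 0}"
    using lowdim_subset_hyperplane[of S] dim span_superset by fastforce
  define \<eta> where "\<eta> y = (\<Sum>i\<in>Basis. (n \<bullet> T y i) *\<^sub>R i)" for y
  have E_open: "open E"
    using tgt.open_img_Int[OF a tgt.open_dom[OF cA]] by (simp add: E_def)
  have \<tau>: "smooth_within UNIV \<tau> y" if "y \<in> E" for y
    using that tgt.transition_smooth[OF a cA] by (auto simp: E_def \<tau>_def)
  have \<sigma>: "smooth_within UNIV \<sigma> (\<tau> y)" if "y \<in> E" for y
    using that tgt.transition_smooth[OF cA a] a by (auto simp: E_def \<tau>_def \<sigma>_def tgt.chart_inv_chart local_rep_def)
  have \<sigma>\<tau>: "\<sigma> (\<tau> y) = y" if "y \<in> E" for y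
    using that a cA by (auto simp: E_def \<tau>_def \<sigma>_def local_rep_def)
  have T: "(\<tau> has_derivative T y) (at y)" if "y \<in> E" for y
    unfolding T_def using smooth_within_UNIV_differentiable(1)[OF \<tau>[OF that]] .
  have cont: "continuous_on E \<tau>"
    using T by (meson continuous_at_imp_continuous_on has_derivative_continuous)
  have \<eta>: "\<eta> y \<bullet> v = n \<bullet> T y v" if "y \<in> E" for y v
  proof -
    interpret linear "T y" using T[OF that] has_derivative_linear by blast
    have "n \<bullet> T y v = n \<bullet> T y (\<Sum>i\<in>Basis. (v \<bullet> i) *\<^sub>R i)" by (simp add: euclidean_representation)
    also have "\<dots> = (\<Sum>i\<in>Basis. (v \<bullet> i) * (n \<bullet> T y i))" by (simp add: sum scale inner_sum_right)
    also have "\<dots> = \<eta> y \<bullet> v" by (simp add: \<eta>_def inner_sum_left inner_commute[of v] mult.commute)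
    finally show ?thesis by simp
  qed
  \<comment> \<open>\<open>T y\<close> has a right inverse, the derivative of the reverse coordinate
    change \<sigma>; so a zero of \<open>\<eta>\<close> would force \<open>n = 0\<close>.\<close>
  have "\<eta> y \<noteq> 0" if y: "y \<in> E" for y
  proof
    assume 0: "\<eta> y = 0"
    let ?D = "frechet_derivative \<sigma> (at (\<tau> y))"
    have D: "(\<sigma> has_derivative ?D) (at (\<tau> y))"
      using smooth_within_UNIV_differentiable(1)[OF \<sigma>[OF y]] .
    have st: "\<tau> (\<sigma> z) = z" if "z \<in> snd c ` (fst a \<inter> fst c)" for z
      using that a cA by (auto simp: \<tau>_def \<sigma>_def local_rep_def)
    have op: "open (snd c ` (fst a \<inter> fst c))"
      using tgt.open_img_Int[OF cA tgt.open_dom[OF a]] by (simp add: Int_commute)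
    have "\<tau> y \<in> snd c ` (fst a \<inter> fst c)" using y a by (auto simp: E_def \<tau>_def local_rep_def)
    then have "((\<lambda>z. z) has_derivative (\<lambda>v. T y (?D v))) (at (\<tau> y))"
      using has_derivative_compose_local[OF D, of \<tau> "T y" UNIV _ "\<lambda>z. z"] T[OF y] op st \<sigma>\<tau>[OF y] by simp
    then have "(\<lambda>v. T y (?D v)) = (\<lambda>v. v)"
      using has_derivative_ident has_derivative_unique by blast
    then have "n \<bullet> v = \<eta> y \<bullet> ?D v" for v using \<eta>[OF y] by metis
    then have "n \<bullet> n = 0" using 0 by simp
    then show False using n by simp
  qed
  \<comment> \<open>The zero set is carried back by \<sigma> from part of a hyperplane in the
    coordinates of \<open>c\<close>.\<close>
  moreover have "negligible {y \<in> E. n \<bullet> \<tau> y = 0}"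
  proof -
    let ?Y = "\<tau> ` {y \<in> E. n \<bullet> \<tau> y = 0}"
    have "negligible ?Y"
      by (rule negligible_subset[OF negligible_hyperplane[of n 0]]) (use n in auto)
    moreover have "\<sigma> differentiable_on ?Y"
      unfolding differentiable_on_def
    proof clarify
      fix y assume "y \<in> E"
      then show "\<sigma> differentiable (at (\<tau> y) within ?Y)"
        using smooth_within_UNIV_differentiable(1)[OF \<sigma>] differentiableI differentiable_at_withinI by blast
    qed
    ultimately have "negligible (\<sigma> ` ?Y)"
      by (rule negligible_differentiable_image_negligible[OF order_refl])
    then show ?thesis
      by (rule negligible_subset) (use \<sigma>\<tau> in \<open>force simp: image_iff\<close>)
  qed
  moreover have "\<eta> differentiable_on E"
    unfolding \<eta>_def
  proof (intro differentiable_on_sum differentiable_on_scaleR differentiable_on_inner differentiable_on_const)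
    show "(\<lambda>y. T y i) differentiable_on E" for i
      unfolding differentiable_on_def T_def
      using smooth_within_UNIV_differentiable(2)[OF \<tau>] differentiable_at_withinI by blast
  qed
  ultimately show ?thesis
    using E_open cont n \<eta> T unfolding E_def[symmetric] \<tau>_def[symmetric] T_def[symmetric] Let_def
    by (intro exI[of _ n] exI[of _ \<eta>] conjI continuous_on_inner continuous_on_const) auto
qed

text \<open>Baire's theorem admits only countably many slice charts; by Lindelof, countably many of
  their domains still cover \<open>Z\<close>.\<close>

lemma countable_slice_cover:
  assumes "submanifold X A 1 Z"
  obtains M where "countable M" "\<And>c S. (c, S) \<in> M \<Longrightarrow> slice_chart A Z S c \<and> dim S + 1 = DIM('e)"
    "\<And>q. q \<in> Z \<Longrightarrow> \<exists>(c, S)\<in>M. q \<in> fst c"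
proof -
  define P where "P c S \<longleftrightarrow> slice_chart A Z S c \<and> dim S + 1 = DIM('e)" for c S
  define \<F> where "\<F> = {fst c | c S. P c S}"
  have "openin (top_of_set X) U" if "U \<in> \<F>" for U
    using that tgt.open_dom by (auto simp: \<F>_def P_def slice_chart_def)
  then obtain \<F>' where \<F>': "\<F>' \<subseteq> \<F>" "countable \<F>'" "\<Union>\<F>' = \<Union>\<F>"
    using Lindelof_openin by metis
  have "\<exists>m. P (fst m) (snd m) \<and> fst (fst m) = U" if "U \<in> \<F>'" for U
    using that \<F>'(1) by (force simp: \<F>_def)
  then obtain m where m: "\<And>U. U \<in> \<F>' \<Longrightarrow> P (fst (m U)) (snd (m U)) \<and> fst (fst (m U)) = U"
    by metis
  show ?thesis
  proof (rule that[of "m ` \<F>'"])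
    show "countable (m ` \<F>')" using \<F>'(2) by simp
    show "slice_chart A Z S c \<and> dim S + 1 = DIM('e)" if cS: "(c, S) \<in> m ` \<F>'" for c S
    proof -
      obtain U where "U \<in> \<F>'" "m U = (c, S)" using cS by force
      then show ?thesis using m[of U] by (simp add: P_def)
    qed
    show "\<exists>(c, S)\<in>m ` \<F>'. q \<in> fst c" if q: "q \<in> Z" for q
    proof -
      obtain S c where Sc: "slice_chart A Z S c" "q \<in> fst c" "dim S + 1 = DIM('e)"
        using assms q unfolding submanifold_def by blast
      then have "fst c \<in> \<F>" unfolding \<F>_def P_def by blast
      then have "q \<in> \<Union>\<F>'" using \<F>'(3) Sc(2) by blast
      then obtain U where U: "U \<in> \<F>'" "q \<in> U" by blast
      then show ?thesis using m[OF U(1)] by (intro bexI[of _ "m U"]) (auto simp: case_prod_unfold)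
    qed
  qed
qed

text \<open>The pairs in \<open>\<K>\<close> are the finitely many conditions on compact sets that keep the other
  boxes inside their target charts.\<close>

lemma box_step:
  assumes F: "cmap F" and Z: "submanifold X A 1 Z" and b: "b \<in> B" and a: "a \<in> A" and r: "0 < r"
    and box: "cball x0 (3 * r) \<subseteq> snd b ` fst b"
    and Fbox: "\<And>x. x \<in> cball x0 (3 * r) \<Longrightarrow> F (chart_inv b x) \<in> fst a"
    and \<K>: "finite \<K>"
    and \<K>': "\<And>K U. (K, U) \<in> \<K> \<Longrightarrow> compact K \<and> K \<subseteq> N \<and> openin (top_of_set X) U \<and> F ` K \<subseteq> U"
  obtains F' where "cmap F'"
    "\<And>p. p \<in> N \<Longrightarrow> p \<notin> chart_inv b ` cball x0 (2 * r) \<Longrightarrow> F' p = F p"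
    "\<And>p. p \<in> N \<Longrightarrow> good F p \<Longrightarrow> good F' p"
    "\<And>x. x \<in> ball x0 r \<Longrightarrow> good F' (chart_inv b x)"
    "\<And>K U. (K, U) \<in> \<K> \<Longrightarrow> F' ` K \<subseteq> U"
proof -
  \<comment> \<open>Three radii: within \<open>r\<close> the new map becomes good, the bump function
    is supported within \<open>2 * r\<close>, and up to \<open>3 * r\<close> the map is expressed in
    the charts \<open>b\<close> and \<open>a\<close>, which leaves a collar for gluing.\<close>
  define C where "C = cball x0 (3 * r)"
  define Bx where "Bx = ball x0 (3 * r)"
  define f where "f = local_rep b a F"
  define Y where "Y = snd a ` fst a"
  have C: "compact C" "Bx \<subseteq> C" "C \<subseteq> snd b ` fst b" "open Bx"
    using box by (auto simp: C_def Bx_def)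
  have CH: "C \<subseteq> H" using C(3) openin_imp_subset[OF src.open_img[OF b]] by blast
  have BxH: "Bx \<subseteq> interior H" using CH C by (intro interior_maximal) auto
  have inv: "snd b (chart_inv b x) = x" "chart_inv b x \<in> fst b" "chart_inv b x \<in> N" if "x \<in> C" for x
  proof -
    have x: "x \<in> snd b ` fst b" using that C(3) by blast
    show "snd b (chart_inv b x) = x" "chart_inv b x \<in> fst b" "chart_inv b x \<in> N"
      using src.chart_chart_inv[OF b x] src.chart_inv_in[OF b x] src.dom_subset[OF b] by auto
  qed
  have FC: "F (chart_inv b x) \<in> fst a" if "x \<in> C" for x using Fbox that by (simp add: C_def)
  have fY: "f x \<in> Y" "chart_inv a (f x) = F (chart_inv b x)" if "x \<in> C" for x
    using FC[OF that] a by (auto simp: f_def Y_def local_rep_def)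
  have contF: "continuous_on N F" "F ` N \<subseteq> X" using F by (auto simp: cmap_def)
  have cinv: "continuous_on C (chart_inv b)"
    using src.continuous_chart_inv[OF b] C(3) by (rule continuous_on_subset)
  have contf: "continuous_on C f"
    unfolding f_def local_rep_def comp_def
    by (intro continuous_on_compose2[OF tgt.continuous_chart[OF a]] continuous_on_compose2[OF contF(1)] cinv)
      (use inv FC in auto)
  \<comment> \<open>The margin for one pair of \<open>\<K>\<close>: where the box meets
    \<open>K\<close>, values closer than \<open>e\<close> to those of \<open>f\<close> still
    represent points of \<open>U\<close>.\<close>
  have "\<exists>e>0. \<forall>x\<in>C. chart_inv b x \<in> K \<longrightarrow> (\<forall>y. dist (f x) y < e \<longrightarrow> y \<in> snd a ` (fst a \<inter> U))"
    if K: "compact K" "openin (top_of_set X) U" "F ` K \<subseteq> U" for K U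
  proof -
    have "compact (chart_inv b ` C)" using cinv C(1) by (intro compact_continuous_image)
    then have "compact (K \<inter> chart_inv b ` C)"
      using K(1) by (intro compact_Int_closed compact_imp_closed)
    then have "compact (snd b ` (K \<inter> chart_inv b ` C))"
      by (rule compact_continuous_image[OF continuous_on_subset[OF src.continuous_chart[OF b]], rotated])
        (use inv in auto)
    then have "compact {x \<in> C. chart_inv b x \<in> K}"
      by (rule back_subst[of compact]) (use inv in \<open>force simp: image_iff\<close>)
    moreover have "continuous_on {x \<in> C. chart_inv b x \<in> K} f"
      by (rule continuous_on_subset[OF contf]) auto
    moreover have "open (snd a ` (fst a \<inter> U))"
      using tgt.open_img_Int[OF a K(2)] by simp
    moreover have "f ` {x \<in> C. chart_inv b x \<in> K} \<subseteq> snd a ` (fst a \<inter> U)"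
      using K(3) FC by (auto simp: f_def local_rep_def)
    ultimately have "\<exists>e>0. \<forall>x\<in>{x \<in> C. chart_inv b x \<in> K}. \<forall>y. dist (f x) y < e \<longrightarrow> y \<in> snd a ` (fst a \<inter> U)"
      by (rule compact_image_uniform_nhd)
    then show ?thesis by blast
  qed
  then have "\<forall>q\<in>\<K>. \<exists>e>0. \<forall>x\<in>C. chart_inv b x \<in> fst q \<longrightarrow> (\<forall>y. dist (f x) y < e \<longrightarrow> y \<in> snd a ` (fst a \<inter> snd q))"
    using \<K>' by (metis prod.collapse)
  then obtain e where e: "\<And>q. q \<in> \<K> \<Longrightarrow> e q > 0"
    "\<And>q x y. q \<in> \<K> \<Longrightarrow> x \<in> C \<Longrightarrow> chart_inv b x \<in> fst q \<Longrightarrow> dist (f x) y < e q \<Longrightarrow> y \<in> snd a ` (fst a \<inter> snd q)"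
    by metis
  obtain e0 where e0: "e0 > 0" "\<And>x y. x \<in> C \<Longrightarrow> dist (f x) y < e0 \<Longrightarrow> y \<in> Y"
  proof -
    have "open Y" "f ` C \<subseteq> Y" using tgt.open_img[OF a] fY(1) by (auto simp: Y_def)
    from compact_image_uniform_nhd[OF C(1) contf this] show ?thesis using that by blast
  qed
  define \<epsilon> where "\<epsilon> = Min (insert e0 (e ` \<K>))"
  have \<epsilon>: "\<epsilon> > 0" "\<epsilon> \<le> e0" "\<And>q. q \<in> \<K> \<Longrightarrow> \<epsilon> \<le> e q"
    using \<K> e(1) e0(1) by (auto simp: \<epsilon>_def)
  obtain g where g: "polynomial_function g" "\<And>x. x \<in> C \<Longrightarrow> norm (f x - g x) < \<epsilon> / 3"
    using Stone_Weierstrass_polynomial_function[OF C(1) contf, of "\<epsilon> / 3"] \<epsilon>(1) by auto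
  obtain \<beta> :: "'d \<Rightarrow> real" where \<beta>: "\<And>k. C_on k UNIV \<beta>" "\<And>x. 0 \<le> \<beta> x" "\<And>x. \<beta> x \<le> 1"
    "\<And>x. x \<in> cball x0 r \<Longrightarrow> \<beta> x = 1" "\<And>x. x \<notin> ball x0 (2 * r) \<Longrightarrow> \<beta> x = 0"
    using smooth_bump[OF r] by blast
  have sm\<beta>: "smooth_within UNIV \<beta> x" for x by (rule smooth_withinI[OF open_UNIV]) (auto intro: \<beta>)
  have smg: "smooth_within UNIV g x" for x
    by (rule smooth_withinI[OF open_UNIV]) (auto intro: smooth_polynomial_function g)
  \<comment> \<open>On \<open>cball x0 r\<close> this is the polynomial \<open>g\<close>, smooth
    whatever \<open>f\<close> is; elsewhere it is smooth at least where \<open>f\<close> is.\<close>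
  define fs where "fs x = f x + \<beta> x *\<^sub>R (g x + - 1 *\<^sub>R f x)" for x
  define \<Omega> where "\<Omega> = Bx \<inter> {x. smooth_within UNIV fs x} \<inter> {x. 0 < \<beta> x}"
  have "continuous_on UNIV \<beta>" using \<beta>(1)[of 0] by simp
  then have \<Omega>_open: "open \<Omega>"
    unfolding \<Omega>_def using C(4) open_smooth_points
    by (intro open_Int open_Collect_less continuous_on_const) auto
  obtain M where M: "countable M" "\<And>c S. (c, S) \<in> M \<Longrightarrow> slice_chart A Z S c \<and> dim S + 1 = DIM('e)"
    "\<And>q. q \<in> Z \<Longrightarrow> \<exists>(c, S)\<in>M. q \<in> fst c"
    using countable_slice_cover[OF Z] by blast
  define E where "E m = snd a ` (fst a \<inter> fst (fst m))" for m :: "('a, 'e) chart \<times> 'e set"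
  define \<tau> where "\<tau> m = local_rep a (fst m) (\<lambda>x. x)" for m :: "('a, 'e) chart \<times> 'e set"
  define T where "T m y = frechet_derivative (\<tau> m) (at y)" for m y
  define SL where "SL m n \<eta> \<longleftrightarrow> open (E m) \<and> continuous_on (E m) (\<lambda>y. n \<bullet> \<tau> m y) \<and> negligible {y \<in> E m. n \<bullet> \<tau> m y = 0} \<and>
    \<eta> differentiable_on E m \<and> (\<forall>y\<in>E m. \<eta> y \<noteq> 0) \<and> snd m \<subseteq> {v. n \<bullet> v = 0} \<and>
    (\<forall>y\<in>E m. (\<tau> m has_derivative T m y) (at y) \<and> (\<forall>v. \<eta> y \<bullet> v = n \<bullet> T m y v))" for m n \<eta>
  have "\<exists>n \<eta>. SL m n \<eta>" if "m \<in> M" for m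
  proof -
    have "slice_chart A Z (snd m) (fst m)" "dim (snd m) + 1 = DIM('e)"
      using M(2)[of "fst m" "snd m"] that by simp_all
    from slice_function[OF a this] show ?thesis
      unfolding SL_def E_def \<tau>_def T_def Let_def .
  qed
  then obtain n \<eta> where "\<And>m. m \<in> M \<Longrightarrow> SL m (n m) (\<eta> m)" by metis
  note sl = this[unfolded SL_def]
  obtain R where R: "R > 0" "\<And>x. x \<in> C \<Longrightarrow> norm x \<le> R"
    using C(1) compact_imp_bounded bounded_pos by metis
  \<comment> \<open>Of the permitted distance \<epsilon>, one third goes to the approximation
    \<open>g\<close> and one third to the affine map, whose norm on \<open>C\<close> is at most
    \<delta> R + \<delta>.\<close>
  define \<delta> where "\<delta> = (\<epsilon> / 3) / (R + 1)"
  have "R + 1 \<noteq> 0" using R(1) by simp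
  then have \<delta>: "\<delta> > 0" "\<delta> * (R + 1) = \<epsilon> / 3"
    using \<epsilon>(1) R(1) nonzero_eq_divide_eq[of "R + 1" \<delta> "\<epsilon> / 3"] by (auto simp: \<delta>_def)
  let ?Df = "\<lambda>x. frechet_derivative fs (at x)" and ?D\<beta> = "\<lambda>x. frechet_derivative \<beta> (at x)"
  have dfs: "(fs has_derivative ?Df x) (at x)" "(\<lambda>x. ?Df x i) differentiable (at x)" if "x \<in> \<Omega>" for x i
    using smooth_within_UNIV_differentiable[of fs x] that by (auto simp: \<Omega>_def)
  have d\<beta>: "(\<beta> has_derivative ?D\<beta> x) (at x)" "(\<lambda>x. ?D\<beta> x i) differentiable (at x)" for x i
    using smooth_within_UNIV_differentiable[OF sm\<beta>] by auto
  obtain \<alpha> :: "'d \<Rightarrow>\<^sub>L 'e" and v where \<alpha>: "norm \<alpha> < \<delta>" "norm v < \<delta>"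
    "\<And>m x y. m \<in> M \<Longrightarrow> x \<in> \<Omega> \<Longrightarrow> y = fs x + \<beta> x *\<^sub>R (blinfun_apply \<alpha> x + v) \<Longrightarrow> y \<in> E m \<Longrightarrow> n m \<bullet> \<tau> m y = 0 \<Longrightarrow>
      \<exists>i\<in>Basis. \<eta> m y \<bullet> (?Df x i + ?D\<beta> x i *\<^sub>R (blinfun_apply \<alpha> x + v) + \<beta> x *\<^sub>R blinfun_apply \<alpha> i) \<noteq> 0"
  proof (rule generic_perturbation[OF \<Omega>_open dfs(1) _ d\<beta>(1) _ _ M(1), where h = "\<lambda>m y. n m \<bullet> \<tau> m y" and \<eta> = \<eta>
        and E = E and \<epsilon> = \<delta>], goal_cases)
    case (2 i) show ?case using dfs(2) by (auto simp: differentiable_on_def intro: differentiable_at_withinI)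
  next
    case (3 i) show ?case using d\<beta>(2) by (auto simp: differentiable_on_def intro: differentiable_at_withinI)
  next
    case (11 \<alpha> v) show ?case by (rule 11(1)[OF 11(2,3)]) (rule 11(4))
  qed (use sl \<delta>(1) in \<open>auto simp: \<Omega>_def\<close>)
  define k where "k x = blinfun_apply \<alpha> x + v" for x
  define f' where "f' x = fs x + \<beta> x *\<^sub>R k x" for x
  have kd: "(k has_derivative blinfun_apply \<alpha>) (at x)" for x
    unfolding k_def by (auto intro!: derivative_eq_intros)
  have smk: "smooth_within UNIV k x" for x
    unfolding k_def
    by (intro smooth_within_add smooth_within_const smooth_within_bounded_linear blinfun.bounded_linear_right)
  have f'_near: "dist (f x) (f' x) < \<epsilon>" if "x \<in> C" for x
  proof -
    have "norm (k x) \<le> norm \<alpha> * norm x + norm v"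
      unfolding k_def using norm_blinfun norm_triangle_le by (metis add.commute add_le_cancel_left)
    also have "\<dots> \<le> \<delta> * R + \<delta>"
      using \<alpha>(1,2) R(2)[OF that] \<delta>(1) by (intro add_mono mult_mono) auto
    also have "\<dots> = \<epsilon> / 3" using \<delta>(2) by (simp add: algebra_simps)
    finally have k: "norm (k x) \<le> \<epsilon> / 3" .
    have "norm (f' x - f x) = \<bar>\<beta> x\<bar> * norm ((g x - f x) + k x)"
      unfolding norm_scaleR[symmetric] f'_def fs_def by (simp add: algebra_simps)
    also have "\<dots> \<le> 1 * (norm (g x - f x) + norm (k x))"
      using \<beta>(2,3)[of x] by (intro mult_mono norm_triangle_ineq) auto
    also have "\<dots> < \<epsilon>" using k g(2)[OF that] \<epsilon>(1) by (simp add: norm_minus_commute)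
    finally show ?thesis by (simp add: dist_norm norm_minus_commute)
  qed
  have f'Y: "f' x \<in> Y" if "x \<in> C" for x
    using e0(2)[OF that] f'_near[OF that] \<epsilon>(2) by auto
  have ca: "snd a (chart_inv a y) = y" "chart_inv a y \<in> fst a" "chart_inv a y \<in> X" if "y \<in> Y" for y
    using that a tgt.dom_subset[OF a] by (auto simp: Y_def)
  define O' where "O' = chart_inv b ` Bx"
  define L where "L = chart_inv b ` cball x0 (2 * r)"
  have Bx2: "cball x0 (2 * r) \<subseteq> Bx" using r by (auto simp: Bx_def)
  \<comment> \<open>Both formulas agree between the radii \<open>2 * r\<close> and
    \<open>3 * r\<close>, where \<open>\<beta>\<close> vanishes. Hence \<open>F'\<close> is
    continuous on each of the open sets \<open>O'\<close> and \<open>N - L\<close>, which cover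
    \<open>N\<close>.\<close>
  define F' where "F' p = (if p \<in> O' then chart_inv a (f' (snd b p)) else F p)" for p
  have F'_inv: "F' (chart_inv b x) = chart_inv a (f' x)" if "x \<in> Bx" for x
    using that inv C(2) by (auto simp: F'_def O'_def)
  have f'_off: "f' x = f x" if "x \<notin> ball x0 (2 * r)" for x
    using \<beta>(5)[OF that] by (simp add: f'_def fs_def)
  have F'_off: "F' p = F p" if "p \<in> N - L" for p
  proof (cases "p \<in> O'")
    case True
    then obtain x where x: "x \<in> Bx" "p = chart_inv b x" by (auto simp: O'_def)
    then have "x \<notin> ball x0 (2 * r)" using that by (force simp: L_def)
    then show ?thesis using x F'_inv f'_off fY(2) C(2) by auto
  qed (simp add: F'_def)
  have L: "compact L" unfolding L_def
    using Bx2 C(2) by (intro compact_continuous_image continuous_on_subset[OF cinv]) auto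
  have LN: "openin (top_of_set N) (N - L)"
    using compact_imp_closed[OF L] by (simp add: Diff_eq open_Compl openin_open_Int)
  have O'_open: "openin (top_of_set N) O'"
  proof -
    have "openin (top_of_set (fst b)) (fst b \<inter> snd b -` Bx)"
      by (rule continuous_openin_preimage_gen[OF src.continuous_chart[OF b] C(4)])
    moreover have "fst b \<inter> snd b -` Bx = O'"
      using inv C(2) b by (force simp: O'_def)
    ultimately show ?thesis using src.open_dom[OF b] openin_trans by metis
  qed
  have N_eq: "O' \<union> (N - L) = N"
    using Bx2 inv C(2) by (auto simp: O'_def L_def)
  have smf': "smooth_within UNIV f' x" if "smooth_within UNIV fs x" for x
    unfolding f'_def by (intro smooth_within_add smooth_within_scaleR that sm\<beta> smk)
  have contf': "continuous_on C f'"
    unfolding f'_def fs_def k_def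
    by (intro continuous_intros contf continuous_on_subset[OF \<open>continuous_on UNIV \<beta>\<close> subset_UNIV]
        continuous_on_polymonial_function[OF g(1)])
  have "continuous_on O' (\<lambda>p. chart_inv a (f' (snd b p)))"
    by (intro continuous_on_compose2[OF tgt.continuous_chart_inv[OF a]] continuous_on_compose2[OF contf']
        continuous_on_subset[OF src.continuous_chart[OF b]])
      (use inv f'Y C(2) in \<open>auto simp: O'_def Y_def\<close>)
  then have "continuous_on O' F'" by (rule continuous_on_eq) (simp add: F'_def)
  moreover have "continuous_on (N - L) F'"
    by (rule continuous_on_eq[OF continuous_on_subset[OF contF(1)]]) (use F'_off in auto)
  ultimately have "continuous_on N F'"
    using continuous_on_Un_local_open[of O' "N - L" F'] O'_open LN N_eq by simp
  moreover have "F' ` N \<subseteq> X"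
    using contF(2) inv f'Y ca C(2) by (auto simp: F'_def O'_def)
  ultimately have cF': "cmap F'" by (simp add: cmap_def)
  have rep': "local_rep b c F' x = local_rep a c (\<lambda>x. x) (f' x)" if "x \<in> Bx" for x and c :: "('a, 'e) chart"
    using F'_inv[OF that] by (simp add: local_rep_def)
  have repa: "local_rep b a F' x = f' x" if "x \<in> Bx" for x
    using F'_inv[OF that] ca(1) f'Y that C(2) by (auto simp: local_rep_def)
  have rep: "local_rep b c F x = local_rep a c (\<lambda>x. x) (f x)" if "x \<in> Bx" for x and c :: "('a, 'e) chart"
    using fY(2) that C(2) by (auto simp: local_rep_def)
  have good': "good F' (chart_inv b x)" if x: "x \<in> Bx" and disj: "good F (chart_inv b x) \<or> x \<in> ball x0 r" for x
  proof -
    let ?p = "chart_inv b x"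
    have xC: "x \<in> C" and xH: "x \<in> H" using x C(2) CH by auto
    have p: "?p \<in> fst b" "snd b ?p = x" using inv[OF xC] by auto
    have smF: "smooth_within UNIV f x" if "good F ?p"
    proof -
      have "smooth_within H f x"
        using smooth_pt_rep[OF F _ b p(1) a FC[OF xC]] that p(2) unfolding good_def f_def by auto
      then show ?thesis using smooth_within_interior BxH x by blast
    qed
    have smfs: "smooth_within UNIV fs x"
      using disj
    proof
      assume "good F ?p"
      then show ?thesis unfolding fs_def
        by (intro smooth_within_add smooth_within_scaleR sm\<beta> smg smF smooth_within_const)
    next
      assume "x \<in> ball x0 r"
      then show ?thesis
        by (intro smooth_within_transfer[OF smg open_ball]) (use \<beta>(4) in \<open>auto simp: fs_def\<close>)
    qed
    have sm: "smooth_within UNIV f' x" using smf'[OF smfs] .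
    have F'p: "F' ?p = chart_inv a (f' x)" using F'_inv[OF x] .
    then have F'a: "F' ?p \<in> fst a" using ca f'Y xC by auto
    have "smooth_within H (local_rep b a F') x"
      by (rule smooth_within_transfer[OF smooth_within_UNIV[OF sm, of H] C(4) x]) (use repa in auto)
    then have sp: "smooth_pt F' ?p"
      unfolding smooth_pt_def using a b p(1) F'a by (metis p(2))
    \<comment> \<open>Where \<open>\<beta>\<close> is positive, transversality comes afresh from the
      generic choice; where it vanishes, it is inherited from \<open>F\<close>.\<close>
    moreover have "\<exists>b c S. transv_at F' ?p b c S" if inZ: "F' ?p \<in> Z"
    proof (cases "\<beta> x > 0")
      case True
      then have x\<Omega>: "x \<in> \<Omega>" using x smfs by (simp add: \<Omega>_def)
      obtain c S where cS: "(c, S) \<in> M" "F' ?p \<in> fst c" using M(3)[OF inZ] by blast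
      note sc = M(2)[OF cS(1)]
      let ?m = "(c, S)"
      have yE: "f' x \<in> E ?m" using F'p F'a cS(2) ca(1) f'Y xC by (force simp: E_def)
      have "snd c (F' ?p) \<in> S" using sc cS(2) inZ unfolding slice_chart_def by blast
      then have "n ?m \<bullet> \<tau> ?m (f' x) = 0"
        using sl[OF cS(1)] F'p by (auto simp: \<tau>_def local_rep_def)
      then obtain i where i: "\<eta> ?m (f' x) \<bullet> (?Df x i + ?D\<beta> x i *\<^sub>R k x + \<beta> x *\<^sub>R blinfun_apply \<alpha> i) \<noteq> 0"
        using \<alpha>(3)[OF cS(1) x\<Omega> _ yE] by (auto simp: f'_def k_def)
      let ?D = "\<lambda>i. ?Df x i + (\<beta> x *\<^sub>R blinfun_apply \<alpha> i + ?D\<beta> x i *\<^sub>R k x)"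
      have D: "(f' has_derivative ?D) (at x)"
        unfolding f'_def by (intro has_derivative_add has_derivative_scaleR dfs(1)[OF x\<Omega>] d\<beta>(1) kd)
      have Td: "(\<tau> ?m has_derivative T ?m (f' x)) (at (f' x))" "n ?m \<bullet> T ?m (f' x) (?D i) \<noteq> 0"
        using sl[OF cS(1)] yE i by (auto simp: add_ac)
      have repD: "(local_rep b c F' has_derivative (\<lambda>w. T ?m (f' x) (?D w))) (at x within H)"
        by (rule has_derivative_compose_local[where T = UNIV, OF has_derivative_at_withinI[OF D] _ xH C(4) x])
          (use Td(1) rep' in \<open>auto simp: \<tau>_def\<close>)
      have "T ?m (f' x) (?D i) \<notin> S" using Td(2) sl[OF cS(1)] by auto
      then have "transv_at F' ?p b c S"
        unfolding transv_at_def p(2)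
        by (intro conjI b p(1) cS(2) exI[of _ "\<lambda>w. T ?m (f' x) (?D w)"] exI[of _ i] repD) (use sc in auto)
      then show ?thesis by blast
    next
      case False
      then have \<beta>0: "\<beta> x = 0" using \<beta>(2)[of x] by linarith
      then have "x \<notin> ball x0 r" using \<beta>(4)[of x] by auto
      then have gF: "good F ?p" using disj by blast
      have ff': "f' x = f x" using \<beta>0 by (simp add: f'_def fs_def)
      then have eq: "F' ?p = F ?p" using F'p fY(2)[OF xC] by simp
      then obtain b1 c S where "transv_at F ?p b1 c S" using gF inZ unfolding good_def by auto
      then have "transv_at F ?p b c S"
        using transv_change[OF F _ _ b p(1)] gF unfolding good_def by blast
      then obtain D \<xi> where D: "slice_chart A Z S c" "F ?p \<in> fst c" "dim S + 1 = DIM('e)"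
        "(local_rep b c F has_derivative D) (at x within H)" "D \<xi> \<notin> S"
        unfolding transv_at_def p(2) by blast
      have cA: "c \<in> A" using D(1) by (simp add: slice_chart_def)
      let ?fD = "frechet_derivative f (at x)" and ?gD = "frechet_derivative g (at x)"
      have fD: "(f has_derivative ?fD) (at x)" and gD: "(g has_derivative ?gD) (at x)"
        using smooth_within_UNIV_differentiable(1)[OF smF[OF gF]] smooth_within_UNIV_differentiable(1)[OF smg] by simp_all
      \<comment> \<open>A zero of \<open>\<beta>\<close> is a minimum, so the derivative vanishes
        there as well.\<close>
      have D\<beta>0: "?D\<beta> x = (\<lambda>v. 0)"
        using differential_zero_maxmin[of x UNIV \<beta>] d\<beta>(1) \<beta>(2) \<beta>0 by auto
      have "(f' has_derivative (\<lambda>v. (?fD v + (\<beta> x *\<^sub>R (?gD v + - 1 *\<^sub>R ?fD v) + ?D\<beta> x v *\<^sub>R (g x + - 1 *\<^sub>R f x)))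
          + (\<beta> x *\<^sub>R blinfun_apply \<alpha> v + ?D\<beta> x v *\<^sub>R k x))) (at x)"
        unfolding f'_def fs_def
        by (intro has_derivative_add has_derivative_scaleR has_derivative_scaleR_right fD gD d\<beta>(1) kd)
      then have f'D: "(f' has_derivative ?fD) (at x)" by (simp add: \<beta>0 D\<beta>0)
      let ?\<tau> = "local_rep a c (\<lambda>x. x)"
      have fx: "snd a (F ?p) = f x" using xC by (simp add: f_def local_rep_def)
      have "smooth_within UNIV ?\<tau> (f x)"
        using tgt.transition_smooth[OF a cA FC[OF xC] D(2)] fx by simp
      then have \<tau>D: "(?\<tau> has_derivative frechet_derivative ?\<tau> (at (f x))) (at (f x))"
        by (rule smooth_within_UNIV_differentiable(1))
      have "(local_rep b c F has_derivative (\<lambda>w. frechet_derivative ?\<tau> (at (f x)) (?fD w))) (at x within H)"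
        by (rule has_derivative_compose_local[where T = UNIV, OF has_derivative_at_withinI[OF fD] _ xH C(4) x])
          (use \<tau>D rep in auto)
      \<comment> \<open>Uniqueness within \<open>H\<close> identifies the derivative supplied by
        \<open>transv_at\<close> with the one from the chain rule. The latter involves only the
        value and the derivative of \<open>f\<close> at \<open>x\<close>, so it is also the
        derivative for \<open>F'\<close>.\<close>
      then have De: "D = (\<lambda>w. frechet_derivative ?\<tau> (at (f x)) (?fD w))"
        using src.derivative_unique[OF xH D(4)] by blast
      have repD: "(local_rep b c F' has_derivative (\<lambda>w. frechet_derivative ?\<tau> (at (f x)) (?fD w))) (at x within H)"
        by (rule has_derivative_compose_local[where T = UNIV, OF has_derivative_at_withinI[OF f'D] _ xH C(4) x])
          (use \<tau>D rep' ff' in auto)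
      have "transv_at F' ?p b c S"
        unfolding transv_at_def p(2)
        by (intro conjI b p(1) exI[of _ D] exI[of _ \<xi>]) (use D eq De repD in auto)
      then show ?thesis by blast
    qed
    ultimately show ?thesis unfolding good_def by blast
  qed
  show ?thesis
  proof (rule that[OF cF'])
    show "F' p = F p" if "p \<in> N" "p \<notin> chart_inv b ` cball x0 (2 * r)" for p
      using F'_off that by (simp add: L_def)
    show "good F' p" if "p \<in> N" "good F p" for p
    proof (cases "p \<in> O'")
      case True
      then show ?thesis using good' that by (auto simp: O'_def)
    next
      case False
      then have "p \<in> N - L" using N_eq that by auto
      then show ?thesis using good_cong[OF that(2) LN, of F'] F'_off by auto
    qed
    show "good F' (chart_inv b x)" if "x \<in> ball x0 r" for x
      using good'[of x] that r by (auto simp: Bx_def)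
    show "F' ` K \<subseteq> U" if KU: "(K, U) \<in> \<K>" for K U
    proof clarify
      fix p assume p: "p \<in> K"
      show "F' p \<in> U"
      proof (cases "p \<in> O'")
        case True
        then obtain x where x: "x \<in> Bx" "p = chart_inv b x" by (auto simp: O'_def)
        then have xC: "x \<in> C" using C(2) by auto
        have "f' x \<in> snd a ` (fst a \<inter> U)"
          using e(2)[OF KU xC, of "f' x"] x(2) p f'_near[OF xC] \<epsilon>(3)[OF KU] by auto
        then show ?thesis using F'_inv[OF x(1)] x(2) a by auto
      next
        case False
        then show ?thesis using \<K>'[OF KU] p by (auto simp: F'_def)
      qed
    qed
  qed
qed

end

section \<open>Locally finite families of coordinate balls\<close>

text \<open>Exhaust \<open>N\<close> by compact sets and cover each compact annulus by finitely many
  boxes lying in a slightly larger open annulus. The inner sets \<open>K\<close> cover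
  \<open>N\<close> while the outer sets \<open>L\<close> stay locally finite; compactness of the
  \<open>L c\<close> supplies the local compactness of \<open>N\<close>.\<close>

lemma locally_finite_refinement:
  fixes N :: "'p::{t2_space,second_countable_topology} set" and K L :: "'c \<Rightarrow> 'p set"
  assumes basis: "\<And>p U. p \<in> N \<Longrightarrow> openin (top_of_set N) U \<Longrightarrow> p \<in> U \<Longrightarrow> \<exists>c. P c \<and> p \<in> K c \<and> L c \<subseteq> U"
    and P: "\<And>c. P c \<Longrightarrow> openin (top_of_set N) (K c) \<and> K c \<subseteq> L c \<and> compact (L c) \<and> L c \<subseteq> N"
  obtains \<C> where "countable \<C>" "\<And>c. c \<in> \<C> \<Longrightarrow> P c" "\<And>p. p \<in> N \<Longrightarrow> \<exists>c\<in>\<C>. p \<in> K c"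
    "\<And>p. p \<in> N \<Longrightarrow> \<exists>T. openin (top_of_set N) T \<and> p \<in> T \<and> finite {c \<in> \<C>. L c \<inter> T \<noteq> {}}"
proof (cases "N = {}")
  case True
  then show ?thesis using that[of "{}"] by simp
next
  case False
  have cov: "\<exists>D. finite D \<and> (\<forall>c\<in>D. P c \<and> L c \<subseteq> U) \<and> Q \<subseteq> (\<Union>c\<in>D. K c)"
    if Q: "compact Q" "Q \<subseteq> U" "openin (top_of_set N) U" for Q U
  proof -
    have "\<forall>p\<in>Q. \<exists>c. P c \<and> p \<in> K c \<and> L c \<subseteq> U"
      using basis Q openin_imp_subset[OF Q(3)] by blast
    then obtain c where c: "\<And>p. p \<in> Q \<Longrightarrow> P (c p) \<and> p \<in> K (c p) \<and> L (c p) \<subseteq> U" by metis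
    have "\<forall>p\<in>Q. \<exists>W. open W \<and> K (c p) = N \<inter> W" using c P by (meson openin_open)
    then obtain W where W: "\<And>p. p \<in> Q \<Longrightarrow> open (W p) \<and> K (c p) = N \<inter> W p" by metis
    have "Q \<subseteq> (\<Union>p\<in>Q. W p)" using c W by blast
    then obtain D where D: "D \<subseteq> Q" "finite D" "Q \<subseteq> (\<Union>p\<in>D. W p)"
      using compactE_image[OF Q(1), of Q W] W by metis
    have "Q \<subseteq> (\<Union>p\<in>D. K (c p))"
      using D W Q openin_imp_subset[OF Q(3)] by blast
    moreover have "\<forall>d\<in>c ` D. P d \<and> L d \<subseteq> U" using D(1) c by blast
    ultimately show ?thesis using D(2) by (intro exI[of _ "c ` D"]) auto
  qed
  have grow: "\<exists>E' I'. compact E' \<and> E' \<subseteq> N \<and> openin (top_of_set N) I' \<and> Q \<subseteq> I' \<and> I' \<subseteq> E'"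
    if Q: "compact Q" "Q \<subseteq> N" for Q
  proof -
    obtain D where D: "finite D" "\<forall>c\<in>D. P c \<and> L c \<subseteq> N" "Q \<subseteq> (\<Union>c\<in>D. K c)"
      using cov[OF Q openin_subtopology_self] by blast
    show ?thesis
    proof (intro exI conjI)
      show "compact (\<Union>c\<in>D. L c)" using D P by (intro compact_UN) auto
      show "openin (top_of_set N) (\<Union>c\<in>D. K c)" using D P by blast
      show "(\<Union>c\<in>D. K c) \<subseteq> (\<Union>c\<in>D. L c)" by (rule UN_mono) (use D P in auto)
    qed (use D in auto)
  qed
  have opn: "openin (top_of_set N) U" if "U \<in> {K c | c. P c}" for U using that P by blast
  obtain \<W> where \<W>: "\<W> \<subseteq> {K c | c. P c}" "countable \<W>" "\<Union>\<W> = \<Union>{K c | c. P c}"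
    by (rule Lindelof_openin[of "{K c | c. P c}" N, OF opn]) (assumption, rule that)
  have covN: "N \<subseteq> \<Union>\<W>" unfolding \<W>(3) using basis[OF _ openin_subtopology_self] by blast
  then have "\<W> \<noteq> {}" using False by auto
  have "\<forall>W\<in>\<W>. \<exists>c. P c \<and> K c = W" using \<W>(1) by blast
  then obtain w where w: "\<And>W. W \<in> \<W> \<Longrightarrow> P (w W) \<and> K (w W) = W" by metis
  define c where "c n = w (from_nat_into \<W> n)" for n
  have c: "P (c n)" for n
    using w from_nat_into[OF \<open>\<W> \<noteq> {}\<close>] by (simp add: c_def)
  have c_cov: "\<exists>n. p \<in> K (c n)" if p: "p \<in> N" for p
  proof -
    obtain W where "W \<in> \<W>" "p \<in> W" using covN p by blast
    then show ?thesis using w from_nat_into_surj[OF \<W>(2)] unfolding c_def by metis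
  qed
  \<comment> \<open>Stage \<open>n\<close> is a compact set together with an open set inside it. The
    open part of the next stage swallows this compact set and one more box \<open>c n\<close> of a
    countable cover. Stage 0 is empty.\<close>
  have "\<exists>f :: nat \<Rightarrow> 'p set \<times> 'p set. \<forall>n. (compact (fst (f n)) \<and> fst (f n) \<subseteq> N \<and> openin (top_of_set N) (snd (f n)) \<and> snd (f n) \<subseteq> fst (f n) \<and>
      (n = 0 \<longrightarrow> fst (f n) = {})) \<and>
      fst (f n) \<union> L (c n) \<subseteq> snd (f (Suc n))"
  proof (rule dependent_nat_choice)
    show "\<exists>x. compact (fst x) \<and> fst x \<subseteq> N \<and> openin (top_of_set N) (snd x) \<and> snd x \<subseteq> fst x \<and> ((0::nat) = 0 \<longrightarrow> fst x = {})"
      by (intro exI[of _ "({}, {})"]) auto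
    fix x :: "'p set \<times> 'p set" and n :: nat
    assume x: "compact (fst x) \<and> fst x \<subseteq> N \<and> openin (top_of_set N) (snd x) \<and> snd x \<subseteq> fst x \<and> (n = 0 \<longrightarrow> fst x = {})"
    have "compact (fst x \<union> L (c n))" "fst x \<union> L (c n) \<subseteq> N" using x P[OF c[of n]] by auto
    from grow[OF this] obtain E' I' where "compact E'" "E' \<subseteq> N" "openin (top_of_set N) I'"
      "fst x \<union> L (c n) \<subseteq> I'" "I' \<subseteq> E'" by blast
    then show "\<exists>y. (compact (fst y) \<and> fst y \<subseteq> N \<and> openin (top_of_set N) (snd y) \<and> snd y \<subseteq> fst y \<and> (Suc n = 0 \<longrightarrow> fst y = {})) \<and>
        fst x \<union> L (c n) \<subseteq> snd y"
      by (intro exI[of _ "(E', I')"]) auto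
  qed
  then obtain f :: "nat \<Rightarrow> 'p set \<times> 'p set" where f: "\<And>n. (compact (fst (f n)) \<and> fst (f n) \<subseteq> N \<and> openin (top_of_set N) (snd (f n)) \<and> snd (f n) \<subseteq> fst (f n) \<and>
      (n = 0 \<longrightarrow> fst (f n) = {})) \<and>
      fst (f n) \<union> L (c n) \<subseteq> snd (f (Suc n))" by blast
  define E where "E n = fst (f n)" for n
  define I where "I n = snd (f n)" for n
  have E: "compact (E n)" "E n \<subseteq> N" "openin (top_of_set N) (I n)" "I n \<subseteq> E n" "E 0 = {}"
    "E n \<union> L (c n) \<subseteq> I (Suc n)" for n
    using f[of n] f[of 0] by (auto simp: E_def I_def)
  have "E n \<subseteq> E (Suc n)" for n using E(4)[of "Suc n"] E(6)[of n] by blast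
  then have mono: "E m \<subseteq> E n" if "m \<le> n" for m n
    using that by (rule lift_Suc_mono_le)
  define An where "An n = E (Suc n) - I n" for n
  \<comment> \<open>For \<open>n = 0\<close> the truncated \<open>n - 1\<close> is 0 and
    \<open>E 0\<close> is empty, so nothing is removed. Since \<open>U k\<close> avoids
    \<open>E (k - 1)\<close>, it meets \<open>I (Suc n)\<close> only for
    \<open>k \<le> Suc n\<close>, which gives local finiteness.\<close>
  define U where "U n = I (Suc (Suc n)) - E (n - 1)" for n
  have An_compact: "compact (An n)" for n
  proof -
    obtain W where W: "open W" "I n = N \<inter> W" using E(3) openin_open by metis
    have "An n = E (Suc n) - W" using W E(2) unfolding An_def by blast
    then show ?thesis using E(1) W(1) by (simp add: compact_diff)
  qed
  have An_U: "An n \<subseteq> U n" for n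
  proof -
    have "E (n - 1) \<subseteq> I n" using E(5) E(6)[of "n - 1"] by (cases n) auto
    then show ?thesis using E(6)[of "Suc n"] unfolding An_def U_def by blast
  qed
  have U_open: "openin (top_of_set N) (U n)" for n
  proof -
    have "openin (top_of_set N) (I (Suc (Suc n)) \<inter> - E (n - 1))"
      by (intro openin_Int_open open_Compl E(3) compact_imp_closed[OF E(1)])
    then show ?thesis by (simp add: U_def Diff_eq)
  qed
  have "\<forall>n. \<exists>D. finite D \<and> (\<forall>c\<in>D. P c \<and> L c \<subseteq> U n) \<and> An n \<subseteq> (\<Union>c\<in>D. K c)"
    using cov[OF An_compact An_U U_open] by blast
  then obtain D where D: "\<And>n. finite (D n)" "\<And>n c. c \<in> D n \<Longrightarrow> P c \<and> L c \<subseteq> U n" "\<And>n. An n \<subseteq> (\<Union>c\<in>D n. K c)"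
    by metis
  show ?thesis
  proof (rule that[of "\<Union>n. D n"])
    show "countable (\<Union>n. D n)" using D(1) by (intro countable_UN) (auto intro: countable_finite)
    show "P c" if "c \<in> (\<Union>n. D n)" for c using that D(2) by blast
    show "\<exists>c\<in>\<Union>n. D n. p \<in> K c" if p: "p \<in> N" for p
    proof -
      obtain n where "p \<in> K (c n)" using c_cov p by blast
      then have "p \<in> E (Suc n)" using P[OF c[of n]] E(4)[of "Suc n"] E(6)[of n] by blast
      then have ex: "\<exists>m. p \<in> E m" by blast
      define m where "m = (LEAST m. p \<in> E m)"
      have m: "p \<in> E m" "\<And>k. k < m \<Longrightarrow> p \<notin> E k"
        using LeastI_ex[OF ex] not_less_Least unfolding m_def by auto
      then obtain k where k: "m = Suc k" using E(5) by (cases m) auto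
      have "p \<in> An k" using m(1) m(2)[of k] E(4)[of k] unfolding k An_def by auto
      then show ?thesis using D(3)[of k] by blast
    qed
    show "\<exists>T. openin (top_of_set N) T \<and> p \<in> T \<and> finite {c \<in> \<Union>n. D n. L c \<inter> T \<noteq> {}}" if p: "p \<in> N" for p
    proof -
      obtain n where "p \<in> K (c n)" using c_cov p by blast
      then have pI: "p \<in> I (Suc n)" using P[OF c[of n]] E(6)[of n] by blast
      have "{c \<in> \<Union>n. D n. L c \<inter> I (Suc n) \<noteq> {}} \<subseteq> (\<Union>k\<le>Suc n. D k)"
      proof clarify
        fix d k assume d: "d \<in> D k" "L d \<inter> I (Suc n) \<noteq> {}"
        have "k \<le> Suc n"
        proof (rule ccontr)
          assume "\<not> k \<le> Suc n"
          then have "Suc n \<le> k - 1" by simp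
          then have "I (Suc n) \<subseteq> E (k - 1)" using E(4)[of "Suc n"] mono by blast
          then show False using d D(2)[OF d(1)] unfolding U_def by blast
        qed
        then show "d \<in> (\<Union>k\<le>Suc n. D k)" using d(1) by blast
      qed
      moreover have "finite (\<Union>k\<le>Suc n. D k)" using D(1) by blast
      ultimately have "finite {c \<in> \<Union>n. D n. L c \<inter> I (Suc n) \<noteq> {}}" by (rule finite_subset)
      then show ?thesis using pI E(3)[of "Suc n"] by (intro exI[of _ "I (Suc n)"] conjI)
    qed
  qed
qed

text \<open>Local finiteness passes from points to compact sets by a finite subcover. It makes the
  set \<open>\<K>\<close> of conditions in \<open>box_step\<close> finite.\<close>

lemma finite_meeting_compact:
  assumes "compact Q" "Q \<subseteq> N"
    and "\<And>p. p \<in> N \<Longrightarrow> \<exists>T. openin (top_of_set N) T \<and> p \<in> T \<and> finite {c \<in> \<C>. L c \<inter> T \<noteq> {}}"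
  shows "finite {c \<in> \<C>. L c \<inter> Q \<noteq> {}}"
proof -
  have "\<exists>W. open W \<and> p \<in> W \<and> finite {c \<in> \<C>. L c \<inter> (N \<inter> W) \<noteq> {}}" if p: "p \<in> Q" for p
  proof -
    obtain T where T: "openin (top_of_set N) T" "p \<in> T" "finite {c \<in> \<C>. L c \<inter> T \<noteq> {}}"
      using assms(2,3) p by blast
    then obtain W where "open W" "T = N \<inter> W" by (auto simp: openin_open)
    then show ?thesis using T(2,3) by (intro exI[of _ W]) simp
  qed
  then have "\<forall>p\<in>Q. \<exists>W. open W \<and> p \<in> W \<and> finite {c \<in> \<C>. L c \<inter> (N \<inter> W) \<noteq> {}}" by (rule ballI)
  from bchoice[OF this] obtain W
    where W: "\<forall>p\<in>Q. open (W p) \<and> p \<in> W p \<and> finite {c \<in> \<C>. L c \<inter> (N \<inter> W p) \<noteq> {}}" ..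
  have W1: "open (W p)" if "p \<in> Q" for p using W that by simp
  have W2: "Q \<subseteq> (\<Union>p\<in>Q. W p)" using W by blast
  obtain D where D: "D \<subseteq> Q" "finite D" "Q \<subseteq> (\<Union>p\<in>D. W p)"
    using compactE_image[OF assms(1) W1 W2] .
  have "{c \<in> \<C>. L c \<inter> Q \<noteq> {}} \<subseteq> (\<Union>p\<in>D. {c \<in> \<C>. L c \<inter> (N \<inter> W p) \<noteq> {}})"
    using D(3) assms(2) by blast
  moreover have "finite (\<Union>p\<in>D. {c \<in> \<C>. L c \<inter> (N \<inter> W p) \<noteq> {}})" using D W by blast
  ultimately show ?thesis using finite_subset by blast
qed

section \<open>Globalisation: successive corrections in boxes and their limit\<close>

context chart_maps
begin

text \<open>Only finitely many corrections act near a given point, so they have a locally eventually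
  constant limit. Each point lies in some \<open>K c\<close>: if the box is active, its step makes
  the point good; otherwise the point lies in \<open>G\<close> and was good from the start. Later
  steps preserve this.\<close>

theorem relative_transversality:
  assumes F: "cmap F" and Z: "submanifold X A 1 Z" and H: "closed H"
    and C: "closedin (top_of_set N) C" and G: "openin (top_of_set N) G" "C \<subseteq> G" "\<And>p. p \<in> G \<Longrightarrow> good F p"
    and int: "\<And>p b. p \<in> N - C \<Longrightarrow> b \<in> B \<Longrightarrow> p \<in> fst b \<Longrightarrow> snd b p \<in> interior H"
  obtains F' where "cmap F'" "\<And>p. p \<in> C \<Longrightarrow> F' p = F p" "\<And>p. p \<in> N \<Longrightarrow> good F' p"
proof -
  \<comment> \<open>A box is a tuple \<open>(b, a, x0, r)\<close>: a source chart, a target chart, a centre and a radius.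
    Boxes that are not \<open>act\<close> lie in \<open>G\<close> and are skipped.\<close>
  define bx :: "('p, 'd) chart \<times> ('a, 'e) chart \<times> 'd \<times> real \<Rightarrow> ('p, 'd) chart" where "bx c = fst c" for c
  define ax :: "('p, 'd) chart \<times> ('a, 'e) chart \<times> 'd \<times> real \<Rightarrow> ('a, 'e) chart" where "ax c = fst (snd c)" for c
  define x0 :: "('p, 'd) chart \<times> ('a, 'e) chart \<times> 'd \<times> real \<Rightarrow> 'd" where "x0 c = fst (snd (snd c))" for c
  define r :: "('p, 'd) chart \<times> ('a, 'e) chart \<times> 'd \<times> real \<Rightarrow> real" where "r c = snd (snd (snd c))" for c
  define K where "K c = chart_inv (bx c) ` (H \<inter> ball (x0 c) (r c))" for c
  define L where "L c = chart_inv (bx c) ` (H \<inter> cball (x0 c) (3 * r c))" for c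
  define act where "act c \<longleftrightarrow> cball (x0 c) (3 * r c) \<subseteq> H \<and> L c \<inter> C = {}" for c
  \<comment> \<open>The target chart of each box is fixed in advance, with respect to the original
    \<open>F\<close>; \<open>Inv\<close> below keeps the later maps compatible with that
    choice.\<close>
  define P where "P c \<longleftrightarrow> bx c \<in> B \<and> ax c \<in> A \<and> 0 < r c \<and> H \<inter> cball (x0 c) (3 * r c) \<subseteq> snd (bx c) ` fst (bx c) \<and>
    F ` L c \<subseteq> fst (ax c) \<and> (act c \<or> L c \<subseteq> G)" for c
  have GN: "G \<subseteq> N" and CN: "C \<subseteq> N" using openin_imp_subset[OF G(1)] closedin_imp_subset[OF C] by auto
  have basis: "\<exists>c. P c \<and> p \<in> K c \<and> L c \<subseteq> U" if p: "p \<in> N" "openin (top_of_set N) U" "p \<in> U" for p U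
  proof -
    obtain b where b: "b \<in> B" "p \<in> fst b" using src.cover p(1) by blast
    have "F p \<in> X" using F p(1) by (auto simp: cmap_def)
    then obtain a where a: "a \<in> A" "F p \<in> fst a" using tgt.cover by blast
    \<comment> \<open>Around a point of \<open>C\<close> the box is put into \<open>G\<close>.
      Around any other point it is put off \<open>C\<close>, and as \<open>int\<close> places its
      centre in the interior of \<open>H\<close>, the whole ball can be taken inside
      \<open>H\<close>, which makes the box active.\<close>
    let ?U = "U \<inter> (N \<inter> F -` fst a) \<inter> (if p \<in> C then G else N - C)"
    have NC: "openin (top_of_set N) (N - C)" using C by (metis closedin_def topspace_euclidean_subtopology)
    have "openin (top_of_set N) ?U"
      by (intro openin_Int p(2) preimage_open[OF F tgt.open_dom[OF a(1)]]) (use G(1) NC in auto)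
    moreover have "p \<in> ?U" using p a G(2) by auto
    ultimately obtain V where V: "open V" "snd b p \<in> V"
      "\<And>x. x \<in> H \<Longrightarrow> x \<in> V \<Longrightarrow> x \<in> snd b ` fst b \<and> chart_inv b x \<in> ?U"
      using src.chart_nhd[OF b] by blast
    let ?V = "if p \<in> C then V else V \<inter> interior H"
    have "open ?V" "snd b p \<in> ?V" using V int[of p b] p(1) b by auto
    then obtain e where e: "e > 0" "cball (snd b p) e \<subseteq> ?V" using open_contains_cball by blast
    define c where "c = (b, a, snd b p, e / 3)"
    have c: "bx c = b" "ax c = a" "x0 c = snd b p" "3 * r c = e" "0 < r c"
      using e by (auto simp: c_def bx_def ax_def x0_def r_def)
    have L: "L c \<subseteq> ?U"
      unfolding L_def c using V(3) e(2) by (auto split: if_splits)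
    have "act c \<or> L c \<subseteq> G"
    proof (cases "p \<in> C")
      case False
      then have "cball (snd b p) e \<subseteq> H" using e(2) interior_subset[of H] by auto
      then have "act c" using L False unfolding act_def c by auto
      then show ?thesis by blast
    qed (use L in auto)
    moreover have "H \<inter> cball (x0 c) (3 * r c) \<subseteq> snd (bx c) ` fst (bx c)"
      unfolding c using V(3) e(2) by (auto split: if_splits)
    ultimately have "P c" using b a c L unfolding P_def by auto
    moreover have "p \<in> K c"
    proof -
      have "snd b p \<in> H \<inter> ball (x0 c) (r c)" using c(3,5) src.chart_in_H[OF b] by simp
      then show ?thesis unfolding K_def c(1) using src.chart_inv_chart[OF b] by force
    qed
    ultimately show ?thesis using L by blast
  qed
  have PKL: "openin (top_of_set N) (K c) \<and> K c \<subseteq> L c \<and> compact (L c) \<and> L c \<subseteq> N" if c: "P c" for c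
  proof -
    have b: "bx c \<in> B" and img: "H \<inter> cball (x0 c) (3 * r c) \<subseteq> snd (bx c) ` fst (bx c)" and rp: "0 < r c"
      using c by (auto simp: P_def)
    have sub: "ball (x0 c) (r c) \<subseteq> cball (x0 c) (3 * r c)" using rp by auto
    have "openin (top_of_set (fst (bx c))) (fst (bx c) \<inter> snd (bx c) -` ball (x0 c) (r c))"
      by (rule continuous_openin_preimage_gen[OF src.continuous_chart[OF b] open_ball])
    then have "openin (top_of_set N) (fst (bx c) \<inter> snd (bx c) -` ball (x0 c) (r c))"
      using src.open_dom[OF b] openin_trans by blast
    moreover have "fst (bx c) \<inter> snd (bx c) -` ball (x0 c) (r c) = K c"
    proof
      show "fst (bx c) \<inter> snd (bx c) -` ball (x0 c) (r c) \<subseteq> K c"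
      proof
        fix p assume p: "p \<in> fst (bx c) \<inter> snd (bx c) -` ball (x0 c) (r c)"
        then have "snd (bx c) p \<in> H \<inter> ball (x0 c) (r c)" using src.chart_in_H[OF b] by auto
        moreover have "p = chart_inv (bx c) (snd (bx c) p)" using p src.chart_inv_chart[OF b] by auto
        ultimately show "p \<in> K c" unfolding K_def by blast
      qed
      show "K c \<subseteq> fst (bx c) \<inter> snd (bx c) -` ball (x0 c) (r c)"
      proof
        fix p assume "p \<in> K c"
        then obtain x where x: "x \<in> H \<inter> ball (x0 c) (r c)" "p = chart_inv (bx c) x" by (auto simp: K_def)
        then have "x \<in> snd (bx c) ` fst (bx c)" using img sub by blast
        then show "p \<in> fst (bx c) \<inter> snd (bx c) -` ball (x0 c) (r c)"
          using x src.chart_chart_inv[OF b] src.chart_inv_in[OF b] by auto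
      qed
    qed
    moreover have "K c \<subseteq> L c" unfolding K_def L_def using sub by blast
    moreover have "compact (L c)"
      unfolding L_def using H
      by (intro compact_continuous_image continuous_on_subset[OF src.continuous_chart_inv[OF b] img]) (auto intro: closed_Int_compact)
    moreover have "L c \<subseteq> N"
      unfolding L_def using img src.chart_inv_in[OF b] src.dom_subset[OF b] by blast
    ultimately show ?thesis by simp
  qed
  obtain \<C> where \<C>: "countable \<C>" "\<And>c. c \<in> \<C> \<Longrightarrow> P c" "\<And>p. p \<in> N \<Longrightarrow> \<exists>c\<in>\<C>. p \<in> K c"
    "\<And>p. p \<in> N \<Longrightarrow> \<exists>T. openin (top_of_set N) T \<and> p \<in> T \<and> finite {c \<in> \<C>. L c \<inter> T \<noteq> {}}"
    using locally_finite_refinement[of N P K L, OF basis PKL] by blast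
  define idx where "idx = to_nat_on \<C>"
  have idx: "c = d" if "c \<in> \<C>" "d \<in> \<C>" "idx c = idx d" for c d
    using that inj_on_to_nat_on[OF \<C>(1)] by (auto simp: idx_def inj_on_def)
  define Inv where "Inv f \<longleftrightarrow> cmap f \<and> (\<forall>c\<in>\<C>. f ` L c \<subseteq> fst (ax c))" for f
  \<comment> \<open>At most one box has index \<open>n\<close>. If there is none, or it is not
    active, all clauses allow the map to stay as it is.\<close>
  define stp where "stp n f f' \<longleftrightarrow>
      (\<forall>p\<in>N. (\<forall>c\<in>\<C>. idx c = n \<longrightarrow> act c \<longrightarrow> p \<notin> L c) \<longrightarrow> f' p = f p) \<and>
      (\<forall>c\<in>\<C>. idx c = n \<longrightarrow> act c \<longrightarrow> (\<forall>p\<in>K c. good f' p)) \<and> (\<forall>p\<in>N. good f p \<longrightarrow> good f' p)" for n f f'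
  have step: "\<exists>f'. Inv f' \<and> stp n f f'" if f: "Inv f" for n f
  proof (cases "\<exists>c\<in>\<C>. idx c = n \<and> act c")
    case False
    then show ?thesis using f by (intro exI[of _ f]) (auto simp: stp_def)
  next
    case True
    then obtain c where c: "c \<in> \<C>" "idx c = n" "act c" by blast
    have Pc: "P c" using \<C>(2) c(1) .
    have cb: "H \<inter> cball (x0 c) (3 * r c) = cball (x0 c) (3 * r c)" using c(3) by (auto simp: act_def)
    have Lc: "L c = chart_inv (bx c) ` cball (x0 c) (3 * r c)" unfolding L_def cb ..
    have sub: "ball (x0 c) (r c) \<subseteq> cball (x0 c) (3 * r c)" "cball (x0 c) (2 * r c) \<subseteq> cball (x0 c) (3 * r c)"
      using Pc by (auto simp: P_def)
    have "H \<inter> ball (x0 c) (r c) = ball (x0 c) (r c)" using cb sub(1) by blast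
    then have Kc: "K c = chart_inv (bx c) ` ball (x0 c) (r c)" unfolding K_def by simp
    \<comment> \<open>The map changes only on \<open>L c\<close>, so only boxes meeting
      \<open>L c\<close> can be disturbed; local finiteness leaves finitely many.\<close>
    let ?\<K> = "(\<lambda>d. (L d, fst (ax d))) ` {d \<in> \<C>. L d \<inter> L c \<noteq> {}}"
    have fin: "finite ?\<K>"
      using finite_meeting_compact[of "L c" N \<C> L] PKL[OF Pc] \<C>(4) by auto
    have FL: "f (chart_inv (bx c) x) \<in> fst (ax c)" if "x \<in> cball (x0 c) (3 * r c)" for x
    proof -
      have "f ` L c \<subseteq> fst (ax c)" using f c(1) by (simp add: Inv_def)
      then show ?thesis using that unfolding Lc by blast
    qed
    have \<K>': "compact K' \<and> K' \<subseteq> N \<and> openin (top_of_set X) U \<and> f ` K' \<subseteq> U" if KU: "(K', U) \<in> ?\<K>" for K' U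
    proof -
      obtain d where d: "d \<in> \<C>" "K' = L d" "U = fst (ax d)" using KU by blast
      have "P d" using \<C>(2) d(1) .
      then show ?thesis using PKL[of d] f d tgt.open_dom unfolding Inv_def P_def by simp
    qed
    have Pcs: "bx c \<in> B" "ax c \<in> A" "0 < r c" "cball (x0 c) (3 * r c) \<subseteq> snd (bx c) ` fst (bx c)"
      using Pc cb by (auto simp: P_def)
    have cmf: "cmap f" using f by (simp add: Inv_def)
    obtain f' where f': "cmap f'"
      "\<And>p. p \<in> N \<Longrightarrow> p \<notin> chart_inv (bx c) ` cball (x0 c) (2 * r c) \<Longrightarrow> f' p = f p"
      "\<And>p. p \<in> N \<Longrightarrow> good f p \<Longrightarrow> good f' p"
      "\<And>x. x \<in> ball (x0 c) (r c) \<Longrightarrow> good f' (chart_inv (bx c) x)"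
      "\<And>K U. (K, U) \<in> ?\<K> \<Longrightarrow> f' ` K \<subseteq> U"
      using box_step[OF cmf Z Pcs FL fin \<K>'] by blast
    have off: "f' p = f p" if "p \<in> N" "p \<notin> L c" for p
      using f'(2)[OF that(1)] that(2) sub(2) unfolding Lc by blast
    have "f' ` L d \<subseteq> fst (ax d)" if d: "d \<in> \<C>" for d
    proof (cases "L d \<inter> L c = {}")
      case True
      then have "f' p = f p" if "p \<in> L d" for p
        using off that PKL[OF \<C>(2)[OF d]] by blast
      then show ?thesis using f d unfolding Inv_def by force
    next
      case False
      then show ?thesis using f'(5) d by blast
    qed
    then have "Inv f'" using f'(1) by (simp add: Inv_def)
    moreover have "stp n f f'"
      unfolding stp_def
    proof (intro conjI ballI impI)
      show "f' p = f p" if "p \<in> N" "\<forall>c\<in>\<C>. idx c = n \<longrightarrow> act c \<longrightarrow> p \<notin> L c" for p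
        using off[OF that(1)] that(2) c by blast
      show "good f' p" if d: "d \<in> \<C>" "idx d = n" "p \<in> K d" for d p
      proof -
        have "d = c" using idx[OF d(1) c(1)] d(2) c(2) by simp
        then have "p \<in> chart_inv (bx c) ` ball (x0 c) (r c)" using d(3) Kc by simp
        then obtain x where "x \<in> ball (x0 c) (r c)" "p = chart_inv (bx c) x" by blast
        then show ?thesis using f'(4) by simp
      qed
      show "good f' p" if "p \<in> N" "good f p" for p using f'(3)[OF that] .
    qed
    ultimately show ?thesis by blast
  qed
  have "\<exists>g. \<forall>n. (Inv (g n) \<and> (n = 0 \<longrightarrow> g n = F)) \<and> stp n (g n) (g (Suc n))"
  proof (rule dependent_nat_choice)
    show "\<exists>x. Inv x \<and> ((0::nat) = 0 \<longrightarrow> x = F)"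
      using F \<C>(2) by (auto simp: Inv_def P_def)
    show "\<exists>y. (Inv y \<and> (Suc n = 0 \<longrightarrow> y = F)) \<and> stp n x y" if "Inv x \<and> (n = 0 \<longrightarrow> x = F)" for x n
      using step that by simp
  qed
  then obtain g where g: "\<And>n. Inv (g n)" "g 0 = F" "\<And>n. stp n (g n) (g (Suc n))" by blast
  have good_mono: "good (g m) p \<Longrightarrow> good (g n) p" if "p \<in> N" "m \<le> n" for m n p
    using that(2) by (induction n rule: dec_induct) (use g(3) that(1) in \<open>auto simp: stp_def\<close>)
  have stable: "\<exists>T J. openin (top_of_set N) T \<and> p \<in> T \<and> (\<forall>q\<in>T. \<forall>n\<ge>J. g n q = g J q)" if p: "p \<in> N" for p
  proof -
    obtain T where T: "openin (top_of_set N) T" "p \<in> T" "finite {c \<in> \<C>. L c \<inter> T \<noteq> {}}"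
      using \<C>(4)[OF p] by blast
    obtain J where J: "\<And>c. c \<in> \<C> \<Longrightarrow> L c \<inter> T \<noteq> {} \<Longrightarrow> idx c < J"
    proof -
      have "finite (idx ` {c \<in> \<C>. L c \<inter> T \<noteq> {}})" using T(3) by simp
      then obtain J where "\<forall>i \<in> idx ` {c \<in> \<C>. L c \<inter> T \<noteq> {}}. i < J"
        using finite_nat_set_iff_bounded by blast
      then show ?thesis using that by blast
    qed
    have "g n q = g J q" if q: "q \<in> T" and n: "n \<ge> J" for q n
      using n
    proof (induction n rule: dec_induct)
      case (step n)
      have "q \<in> N" using q openin_imp_subset[OF T(1)] by blast
      moreover have "q \<notin> L c" if "c \<in> \<C>" "idx c = n" for c
        using J[OF that(1)] that(2) step(1) q by auto
      ultimately have "g (Suc n) q = g n q" using g(3)[of n] unfolding stp_def by blast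
      then show ?case using step by simp
    qed simp
    then show ?thesis using T by blast
  qed
  \<comment> \<open>The eventual value at \<open>p\<close>. The index picked by \<open>SOME\<close>
    depends on \<open>p\<close> and may differ from a locally valid \<open>J\<close>;
    \<open>F'_eq\<close> compares the two at their maximum.\<close>
  define F' where "F' p = g (SOME j. \<forall>n\<ge>j. g n p = g j p) p" for p
  have F'_eq: "F' q = g n q" if "\<forall>n\<ge>J. g n q = g J q" "n \<ge> J" for q n J
  proof -
    define j where "j = (SOME j. \<forall>n\<ge>j. g n q = g j q)"
    have "\<forall>n\<ge>j. g n q = g j q" unfolding j_def by (rule someI[of _ J]) (rule that(1))
    then have "g (max j J) q = g j q" using max.cobounded1 by blast
    then have "g j q = g (max j J) q" by (rule sym)
    also have "\<dots> = g J q" using that(1) max.cobounded2 by blast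
    also have "\<dots> = g n q" using that by metis
    finally show ?thesis by (simp add: F'_def j_def)
  qed
  have cg: "continuous_on N (g n)" "g n ` N \<subseteq> X" for n using g(1)[of n] by (auto simp: Inv_def cmap_def)
  have local: "\<exists>T J. openin (top_of_set N) T \<and> p \<in> T \<and> (\<forall>q\<in>T. \<forall>n\<ge>J. F' q = g n q)" if p: "p \<in> N" for p
  proof -
    obtain T J where T: "openin (top_of_set N) T" "p \<in> T" "\<forall>q\<in>T. \<forall>n\<ge>J. g n q = g J q"
      using stable[OF p] by blast
    then have "\<forall>q\<in>T. \<forall>n\<ge>J. F' q = g n q" using F'_eq by blast
    then show ?thesis using T by blast
  qed
  have "continuous_on N F'"
    unfolding continuous_on_eq_continuous_within
  proof
    fix p assume p: "p \<in> N"
    obtain T J where T: "openin (top_of_set N) T" "p \<in> T" "\<forall>q\<in>T. \<forall>n\<ge>J. F' q = g n q"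
      using local[OF p] by blast
    have "continuous (at p within N) (g J)" using cg(1) p by (simp add: continuous_on_eq_continuous_within)
    moreover have "g J q = F' q" if "q \<in> T" for q using T(3) that by (metis order_refl)
    ultimately show "continuous (at p within N) F'"
      using continuous_transform_within_openin[OF _ T(1,2)] by blast
  qed
  moreover have "F' ` N \<subseteq> X"
    using local cg(2) by (metis image_subset_iff order_refl)
  ultimately have cF': "cmap F'" by (simp add: cmap_def)
  have F'C: "F' p = F p" if p: "p \<in> C" for p
  proof -
    have "g n p = F p" for n
    proof (induction n)
      case (Suc n)
      have "p \<notin> L c" if "act c" for c using that p by (auto simp: act_def)
      then have "g (Suc n) p = g n p" using g(3)[of n] p CN unfolding stp_def by blast
      then show ?case using Suc by simp
    qed (simp add: g(2))
    then show ?thesis using F'_eq[of 0 p 0] by simp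
  qed
  have "good F' p" if p: "p \<in> N" for p
  proof -
    obtain T J where T: "openin (top_of_set N) T" "p \<in> T" "\<forall>q\<in>T. \<forall>n\<ge>J. F' q = g n q"
      using local[OF p] by blast
    obtain c where c: "c \<in> \<C>" "p \<in> K c" using \<C>(3)[OF p] by blast
    have "\<exists>m. good (g m) p"
    proof (cases "act c")
      case True
      then have "good (g (Suc (idx c))) p" using g(3)[of "idx c"] c unfolding stp_def by blast
      then show ?thesis by blast
    next
      case False
      then have "p \<in> G" using \<C>(2)[OF c(1)] PKL[OF \<C>(2)[OF c(1)]] c(2) unfolding P_def by blast
      then have "good (g 0) p" using G(3) g(2) by simp
      then show ?thesis by blast
    qed
    then obtain m where "good (g m) p" by blast
    \<comment> \<open>From stage \<open>m\<close> on the point stays good, and from stage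
      \<open>J\<close> on the map has the germ of the limit.\<close>
    then have "good (g (max m J)) p" using good_mono[OF p max.cobounded1] by blast
    moreover have "g (max m J) q = F' q" if "q \<in> T" for q using T(3) that by (metis max.cobounded2)
    ultimately show ?thesis using good_cong[OF _ T(1,2)] by blast
  qed
  then show ?thesis using that[OF cF'] F'C by blast
qed

end

section \<open>Tangent spaces\<close>

lemma hyperplane_decomposition:
  fixes S :: "'e::euclidean_space set"
  assumes "subspace S" "dim S + 1 = DIM('e)" "\<eta> \<notin> S"
  obtains k s where "s \<in> S" "y = k *\<^sub>R \<eta> + s"
proof -
  have sp: "span S = S" using assms(1) by (simp add: span_eq_iff)
  have "\<eta> \<notin> span S" unfolding sp using assms(3) .
  then have "dim (insert \<eta> S) = DIM('e)" using assms(2) by (simp add: dim_insert)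
  then have "y \<in> span (insert \<eta> S)" using dim_eq_full by blast
  then obtain k where "y - k *\<^sub>R \<eta> \<in> S" unfolding span_breakdown_eq sp by blast
  then show ?thesis using that[of "y - k *\<^sub>R \<eta>" k] by simp
qed

text \<open>\<open>local_deriv\<close> is taken within a domain that changes with the charts. As
  this domain is relatively open in \<open>H\<close>, the derivative chosen within it is a
  derivative within \<open>H\<close>.\<close>

lemma frechet_derivative_openin:
  assumes "openin (top_of_set H) D" "x \<in> D" "(f has_derivative f') (at x within H)"
  shows "(f has_derivative frechet_derivative f (at x within D)) (at x within H)"
proof -
  obtain V where V: "open V" "D = H \<inter> V" using assms(1) openin_open by blast
  have "at x within D = at x within H"
    by (rule at_within_nhd[of x V]) (use V assms(2) in auto)
  then show ?thesis
    using assms(3) frechet_derivative_works unfolding differentiable_def by metis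
qed

context charts
begin

lemma transition_deriv:
  assumes "b \<in> B" "c \<in> B" "p \<in> fst b" "p \<in> fst c"
  shows "(local_rep b c (\<lambda>x. x) has_derivative local_deriv b c (\<lambda>x. x) p) (at (snd b p) within H)"
proof -
  obtain D where "(local_rep b c (\<lambda>x. x) has_derivative D) (at (snd b p) within H)"
    using smooth_within_has_derivative[OF transition_smooth[OF assms] chart_in_H[OF assms(1,3)]] .
  moreover have "openin (top_of_set H) (local_dom b c (\<lambda>x. x))"
    using open_img_Int[OF assms(1) open_dom[OF assms(2)]] by (simp add: local_dom_def vimage_def)
  moreover have "snd b p \<in> local_dom b c (\<lambda>x. x)" using assms by (auto simp: local_dom_def)
  ultimately show ?thesis unfolding local_deriv_def by (metis frechet_derivative_openin)
qed

lemma transition_cocycle: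
  assumes "b \<in> B" "c \<in> B" "d \<in> B" "p \<in> fst b" "p \<in> fst c" "p \<in> fst d"
  shows "local_deriv b d (\<lambda>x. x) p v = local_deriv c d (\<lambda>x. x) p (local_deriv b c (\<lambda>x. x) p v)"
proof -
  obtain V where V: "open V" "snd b p \<in> V"
    "\<And>x. x \<in> H \<Longrightarrow> x \<in> V \<Longrightarrow> x \<in> snd b ` fst b \<and> chart_inv b x \<in> fst c"
    using chart_nhd[OF assms(1,4) open_dom[OF assms(2)] assms(5)] by blast
  have "(local_rep b d (\<lambda>x. x) has_derivative
      (\<lambda>v. local_deriv c d (\<lambda>x. x) p (local_deriv b c (\<lambda>x. x) p v))) (at (snd b p) within H)"
  proof (rule has_derivative_compose_local[where g = "local_rep c d (\<lambda>x. x)" and T = H, OF transition_deriv[OF assms(1,2,4,5)] _ chart_in_H[OF assms(1,4)] V(1,2)])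
    have "local_rep b c (\<lambda>x. x) (snd b p) = snd c p" using assms by (simp add: local_rep_def)
    then show "(local_rep c d (\<lambda>x. x) has_derivative local_deriv c d (\<lambda>x. x) p) (at (local_rep b c (\<lambda>x. x) (snd b p)) within H)"
      using transition_deriv[OF assms(2,3,5,6)] by simp
    show "local_rep b c (\<lambda>x. x) y \<in> H \<and> local_rep b d (\<lambda>x. x) y = local_rep c d (\<lambda>x. x) (local_rep b c (\<lambda>x. x) y)"
      if "y \<in> H" "y \<in> V" for y
      using V(3)[OF that] assms(1,2) by (simp add: local_rep_def chart_in_H)
  qed
  then have "local_deriv b d (\<lambda>x. x) p = (\<lambda>v. local_deriv c d (\<lambda>x. x) p (local_deriv b c (\<lambda>x. x) p v))"
    using derivative_unique[OF chart_in_H[OF assms(1,4)] transition_deriv[OF assms(1,3,4,6)]] by blast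
  then show ?thesis by (rule fun_cong)
qed

lemma transition_self:
  assumes "b \<in> B" "p \<in> fst b"
  shows "local_deriv b b (\<lambda>x. x) p v = v"
proof -
  obtain V where V: "open V" "snd b p \<in> V"
    "\<And>x. x \<in> H \<Longrightarrow> x \<in> V \<Longrightarrow> x \<in> snd b ` fst b \<and> chart_inv b x \<in> fst b"
    using chart_nhd[OF assms open_dom[OF assms(1)] assms(2)] by blast
  have "(local_rep b b (\<lambda>x. x) has_derivative (\<lambda>v. v)) (at (snd b p) within H)"
    by (rule has_derivative_cong_local[OF has_derivative_ident chart_in_H[OF assms] V(1,2)])
      (use V(3) assms(1) in \<open>simp add: local_rep_def\<close>)
  then have "local_deriv b b (\<lambda>x. x) p = (\<lambda>v. v)"
    using derivative_unique[OF chart_in_H[OF assms] transition_deriv[OF assms(1,1,2,2)]] by blast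
  then show ?thesis by (rule fun_cong)
qed

lemma linear_transition:
  "b \<in> B \<Longrightarrow> c \<in> B \<Longrightarrow> p \<in> fst b \<Longrightarrow> p \<in> fst c \<Longrightarrow> linear (local_deriv b c (\<lambda>x. x) p)"
  using transition_deriv has_derivative_linear by blast

lemma tangent_spaceI:
  assumes "\<And>c. \<not> (c \<in> B \<and> p \<in> fst c) \<Longrightarrow> v c = 0"
    and "\<And>c d. c \<in> B \<Longrightarrow> d \<in> B \<Longrightarrow> p \<in> fst c \<Longrightarrow> p \<in> fst d \<Longrightarrow> v d = local_deriv c d (\<lambda>x. x) p (v c)"
  shows "v \<in> tangent_space B p"
  unfolding tangent_space_def mem_Collect_eq using assms by blast

lemma tangent_spaceD:
  assumes "v \<in> tangent_space B p"
  shows "\<not> (c \<in> B \<and> p \<in> fst c) \<Longrightarrow> v c = 0"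
    and "c \<in> B \<Longrightarrow> d \<in> B \<Longrightarrow> p \<in> fst c \<Longrightarrow> p \<in> fst d \<Longrightarrow> v d = local_deriv c d (\<lambda>x. x) p (v c)"
proof -
  have zero: "\<forall>c. \<not> (c \<in> B \<and> p \<in> fst c) \<longrightarrow> v c = 0"
    using assms unfolding tangent_space_def mem_Collect_eq by (rule conjunct1)
  show "v c = 0" if "\<not> (c \<in> B \<and> p \<in> fst c)"
    by (rule mp[OF spec[OF zero] that])
  have all: "\<forall>c\<in>B. \<forall>d\<in>B. p \<in> fst c \<and> p \<in> fst d \<longrightarrow> v d = local_deriv c d (\<lambda>x. x) p (v c)"
    using assms unfolding tangent_space_def mem_Collect_eq by (rule conjunct2)
  show "v d = local_deriv c d (\<lambda>x. x) p (v c)" if "c \<in> B" "d \<in> B" "p \<in> fst c" "p \<in> fst d"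
    by (rule mp[OF bspec[OF bspec[OF all that(1)] that(2)] conjI[OF that(3,4)]])
qed

lemma tangent_space_add:
  assumes "v \<in> tangent_space B p" "w \<in> tangent_space B p"
  shows "(\<lambda>c. v c + w c) \<in> tangent_space B p"
proof (rule tangent_spaceI)
  show "v c + w c = 0" if "\<not> (c \<in> B \<and> p \<in> fst c)" for c
    using tangent_spaceD(1)[OF assms(1) that] tangent_spaceD(1)[OF assms(2) that] by simp
  show "v d + w d = local_deriv c d (\<lambda>x. x) p (v c + w c)"
    if cd: "c \<in> B" "d \<in> B" "p \<in> fst c" "p \<in> fst d" for c d
    by (simp only: linear_add[OF linear_transition[OF cd]]
        tangent_spaceD(2)[OF assms(1) cd, symmetric] tangent_spaceD(2)[OF assms(2) cd, symmetric])
qed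

lemma tangent_space_diff:
  assumes "v \<in> tangent_space B p" "w \<in> tangent_space B p"
  shows "(\<lambda>c. v c - w c) \<in> tangent_space B p"
proof (rule tangent_spaceI)
  show "v c - w c = 0" if "\<not> (c \<in> B \<and> p \<in> fst c)" for c
    using tangent_spaceD(1)[OF assms(1) that] tangent_spaceD(1)[OF assms(2) that] by simp
  show "v d - w d = local_deriv c d (\<lambda>x. x) p (v c - w c)"
    if cd: "c \<in> B" "d \<in> B" "p \<in> fst c" "p \<in> fst d" for c d
    by (simp only: linear_diff[OF linear_transition[OF cd]]
        tangent_spaceD(2)[OF assms(1) cd, symmetric] tangent_spaceD(2)[OF assms(2) cd, symmetric])
qed

text \<open>Transport \<open>v\<close> from \<open>b\<close> to all other charts by the coordinate
  changes; the cocycle rule is the compatibility demanded of a tangent vector.\<close>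

lemma tangent_vector_exists:
  assumes "b \<in> B" "p \<in> fst b"
  obtains u where "u \<in> tangent_space B p" "u b = v"
proof -
  define u where "u c = (if c \<in> B \<and> p \<in> fst c then local_deriv b c (\<lambda>x. x) p v else 0)" for c
  have "u \<in> tangent_space B p"
  proof (rule tangent_spaceI)
    show "u c = 0" if "\<not> (c \<in> B \<and> p \<in> fst c)" for c
      unfolding u_def by (rule if_not_P[OF that])
    show "u d = local_deriv c d (\<lambda>x. x) p (u c)" if "c \<in> B" "d \<in> B" "p \<in> fst c" "p \<in> fst d" for c d
      using transition_cocycle[OF assms(1) that(1,2) assms(2) that(3,4)] that by (simp add: u_def)
  qed
  moreover have "u b = v" using assms transition_self by (simp add: u_def)
  ultimately show ?thesis by (rule that)
qed

end

section \<open>Differentials, and transversality in terms of tangent spaces\<close>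

context chart_maps
begin

lemma rep_deriv:
  assumes "cmap F" "smooth_pt F p" "b \<in> B" "p \<in> fst b" "a \<in> A" "F p \<in> fst a"
  shows "(local_rep b a F has_derivative local_deriv b a F p) (at (snd b p) within H)"
proof -
  obtain D where D: "(local_rep b a F has_derivative D) (at (snd b p) within H)"
    using smooth_within_has_derivative[OF smooth_pt_rep[OF assms] src.chart_in_H[OF assms(3,4)]] .
  have "fst b \<inter> (N \<inter> F -` fst a) = fst b \<inter> F -` fst a" using src.dom_subset[OF assms(3)] by auto
  then have "openin (top_of_set H) (local_dom b a F)"
    using src.open_img_Int[OF assms(3) preimage_open[OF assms(1) tgt.open_dom[OF assms(5)]]]
    by (simp add: local_dom_def)
  moreover have "snd b p \<in> local_dom b a F" using assms by (auto simp: local_dom_def)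
  ultimately show ?thesis unfolding local_deriv_def using D by (rule frechet_derivative_openin)
qed

lemma rep_chain:
  assumes "cmap F" "smooth_pt F p" "b \<in> B" "p \<in> fst b" "a \<in> A" "F p \<in> fst a" "a' \<in> A" "F p \<in> fst a'"
  shows "local_deriv b a' F p v = local_deriv a a' (\<lambda>x. x) (F p) (local_deriv b a F p v)"
proof -
  obtain V where V: "open V" "snd b p \<in> V"
    "\<And>x. x \<in> H \<Longrightarrow> x \<in> V \<Longrightarrow> x \<in> snd b ` fst b \<and> F (chart_inv b x) \<in> fst a"
    using rep_nhd[OF assms(1,3,4) tgt.open_dom[OF assms(5)] assms(6)] by blast
  have "(local_rep b a' F has_derivative
      (\<lambda>v. local_deriv a a' (\<lambda>x. x) (F p) (local_deriv b a F p v))) (at (snd b p) within H)"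
  proof (rule has_derivative_compose_local[where g = "local_rep a a' (\<lambda>x. x)" and T = UNIV, OF rep_deriv[OF assms(1-6)] _ src.chart_in_H[OF assms(3,4)] V(1,2)])
    show "(local_rep a a' (\<lambda>x. x) has_derivative local_deriv a a' (\<lambda>x. x) (F p)) (at (local_rep b a F (snd b p)))"
      unfolding local_rep_at[OF assms(3,4)] by (rule tgt.transition_deriv[OF assms(5,7,6,8)])
    show "local_rep b a F y \<in> UNIV \<and> local_rep b a' F y = local_rep a a' (\<lambda>x. x) (local_rep b a F y)"
      if "y \<in> H" "y \<in> V" for y
      using V(3)[OF that] assms(5) by (simp add: local_rep_def)
  qed
  then have "local_deriv b a' F p = (\<lambda>v. local_deriv a a' (\<lambda>x. x) (F p) (local_deriv b a F p v))"
    using src.derivative_unique[OF src.chart_in_H[OF assms(3,4)] rep_deriv[OF assms(1-4,7,8)]] by blast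
  then show ?thesis by (rule fun_cong)
qed

text \<open>In codimension 1 a single vector outside the hyperplane \<open>S\<close> spans the whole
  space together with \<open>S\<close>.\<close>

lemma good_imp_transversal:
  assumes F: "cmap F" and good: "\<And>p. p \<in> N \<Longrightarrow> good F p"
  shows "transversal N B X A F Z"
proof -
  have sp: "smooth_pt F p" if "p \<in> N" for p using good[OF that] by (simp add: good_def)
  have "smooth_on (local_dom b a F) (local_rep b a F)" if ba: "b \<in> B" "a \<in> A" for b a
    unfolding smooth_on_iff
  proof
    fix x assume "x \<in> local_dom b a F"
    then obtain p where p: "p \<in> fst b" "F p \<in> fst a" "x = snd b p" by (auto simp: local_dom_def)
    have "p \<in> N" using src.dom_subset[OF ba(1)] p(1) by blast
    then have "smooth_within H (local_rep b a F) x"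
      using smooth_pt_rep[OF F sp ba(1) p(1) ba(2) p(2)] p(3) by simp
    then show "smooth_within (local_dom b a F) (local_rep b a F) x"
      by (rule smooth_within_transfer[OF _ open_UNIV UNIV_I])
        (use src.chart_in_H[OF ba(1)] in \<open>auto simp: local_dom_def\<close>)
  qed
  then have "smooth_map N B X A F" using F by (auto simp: smooth_map_def cmap_def)
  moreover have "{\<lambda>c. v c + w c | v w. v \<in> differential B A F p ` tangent_space B p \<and>
      w \<in> submanifold_tangent_space A Z (F p)} = tangent_space A (F p)" (is "?L = ?R")
    if p: "p \<in> N" "F p \<in> Z" for p
  proof -
    \<comment> \<open>The very chart that \<open>differential\<close> picks;
      \<open>transv_change\<close> moves the transversality statement into it.\<close>
    define b where "b = (SOME b. b \<in> B \<and> p \<in> fst b)"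
    have "\<exists>b. b \<in> B \<and> p \<in> fst b" using src.cover p(1) by blast
    then have bb: "b \<in> B \<and> p \<in> fst b" unfolding b_def by (rule someI_ex)
    note b = conjunct1[OF bb] conjunct2[OF bb]
    obtain c S where "transv_at F p b c S"
      using good[OF p(1)] p(2) transv_change[OF F sp[OF p(1)] _ b] unfolding good_def by blast
    then obtain D \<xi> where c: "slice_chart A Z S c" "F p \<in> fst c" "dim S + 1 = DIM('e)"
      and D: "(local_rep b c F has_derivative D) (at (snd b p) within H)" "D \<xi> \<notin> S"
      unfolding transv_at_def by blast
    have cA: "c \<in> A" and subS: "subspace S" using c(1) by (auto simp: slice_chart_def)
    have De: "D = local_deriv b c F p"
      using src.derivative_unique[OF src.chart_in_H[OF b] D(1) rep_deriv[OF F sp[OF p(1)] b cA c(2)]] .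
    have dF: "differential B A F p u = (\<lambda>a. if a \<in> A \<and> F p \<in> fst a then local_deriv b a F p (u b) else 0)" for u
      unfolding differential_def Let_def b_def[symmetric] by (rule refl)
    have dF_tan: "differential B A F p u \<in> tangent_space A (F p)" for u
    proof (rule tgt.tangent_spaceI)
      show "differential B A F p u a = 0" if "\<not> (a \<in> A \<and> F p \<in> fst a)" for a
        unfolding dF by (rule if_not_P[OF that])
      show "differential B A F p u a' = local_deriv a a' (\<lambda>x. x) (F p) (differential B A F p u a)"
        if "a \<in> A" "a' \<in> A" "F p \<in> fst a" "F p \<in> fst a'" for a a'
        using rep_chain[OF F sp[OF p(1)] b that(1,3,2,4)] that by (simp add: dF)
    qed
    show ?thesis
    proof
      show "?L \<subseteq> ?R"
        using tgt.tangent_space_add[OF dF_tan] by (auto simp: submanifold_tangent_space_def)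
      show "?R \<subseteq> ?L"
      proof
        \<comment> \<open>In the coordinates of the slice chart \<open>c\<close>, subtracting the
          image of a suitable multiple of \<xi> leaves a vector of \<open>S\<close>, so the
          remainder is tangent to \<open>Z\<close>.\<close>
        fix \<omega> assume \<omega>: "\<omega> \<in> tangent_space A (F p)"
        obtain k s where s: "s \<in> S" "\<omega> c = k *\<^sub>R D \<xi> + s"
          using hyperplane_decomposition[OF subS c(3) D(2)] by blast
        obtain u where u: "u \<in> tangent_space B p" "u b = k *\<^sub>R \<xi>"
          using src.tangent_vector_exists[OF b] by blast
        let ?v = "differential B A F p u"
        have "linear D" using D(1) has_derivative_linear by blast
        then have "?v c = k *\<^sub>R D \<xi>"
          using cA c(2) u(2) unfolding dF De by (simp add: linear_scale)
        then have "\<omega> c - ?v c \<in> S" using s by simp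
        then have "(\<lambda>a. \<omega> a - ?v a) \<in> submanifold_tangent_space A Z (F p)"
          unfolding submanifold_tangent_space_def
          using tgt.tangent_space_diff[OF \<omega> dF_tan] c(1,2) by blast
        moreover have "\<omega> = (\<lambda>a. ?v a + (\<omega> a - ?v a))" by simp
        ultimately show "\<omega> \<in> ?L"
          using u(1) by (intro CollectI exI[of _ ?v] exI[of _ "\<lambda>a. \<omega> a - ?v a"] conjI imageI)
      qed
    qed
  qed
  ultimately show ?thesis unfolding transversal_def by blast
qed

end

section \<open>Cylinders and spaces of paths\<close>

lemma smooth_manifold_charts:
  assumes "smooth_manifold X (A :: ('a::{t2_space,second_countable_topology}, 'e::euclidean_space) chart set)"
  shows "charts X A UNIV"
proof
  have A: "c \<in> A \<Longrightarrow> is_chart X c" "X = (\<Union>c\<in>A. fst c)" "c \<in> A \<Longrightarrow> d \<in> A \<Longrightarrow> compatible c d" for c d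
    using assms by (auto simp: smooth_manifold_def)
  show "X = (\<Union>c\<in>A. fst c)" by (rule A(2))
  fix b c assume "b \<in> A"
  then show "openin (top_of_set X) (fst b)" "openin (top_of_set UNIV) (snd b ` fst b)"
    "homeomorphism (fst b) (snd b ` fst b) (snd b) (chart_inv b)"
    using A(1) by (auto simp: is_chart_def)
  assume "c \<in> A"
  with \<open>b \<in> A\<close> show "smooth_on (local_dom b c (\<lambda>x. x)) (local_rep b c (\<lambda>x. x))"
    using A(3) by (simp add: compatible_def)
next
  show "\<exists>d. 0 < \<bar>d\<bar> \<and> \<bar>d\<bar> < e \<and> x + d *\<^sub>R i \<in> UNIV" if "0 < e" for e :: real and x i :: 'e
    by (rule exI[of _ "e / 2"]) (use that in simp)
qed

definition cyl :: "('a \<times> 'a) set \<Rightarrow> ('a, 'e) chart \<Rightarrow> ('a, 'e) chart \<Rightarrow> (('a \<times> 'a) \<times> real, ('e \<times> 'e) \<times> real) chart" where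
  "cyl U c d = ((fst c \<times> fst d \<inter> U) \<times> {0..1}, map_prod (map_prod (snd c) (snd d)) (\<lambda>t. t))"

lemma cylinder_atlas_eq:
  fixes A :: "('a, 'b) chart set"
  shows "cylinder_atlas U A = {cyl U c d | c d. c \<in> A \<and> d \<in> A}"
proof (intro equalityI subsetI)
  fix y assume "y \<in> cylinder_atlas U A"
  then obtain r i where r: "r \<in> restrict_atlas U (prod_atlas A A)" "i \<in> interval_atlas"
    "y = (fst r \<times> fst i, map_prod (snd r) (snd i))"
    unfolding cylinder_atlas_def prod_atlas_def[of _ interval_atlas] by blast
  obtain q where q: "q \<in> prod_atlas A A" "r = (fst q \<inter> U, snd q)"
    using r(1) unfolding restrict_atlas_def by blast
  obtain c d where cd: "c \<in> A" "d \<in> A" "q = (fst c \<times> fst d, map_prod (snd c) (snd d))"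
    using q(1) unfolding prod_atlas_def by blast
  have "y = cyl U c d" using r(2,3) q(2) cd(3) by (simp add: interval_atlas_def cyl_def)
  then show "y \<in> {cyl U c d | c d. c \<in> A \<and> d \<in> A}" using cd(1,2) by blast
next
  fix y assume "y \<in> {cyl U c d | c d. c \<in> A \<and> d \<in> A}"
  then obtain c d where cd: "c \<in> A" "d \<in> A" "y = cyl U c d" by blast
  let ?q = "(fst c \<times> fst d, map_prod (snd c) (snd d))"
  let ?r = "(fst ?q \<inter> U, snd ?q)" and ?i = "({0..1::real}, \<lambda>t::real. t)"
  have "?q \<in> prod_atlas A A" using cd(1,2) unfolding prod_atlas_def by blast
  then have "?r \<in> restrict_atlas U (prod_atlas A A)" unfolding restrict_atlas_def by blast
  moreover have "?i \<in> interval_atlas" by (simp add: interval_atlas_def)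
  ultimately have "(fst ?r \<times> fst ?i, map_prod (snd ?r) (snd ?i)) \<in> cylinder_atlas U A"
    unfolding cylinder_atlas_def prod_atlas_def[of _ interval_atlas] by blast
  then show "y \<in> cylinder_atlas U A" using cd(3) by (simp add: cyl_def)
qed

lemma thick_cylinder:
  fixes x i :: "('n::euclidean_space) \<times> real"
  assumes "x \<in> UNIV \<times> {0..1}" "i \<in> Basis" "e > 0"
  shows "\<exists>d. 0 < \<bar>d\<bar> \<and> \<bar>d\<bar> < e \<and> x + d *\<^sub>R i \<in> UNIV \<times> {0..1}"
proof -
  have "snd i = 0 \<or> snd i = 1" using assms(2) by (auto simp: Basis_prod_def)
  then show ?thesis
  proof
    assume "snd i = 0"
    then show ?thesis using assms by (intro exI[of _ "e / 2"]) (auto simp: mem_Times_iff)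
  next
    assume i: "snd i = 1"
    \<comment> \<open>Move towards the farther end of the interval, by at most 1/2, so as to stay
      inside.\<close>
    let ?d = "(if snd x \<le> 1 / 2 then 1 else - 1) * min (e / 2) (1 / 2)"
    show ?thesis
      using assms i by (intro exI[of _ ?d]) (auto simp: mem_Times_iff min_def)
  qed
qed

context charts
begin

lemma cyl_inv:
  assumes "c \<in> B" "d \<in> B" "p \<in> fst (cyl U c d)"
  shows "chart_inv (cyl U c d) (snd (cyl U c d) p) = p"
proof -
  have inj: "inj_on (snd c) (fst c)" if "c \<in> B" for c
    by (rule inj_on_inverseI[of _ "chart_inv c"]) (rule chart_inv_chart[OF that])
  have "inj_on (snd (cyl U c d)) (fst (cyl U c d))"
    using inj_onD[OF inj[OF assms(1)]] inj_onD[OF inj[OF assms(2)]]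
    unfolding cyl_def fst_conv snd_conv by (intro inj_onI) auto
  then show ?thesis using assms(3) by (simp add: chart_inv_def inv_into_f_f)
qed

lemma cyl_inv_eq:
  assumes "c \<in> B" "d \<in> B" "z \<in> snd (cyl U c d) ` fst (cyl U c d)"
  shows "chart_inv (cyl U c d) z = ((chart_inv c (fst (fst z)), chart_inv d (snd (fst z))), snd z)"
proof -
  obtain x y t where p: "((x, y), t) \<in> fst (cyl U c d)" "z = snd (cyl U c d) ((x, y), t)"
    using assms(3) by auto
  have "x \<in> fst c" "y \<in> fst d" using p(1) by (auto simp: cyl_def)
  moreover have "z = ((snd c x, snd d y), t)" using p(2) by (simp add: cyl_def)
  ultimately show ?thesis using cyl_inv[OF assms(1,2) p(1)] p(2) assms by simp
qed

lemma cyl_img: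
  assumes "c \<in> B" "d \<in> B"
  shows "snd (cyl U c d) ` fst (cyl U c d) =
    {z \<in> (snd c ` fst c) \<times> (snd d ` fst d). (chart_inv c (fst z), chart_inv d (snd z)) \<in> U} \<times> {0..1}"
    (is "?L = ?R")
proof
  show "?L \<subseteq> ?R" using assms by (auto simp: cyl_def)
  show "?R \<subseteq> ?L"
  proof
    fix z assume z: "z \<in> ?R"
    then obtain x y where xy: "x \<in> fst c" "y \<in> fst d" "fst z = (snd c x, snd d y)" by auto
    then have "((x, y), snd z) \<in> fst (cyl U c d)" using z assms by (auto simp: cyl_def)
    moreover have "z = snd (cyl U c d) ((x, y), snd z)" using xy(3) by (simp add: cyl_def prod_eq_iff)
    ultimately show "z \<in> ?L" by blast
  qed
qed

text \<open>Coordinate changes of the cylinder are products of two coordinate changes of the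
  manifold with the identity in \<open>t\<close>, so they extend smoothly across the ends 0 and
  1.\<close>

lemma cylinder_charts:
  assumes "H = UNIV" and U: "openin (top_of_set (N \<times> N)) U"
  shows "charts (U \<times> {0..1}) (cylinder_atlas U B) (UNIV \<times> {0..1})"
proof
  obtain W where W: "open W" "U = (N \<times> N) \<inter> W" using U openin_open by blast
  have B: "\<exists>c d. c \<in> B \<and> d \<in> B \<and> b = cyl U c d" if "b \<in> cylinder_atlas U B" for b
    using that by (auto simp: cylinder_atlas_eq)
  show "openin (top_of_set (U \<times> {0..1})) (fst b)" if bB: "b \<in> cylinder_atlas U B" for b
  proof -
    obtain c d where b: "c \<in> B" "d \<in> B" "b = cyl U c d" using B[OF bB] by blast
    have "openin (top_of_set (N \<times> N)) (fst c \<times> fst d)"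
      using open_dom[OF b(1)] open_dom[OF b(2)] by (rule openin_Times)
    then have "openin (top_of_set U) (fst c \<times> fst d \<inter> U)"
      using W(2) by (metis Int_commute openin_subset_trans U openin_Int openin_imp_subset inf_le1)
    then show ?thesis unfolding b(3) cyl_def fst_conv by (intro openin_Times openin_subtopology_self)
  qed
  show "openin (top_of_set (UNIV \<times> {0..1})) (snd b ` fst b)" if bB: "b \<in> cylinder_atlas U B" for b
  proof -
    obtain c d where b: "c \<in> B" "d \<in> B" "b = cyl U c d" using B[OF bB] by blast
    let ?I = "(snd c ` fst c) \<times> (snd d ` fst d)"
    let ?g = "\<lambda>z. (chart_inv c (fst z), chart_inv d (snd z))"
    have "open ?I" using open_img[OF b(1)] open_img[OF b(2)] assms(1) by (auto intro: open_Times)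
    moreover have "continuous_on ?I ?g"
      by (intro continuous_on_Pair continuous_on_compose2[OF continuous_chart_inv[OF b(1)]]
          continuous_on_compose2[OF continuous_chart_inv[OF b(2)]] continuous_on_fst continuous_on_snd continuous_on_id) auto
    ultimately have "open (?I \<inter> ?g -` W)" using W(1) by (intro continuous_open_preimage)
    moreover have "?I \<inter> ?g -` W = {z \<in> ?I. ?g z \<in> U}"
      using W(2) chart_inv_in[OF b(1)] chart_inv_in[OF b(2)] dom_subset[OF b(1)] dom_subset[OF b(2)] by auto
    ultimately have "open {z \<in> ?I. ?g z \<in> U}" by simp
    then have "openin (top_of_set UNIV) {z \<in> ?I. ?g z \<in> U}" by simp
    then show ?thesis
      unfolding b(3) cyl_img[OF b(1,2)] by (rule openin_Times[OF _ openin_subtopology_self])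
  qed
  show "homeomorphism (fst b) (snd b ` fst b) (snd b) (chart_inv b)" if bB: "b \<in> cylinder_atlas U B" for b
  proof -
    obtain c d where b: "c \<in> B" "d \<in> B" "b = cyl U c d" using B[OF bB] by blast
    have sb: "snd b = (\<lambda>p. ((snd c (fst (fst p)), snd d (snd (fst p))), snd p))"
      by (auto simp: b(3) cyl_def)
    have "continuous_on (fst b) (snd b)"
      unfolding sb
      by (intro continuous_on_Pair continuous_on_compose2[OF continuous_chart[OF b(1)]]
          continuous_on_compose2[OF continuous_chart[OF b(2)]] continuous_on_fst continuous_on_snd continuous_on_id)
        (auto simp: b(3) cyl_def)
    moreover have "continuous_on (snd b ` fst b) (\<lambda>z. ((chart_inv c (fst (fst z)), chart_inv d (snd (fst z))), snd z))"
      by (intro continuous_on_Pair continuous_on_compose2[OF continuous_chart_inv[OF b(1)]]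
          continuous_on_compose2[OF continuous_chart_inv[OF b(2)]] continuous_on_fst continuous_on_snd continuous_on_id)
        (auto simp: b(3) cyl_def)
    then have "continuous_on (snd b ` fst b) (chart_inv b)"
      by (rule continuous_on_eq) (use cyl_inv_eq[OF b(1,2)] b(3) in auto)
    ultimately show ?thesis
      by (rule homeomorphismI) (use cyl_inv[OF b(1,2)] b(3) in auto)
  qed
  show "U \<times> {0..1} = (\<Union>b\<in>cylinder_atlas U B. fst b)"
  proof
    show "U \<times> {0..1} \<subseteq> (\<Union>b\<in>cylinder_atlas U B. fst b)"
    proof
      fix p :: "('p \<times> 'p) \<times> real"
      assume p: "p \<in> U \<times> {0..1}"
      then have "fst (fst p) \<in> N" "snd (fst p) \<in> N" using W(2) by auto
      then obtain c d where "c \<in> B" "d \<in> B" "fst (fst p) \<in> fst c" "snd (fst p) \<in> fst d" using cover by blast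
      then have "cyl U c d \<in> cylinder_atlas U B" "p \<in> fst (cyl U c d)"
        using p unfolding cylinder_atlas_eq by (blast, auto simp: cyl_def mem_Times_iff)
      then show "p \<in> (\<Union>b\<in>cylinder_atlas U B. fst b)" by blast
    qed
    show "(\<Union>b\<in>cylinder_atlas U B. fst b) \<subseteq> U \<times> {0..1}"
      by (auto simp: cylinder_atlas_eq cyl_def)
  qed
  show "smooth_on (local_dom b b' (\<lambda>x. x)) (local_rep b b' (\<lambda>x. x))"
    if bB: "b \<in> cylinder_atlas U B" "b' \<in> cylinder_atlas U B" for b b'
    unfolding smooth_on_iff
  proof
    fix z assume z: "z \<in> local_dom b b' (\<lambda>x. x)"
    obtain c d where b: "c \<in> B" "d \<in> B" "b = cyl U c d" using B[OF bB(1)] by blast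
    obtain c' d' where b': "c' \<in> B" "d' \<in> B" "b' = cyl U c' d'" using B[OF bB(2)] by blast
    obtain p where p: "p \<in> fst b" "p \<in> fst b'" "z = snd b p" using z by (auto simp: local_dom_def)
    have p': "fst (fst p) \<in> fst c" "fst (fst p) \<in> fst c'" "snd (fst p) \<in> fst d" "snd (fst p) \<in> fst d'"
      "fst (fst z) = snd c (fst (fst p))" "snd (fst z) = snd d (snd (fst p))"
      using p by (auto simp: b(3) b'(3) cyl_def)
    let ?f = "local_rep c c' (\<lambda>x. x)" and ?g = "local_rep d d' (\<lambda>x. x)"
    have "smooth_within UNIV ?f (fst (fst z))" "smooth_within UNIV ?g (snd (fst z))"
      using transition_smooth[OF b(1) b'(1) p'(1,2)] transition_smooth[OF b(2) b'(2) p'(3,4)] p'(5,6) assms(1) by simp_all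
    moreover have lin: "bounded_linear (\<lambda>z::('d \<times> 'd) \<times> real. fst (fst z))"
      "bounded_linear (\<lambda>z::('d \<times> 'd) \<times> real. snd (fst z))"
      by (auto intro: bounded_linear_compose[OF bounded_linear_fst bounded_linear_fst]
          bounded_linear_compose[OF bounded_linear_snd bounded_linear_fst])
    ultimately have "smooth_within UNIV (\<lambda>z. ?f (fst (fst z))) z" "smooth_within UNIV (\<lambda>z. ?g (snd (fst z))) z"
      by (auto intro: smooth_within_compose[where T = UNIV and V = UNIV and g = ?f, OF smooth_within_bounded_linear[OF lin(1)]]
          smooth_within_compose[where T = UNIV and V = UNIV and g = ?g, OF smooth_within_bounded_linear[OF lin(2)]])
    then have "smooth_within UNIV (\<lambda>z. ((?f (fst (fst z)), ?g (snd (fst z))), snd z)) z"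
      by (intro smooth_within_Pair smooth_within_bounded_linear[OF bounded_linear_snd])
    then show "smooth_within (local_dom b b' (\<lambda>x. x)) (local_rep b b' (\<lambda>x. x)) z"
    proof (rule smooth_within_transfer[OF _ open_UNIV UNIV_I])
      fix y assume "y \<in> local_dom b b' (\<lambda>x. x)"
      then have "y \<in> snd (cyl U c d) ` fst (cyl U c d)" by (auto simp: local_dom_def b(3))
      from cyl_inv_eq[OF b(1,2) this]
      show "y \<in> UNIV \<and> ((?f (fst (fst y)), ?g (snd (fst y))), snd y) = local_rep b b' (\<lambda>x. x) y"
        by (simp add: local_rep_def b(3) b'(3) cyl_def)
    qed
  qed
  show "\<exists>d. 0 < \<bar>d\<bar> \<and> \<bar>d\<bar> < e \<and> x + d *\<^sub>R i \<in> UNIV \<times> {0..1}"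
    if "x \<in> UNIV \<times> {0..1}" "i \<in> Basis" "0 < e" for x i :: "('d \<times> 'd) \<times> real" and e
    using thick_cylinder[OF that] .
qed

end

text \<open>One half of the exponential law. A path lying in \<open>V\<close> at time
  \<open>t\<close> stays there on a compact neighbourhood of \<open>t\<close>; this is an open
  condition in the compact-open topology, so the paths of nearby parameters satisfy it too.\<close>

lemma section_continuous_on:
  fixes X :: "'x::topological_space set" and U :: "'u::topological_space set"
  assumes s: "continuous_map (top_of_set U) (path_space (top_of_set X)) s"
  shows "continuous_on (U \<times> {0..1}) (\<lambda>(u, t). s u t)" "\<And>u t. u \<in> U \<Longrightarrow> t \<in> {0..1} \<Longrightarrow> s u t \<in> X"
proof -
  have "topspace (path_space (top_of_set X)) \<subseteq> {\<gamma>. pathin (top_of_set X) \<gamma>}"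
    by (auto simp: path_space_def topology_generated_by_topspace)
  then have path: "pathin (top_of_set X) (s u)" if "u \<in> U" for u
    using continuous_map_funspace[OF s] that by auto
  then show inX: "s u t \<in> X" if "u \<in> U" "t \<in> {0..1}" for u t
    using that by (force simp: pathin_def continuous_map_def)
  have cont: "continuous_on {0..1} (s u)" if "u \<in> U" for u
    using path[OF that] by (auto simp: pathin_def)
  show "continuous_on (U \<times> {0..1}) (\<lambda>(u, t). s u t)"
    unfolding continuous_openin_preimage_eq
  proof (intro allI impI)
    fix V :: "'x set"
    assume V: "open V"
    let ?f = "\<lambda>(u, t). s u t"
    have "\<exists>T. openin (top_of_set (U \<times> {0..1})) T \<and> p \<in> T \<and> T \<subseteq> U \<times> {0..1} \<inter> ?f -` V"
      if p: "p \<in> U \<times> {0..1} \<inter> ?f -` V" for p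
    proof -
      obtain u t where ut: "p = (u, t)" "u \<in> U" "t \<in> {0..1}" "s u t \<in> V" using p by auto
      have "openin (top_of_set {0..1}) ({0..1} \<inter> s u -` V)"
        using continuous_openin_preimage_gen[OF cont[OF ut(2)] V] .
      then obtain e where e: "e > 0" "cball t e \<inter> {0..1} \<subseteq> {0..1} \<inter> s u -` V"
        using ut(3,4) unfolding openin_contains_cball by blast
      let ?K = "cball t e \<inter> {0..1}"
      let ?S = "{\<gamma> \<in> extensional {0..1}. pathin (top_of_set X) \<gamma> \<and> \<gamma> ` ?K \<subseteq> X \<inter> V}"
      have "openin (path_space (top_of_set X)) ?S"
        unfolding path_space_def
        by (rule topology_generated_by_Basis) (use V in \<open>auto intro!: exI[of _ ?K] exI[of _ "X \<inter> V"] simp: openin_open_Int\<close>)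
      then have op: "openin (top_of_set U) {w \<in> U. s w \<in> ?S}"
        by (rule openin_continuous_map_preimage[OF s, unfolded topspace_euclidean_subtopology])
      have "s u \<in> topspace (path_space (top_of_set X))"
        using continuous_map_funspace[OF s] ut(2) by auto
      then have "s u \<in> extensional {0..1}"
        by (auto simp: path_space_def topology_generated_by_topspace)
      then have "s u \<in> ?S" using path[OF ut(2)] inX[OF ut(2)] e(2) by auto
      then have "p \<in> {w \<in> U. s w \<in> ?S} \<times> ({0..1} \<inter> ball t e)" using ut e(1) by auto
      moreover have "openin (top_of_set (U \<times> {0..1})) ({w \<in> U. s w \<in> ?S} \<times> ({0..1} \<inter> ball t e))"
        by (intro openin_Times op openin_open_Int open_ball)
      moreover have "{w \<in> U. s w \<in> ?S} \<times> ({0..1} \<inter> ball t e) \<subseteq> U \<times> {0..1} \<inter> ?f -` V"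
        by (auto simp: image_subset_iff)
      ultimately show ?thesis by blast
    qed
    then show "openin (top_of_set (U \<times> {0..1})) (U \<times> {0..1} \<inter> ?f -` V)"
      by (subst openin_subopen) blast
  qed
qed

text \<open>The other half, a tube argument: projection along the compact set \<open>K\<close> is
  closed, so the parameters whose path leaves \<open>V\<close> somewhere on \<open>K\<close> form a
  closed set. \<open>restrict\<close> makes the paths extensional, as \<open>path_space\<close>
  demands.\<close>

lemma continuous_section:
  fixes X :: "'x::t2_space set" and U :: "'u::topological_space set"
  assumes F: "continuous_on (U \<times> {0..1}) F" "F ` (U \<times> {0..1}) \<subseteq> X"
  shows "continuous_map (top_of_set U) (path_space (top_of_set X)) (\<lambda>u. restrict (\<lambda>t. F (u, t)) {0..1})"
    (is "continuous_map _ _ ?s")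
proof -
  have path: "pathin (top_of_set X) (?s u)" if "u \<in> U" for u
  proof -
    have "continuous_on {0..1} (\<lambda>t. F (u, t))"
      by (rule continuous_on_compose2[OF F(1)]) (use that in \<open>auto intro: continuous_intros\<close>)
    then have "continuous_on {0..1} (?s u)" by (rule continuous_on_eq) auto
    then show ?thesis using F(2) that by (auto simp: pathin_def)
  qed
  show ?thesis
    unfolding path_space_def
  proof (rule continuous_on_generated_topo)
    fix S assume "S \<in> {{\<gamma> \<in> extensional {0..1}. pathin (top_of_set X) \<gamma> \<and> \<gamma> ` K \<subseteq> V} | K V.
        compact K \<and> K \<subseteq> {0..1} \<and> openin (top_of_set X) V}"
    then obtain K V where S: "S = {\<gamma> \<in> extensional {0..1}. pathin (top_of_set X) \<gamma> \<and> \<gamma> ` K \<subseteq> V}"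
      and K: "compact K" "K \<subseteq> {0..1}" and V: "openin (top_of_set X) V" by blast
    let ?T = "(U \<times> K) - F -` V"
    have FUK: "continuous_on (U \<times> K) F" "F ` (U \<times> K) \<subseteq> X"
      using K(2) F by (auto intro: continuous_on_subset)
    have "openin (top_of_set (U \<times> K)) (U \<times> K \<inter> F -` V)"
      using FUK V by (intro continuous_openin_preimage[of _ _ X]) auto
    then have "closedin (top_of_set (U \<times> K)) ?T"
      using openin_closedin_eq by (metis Diff_Int2 Int_absorb closedin_diff closedin_subtopology_refl closedin_topspace topspace_euclidean_subtopology Diff_Int Diff_cancel Un_empty_left)
    moreover have "closed_map (prod_topology (top_of_set U) (top_of_set K)) (top_of_set U) fst"
      using K(1) by (intro closed_map_fst) (simp add: compact_space_subtopology)
    ultimately have "closedin (top_of_set U) (fst ` ?T)" by (auto simp: closed_map_def)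
    then have "openin (top_of_set U) (U - fst ` ?T)"
      by (metis closedin_def topspace_euclidean_subtopology)
    moreover have "U - fst ` ?T = ?s -` S \<inter> topspace (top_of_set U)"
      using K(2) path by (force simp: S image_subset_iff subset_iff)
    ultimately show "openin (top_of_set U) (?s -` S \<inter> topspace (top_of_set U))" by simp
  next
    let ?\<S> = "{{\<gamma> \<in> extensional {0..1}. pathin (top_of_set X) \<gamma> \<and> \<gamma> ` K \<subseteq> V} | K V.
        compact K \<and> K \<subseteq> {0..1} \<and> openin (top_of_set X) V}"
    \<comment> \<open>The subbasic set for \<open>K = {}\<close> contains every path, so the values
      lie in the generated space.\<close>
    let ?S = "{\<gamma> \<in> extensional {0..1}. pathin (top_of_set X) \<gamma> \<and> \<gamma> ` {} \<subseteq> {}}"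
    have S: "?S \<in> ?\<S>"
      by (intro CollectI exI[of _ "{}"] conjI refl compact_empty empty_subsetI openin_empty)
    show "?s ` topspace (top_of_set U) \<subseteq> \<Union>?\<S>"
    proof (rule image_subsetI)
      fix u assume "u \<in> topspace (top_of_set U)"
      then have "?s u \<in> ?S" using path[of u] by simp
      then show "?s u \<in> \<Union>?\<S>" by (rule UnionI[OF S])
    qed
  qed
qed

section \<open>Correcting a section while keeping its ends\<close>

context chart_maps
begin

text \<open>Meant for the two projections near the ends. The source chart may depend on the target
  chart \<open>c\<close>: a cylinder chart with \<open>c\<close> itself as a factor turns the
  projection into the linear map \<open>l\<close>, and surjectivity yields a derivative vector
  outside the proper subspace \<open>S\<close>.\<close>

lemma good_if_linear:
  assumes Z: "submanifold X A 1 Z" and p: "p \<in> N" "F p \<in> X"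
    and lin: "\<And>c. c \<in> A \<Longrightarrow> F p \<in> fst c \<Longrightarrow> \<exists>b V. b \<in> B \<and> p \<in> fst b \<and> open V \<and> snd b p \<in> V \<and>
      (\<forall>x\<in>H. x \<in> V \<longrightarrow> local_rep b c F x = l x)"
    and l: "bounded_linear l" "surj l"
  shows "good F p"
proof -
  have "smooth_pt F p"
  proof -
    obtain a where a: "a \<in> A" "F p \<in> fst a" using tgt.cover p(2) by blast
    obtain b V where b: "b \<in> B" "p \<in> fst b" "open V" "snd b p \<in> V" "\<forall>x\<in>H. x \<in> V \<longrightarrow> local_rep b a F x = l x"
      using lin[OF a] by blast
    have "smooth_within H (local_rep b a F) (snd b p)"
      by (rule smooth_within_transfer[OF smooth_within_bounded_linear[OF l(1), of H] b(3,4)]) (use b(5) in simp)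
    then show ?thesis unfolding smooth_pt_def using a b(1,2) by blast
  qed
  moreover have "\<exists>b c S. transv_at F p b c S" if inZ: "F p \<in> Z"
  proof -
    obtain S c where c: "slice_chart A Z S c" "F p \<in> fst c" "dim S + 1 = DIM('e)"
      using Z inZ unfolding submanifold_def by blast
    have cA: "c \<in> A" using c(1) by (simp add: slice_chart_def)
    obtain b V where b: "b \<in> B" "p \<in> fst b" "open V" "snd b p \<in> V" "\<forall>x\<in>H. x \<in> V \<longrightarrow> local_rep b c F x = l x"
      using lin[OF cA c(2)] by blast
    have "S \<noteq> UNIV" using c(3) by auto
    then obtain \<eta> where "\<eta> \<notin> S" by blast
    moreover obtain \<xi> where "l \<xi> = \<eta>" using l(2) by (metis surjD)
    moreover have "(local_rep b c F has_derivative l) (at (snd b p) within H)"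
      by (rule has_derivative_cong_local[OF bounded_linear_imp_has_derivative[OF l(1)] src.chart_in_H[OF b(1,2)] b(3,4)])
        (use b(5) in simp)
    ultimately have "transv_at F p b c S"
      unfolding transv_at_def using b(1,2) c by blast
    then show ?thesis by blast
  qed
  ultimately show ?thesis by (simp add: good_def)
qed

end

lemma transversal_section_exists:
  fixes X :: "'a::{t2_space,second_countable_topology} set"
    and A :: "('a, 'e::euclidean_space) chart set"
  assumes X: "smooth_manifold X A" and Z: "submanifold X A 1 Z"
    and U: "openin (prod_topology (top_of_set X) (top_of_set X)) U"
    and s: "local_section (path_space (top_of_set X)) (prod_topology (top_of_set X) (top_of_set X)) endpoints U s"
  obtains s' where "local_section (path_space (top_of_set X)) (prod_topology (top_of_set X) (top_of_set X)) endpoints U s'"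
    "transversal (U \<times> {0..1}) (cylinder_atlas U A) X A (\<lambda>(u, t). s' u t) Z"
proof -
  let ?H = "UNIV \<times> {0..1} :: (('e \<times> 'e) \<times> real) set"
  have UX: "openin (top_of_set (X \<times> X)) U" using U by simp
  have UX': "U \<subseteq> X \<times> X" using UX openin_imp_subset by blast
  have sub_eq: "subtopology (prod_topology (top_of_set X) (top_of_set X)) U = top_of_set U"
    using UX' by (simp add: subtopology_subtopology Int_absorb1)
  have s: "continuous_map (top_of_set U) (path_space (top_of_set X)) s" "\<And>u. u \<in> U \<Longrightarrow> endpoints (s u) = u"
    using s unfolding local_section_def sub_eq by auto
  interpret T: charts X A UNIV by (rule smooth_manifold_charts[OF X])
  interpret S: charts "U \<times> {0..1}" "cylinder_atlas U A" ?H by (rule T.cylinder_charts[OF refl UX])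
  interpret M: chart_maps "U \<times> {0..1}" "cylinder_atlas U A" ?H X A Z by unfold_locales
  let ?N = "U \<times> {0..1::real}"
  define \<rho> :: "real \<Rightarrow> real" where "\<rho> t = max 0 (min 1 (3 * t - 1))" for t
  define F where "F p = s (fst p) (\<rho> (snd p))" for p
  have \<rho>: "\<rho> t \<in> {0..1}" for t by (auto simp: \<rho>_def)
  have F: "M.cmap F"
  proof -
    have "continuous_on ?N (\<lambda>p. (\<lambda>(u, t). s u t) (fst p, \<rho> (snd p)))"
      unfolding \<rho>_def
      by (rule continuous_on_compose2[OF section_continuous_on(1)[OF s(1)]])
        (auto intro!: continuous_intros)
    moreover have "F ` ?N \<subseteq> X"
      using section_continuous_on(2)[OF s(1)] \<rho> by (auto simp: F_def)
    ultimately show ?thesis by (simp add: M.cmap_def F_def)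
  qed
  have ends: "s u 0 = fst u" "s u 1 = snd u" if "u \<in> U" for u
    using arg_cong[OF s(2)[OF that], of fst] arg_cong[OF s(2)[OF that], of snd] by (simp_all add: endpoints_def)
  have F0: "F (u, t) = fst u" if "u \<in> U" "t \<le> 1 / 3" for u t
    using ends(1)[OF that(1)] that(2) by (simp add: F_def \<rho>_def)
  have F1: "F (u, t) = snd u" if "u \<in> U" "t \<ge> 2 / 3" for u t
    using ends(2)[OF that(1)] that(2) by (simp add: F_def \<rho>_def)
  \<comment> \<open>The closed collars end at 1/4 and 3/4, strictly inside the regions
    \<open>G0\<close> and \<open>G1\<close> where the map is a projection, and they contain
    neighbourhoods of both ends; so what remains outside \<open>C\<close> keeps away from the
    boundary.\<close>
  define C where "C = ?N \<inter> snd -` ({..1/4} \<union> {3/4..})"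
  define G0 where "G0 = ?N \<inter> snd -` {..<1/3}"
  define G1 where "G1 = ?N \<inter> snd -` {2/3<..}"
  have C: "closedin (top_of_set ?N) C"
    unfolding C_def by (intro continuous_closedin_preimage continuous_on_snd continuous_on_id closed_Un) auto
  have snd_open: "openin (top_of_set ?N) (?N \<inter> snd -` W)" if "open W" for W :: "real set"
    by (rule continuous_openin_preimage_gen[OF continuous_on_snd[OF continuous_on_id] that])
  have G: "openin (top_of_set ?N) G0" "openin (top_of_set ?N) G1"
    unfolding G0_def G1_def by (simp_all only: snd_open open_lessThan open_greaterThan)
  have cylN: "cyl U c d \<in> cylinder_atlas U A" if "c \<in> A" "d \<in> A" for c d
    using that unfolding cylinder_atlas_eq by blast
  have good0: "M.good F p" if p: "p \<in> G0" for p
  proof (rule M.good_if_linear[OF Z, where l = "\<lambda>z. fst (fst z)"])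
    have pu: "p \<in> ?N" "fst p \<in> U" "fst (fst p) \<in> X" "snd (fst p) \<in> X" "snd p < 1 / 3"
      using p UX' by (auto simp: G0_def)
    have Fp: "F p = fst (fst p)" using F0[OF pu(2), of "snd p"] pu(5) by simp
    show "p \<in> ?N" "F p \<in> X" using pu Fp by auto
    fix c assume c: "c \<in> A" "F p \<in> fst c"
    obtain d where d: "d \<in> A" "snd (fst p) \<in> fst d" using T.cover pu(4) by blast
    have pb: "p \<in> fst (cyl U c d)" using pu(1,2) c(2) d(2) Fp by (auto simp: cyl_def mem_Times_iff)
    obtain V where V: "open V" "snd (cyl U c d) p \<in> V"
      "\<And>x. x \<in> ?H \<Longrightarrow> x \<in> V \<Longrightarrow> x \<in> snd (cyl U c d) ` fst (cyl U c d) \<and> chart_inv (cyl U c d) x \<in> G0"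
      using S.chart_nhd[OF cylN[OF c(1) d(1)] pb G(1) p] by blast
    have "local_rep (cyl U c d) c F x = fst (fst x)" if x: "x \<in> ?H" "x \<in> V" for x
    proof -
      note V3 = V(3)[OF x]
      have inv: "chart_inv (cyl U c d) x = ((chart_inv c (fst (fst x)), chart_inv d (snd (fst x))), snd x)"
        by (rule T.cyl_inv_eq[OF c(1) d(1)]) (use V3 in blast)
      have "F (chart_inv (cyl U c d) x) = chart_inv c (fst (fst x))"
        using V3 F0 unfolding inv by (auto simp: G0_def)
      moreover have "fst (fst x) \<in> snd c ` fst c"
        using V3 by (auto simp: cyl_def)
      ultimately show ?thesis using T.chart_chart_inv[OF c(1)] by (simp add: local_rep_def)
    qed
    then show "\<exists>b V. b \<in> cylinder_atlas U A \<and> p \<in> fst b \<and> open V \<and> snd b p \<in> V \<and>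
        (\<forall>x\<in>?H. x \<in> V \<longrightarrow> local_rep b c F x = fst (fst x))"
      using cylN[OF c(1) d(1)] pb V(1,2) by blast
  next
    show "bounded_linear (\<lambda>z :: ('e \<times> 'e) \<times> real. fst (fst z))"
      by (rule bounded_linear_compose[OF bounded_linear_fst bounded_linear_fst])
    show "surj (\<lambda>z :: ('e \<times> 'e) \<times> real. fst (fst z))"
      by (rule surjI[of _ "\<lambda>x. ((x, 0), 0)"]) simp
  qed
  have good1: "M.good F p" if p: "p \<in> G1" for p
  proof (rule M.good_if_linear[OF Z, where l = "\<lambda>z. snd (fst z)"])
    have pu: "p \<in> ?N" "fst p \<in> U" "fst (fst p) \<in> X" "snd (fst p) \<in> X" "snd p > 2 / 3"
      using p UX' by (auto simp: G1_def)
    have Fp: "F p = snd (fst p)" using F1[OF pu(2), of "snd p"] pu(5) by simp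
    show "p \<in> ?N" "F p \<in> X" using pu Fp by auto
    fix d assume d: "d \<in> A" "F p \<in> fst d"
    obtain c where c: "c \<in> A" "fst (fst p) \<in> fst c" using T.cover pu(3) by blast
    have pb: "p \<in> fst (cyl U c d)" using pu(1,2) c(2) d(2) Fp by (auto simp: cyl_def mem_Times_iff)
    obtain V where V: "open V" "snd (cyl U c d) p \<in> V"
      "\<And>x. x \<in> ?H \<Longrightarrow> x \<in> V \<Longrightarrow> x \<in> snd (cyl U c d) ` fst (cyl U c d) \<and> chart_inv (cyl U c d) x \<in> G1"
      using S.chart_nhd[OF cylN[OF c(1) d(1)] pb G(2) p] by blast
    have "local_rep (cyl U c d) d F x = snd (fst x)" if x: "x \<in> ?H" "x \<in> V" for x
    proof -
      note V3 = V(3)[OF x]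
      have inv: "chart_inv (cyl U c d) x = ((chart_inv c (fst (fst x)), chart_inv d (snd (fst x))), snd x)"
        by (rule T.cyl_inv_eq[OF c(1) d(1)]) (use V3 in blast)
      have "F (chart_inv (cyl U c d) x) = chart_inv d (snd (fst x))"
        using V3 F1 unfolding inv by (auto simp: G1_def)
      moreover have "snd (fst x) \<in> snd d ` fst d"
        using V3 by (auto simp: cyl_def)
      ultimately show ?thesis using T.chart_chart_inv[OF d(1)] by (simp add: local_rep_def)
    qed
    then show "\<exists>b V. b \<in> cylinder_atlas U A \<and> p \<in> fst b \<and> open V \<and> snd b p \<in> V \<and>
        (\<forall>x\<in>?H. x \<in> V \<longrightarrow> local_rep b d F x = snd (fst x))"
      using cylN[OF c(1) d(1)] pb V(1,2) by blast
  next
    show "bounded_linear (\<lambda>z :: ('e \<times> 'e) \<times> real. snd (fst z))"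
      by (rule bounded_linear_compose[OF bounded_linear_snd bounded_linear_fst])
    show "surj (\<lambda>z :: ('e \<times> 'e) \<times> real. snd (fst z))"
      by (rule surjI[of _ "\<lambda>x. ((0, x), 0)"]) simp
  qed
  have int: "snd b p \<in> interior ?H" if p: "p \<in> ?N - C" "b \<in> cylinder_atlas U A" "p \<in> fst b" for p b
  proof -
    have "snd (snd b p) = snd p" using p(2) by (auto simp: cylinder_atlas_eq cyl_def)
    moreover have "0 < snd p" "snd p < 1" using p(1) by (auto simp: C_def)
    ultimately have mem: "snd b p \<in> UNIV \<times> {0<..<1}" by (simp add: mem_Times_iff)
    have "UNIV \<times> {0<..<1} \<subseteq> interior ?H"
      by (rule interior_maximal) (auto intro: open_Times)
    from subsetD[OF this mem] show ?thesis .
  qed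
  have "closed ?H" by (intro closed_Times) auto
  moreover have "C \<subseteq> G0 \<union> G1" by (auto simp: C_def G0_def G1_def)
  moreover have "openin (top_of_set ?N) (G0 \<union> G1)" using G by blast
  moreover have "M.good F p" if "p \<in> G0 \<union> G1" for p using that good0 good1 by blast
  ultimately obtain F' where F': "M.cmap F'" "\<And>p. p \<in> C \<Longrightarrow> F' p = F p" "\<And>p. p \<in> ?N \<Longrightarrow> M.good F' p"
    using M.relative_transversality[OF F Z _ C _ _ _ int] by blast
  define s' where "s' u = restrict (\<lambda>t. F' (u, t)) {0..1}" for u
  have F's': "F' p = (\<lambda>(u, t). s' u t) p" if "p \<in> ?N" for p
    using that by (auto simp: s'_def)
  show ?thesis
  proof (rule that[of s'])
    have "continuous_map (top_of_set U) (path_space (top_of_set X)) s'"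
      unfolding s'_def using F'(1) unfolding M.cmap_def by (intro continuous_section) auto
    moreover have "endpoints (s' u) = u" if "u \<in> U" for u
      using F'(2)[of "(u, 0)"] F'(2)[of "(u, 1)"] F0[OF that, of 0] F1[OF that, of 1] that
      by (simp add: endpoints_def s'_def C_def)
    ultimately show "local_section (path_space (top_of_set X)) (prod_topology (top_of_set X) (top_of_set X)) endpoints U s'"
      unfolding local_section_def sub_eq by blast
    show "transversal ?N (cylinder_atlas U A) X A (\<lambda>(u, t). s' u t) Z"
    proof (rule M.good_imp_transversal)
      have "continuous_on ?N (\<lambda>(u, t). s' u t)"
        by (rule continuous_on_eq[of _ F']) (use F'(1) F's' in \<open>auto simp: M.cmap_def\<close>)
      moreover have "(\<lambda>(u, t). s' u t) ` ?N = F' ` ?N"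
        by (rule image_cong[OF refl]) (simp only: F's')
      ultimately show "M.cmap (\<lambda>(u, t). s' u t)" using F'(1) by (simp add: M.cmap_def)
      show "M.good (\<lambda>(u, t). s' u t) p" if "p \<in> ?N" for p
        by (rule M.good_cong[OF F'(3)[OF that] openin_subtopology_self that]) (rule F's')
    qed
  qed
qed

theorem proposition2p3:
  fixes X :: "'a::{t2_space,second_countable_topology} set"
    and A :: "('a, 'e::euclidean_space) chart set"
    and Z :: "'a set"
  assumes "smooth_manifold X A"
    and "submanifold X A 1 Z"
  shows "topological_complexity (top_of_set X) =
    Inf {enat k | k. 0 < k \<and>
      (\<exists>U. open_cover (prod_topology (top_of_set X) (top_of_set X)) k U \<and>
        (\<forall>i\<in>{1..k}. \<exists>s.
           local_section (path_space (top_of_set X))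
             (prod_topology (top_of_set X) (top_of_set X)) endpoints (U i) s \<and>
           transversal (U i \<times> {0..1}) (cylinder_atlas (U i) A) X A (\<lambda>(u, t). s u t) Z))}"
proof -
  let ?P = "prod_topology (top_of_set X) (top_of_set X)"
  let ?sec = "\<lambda>U s. local_section (path_space (top_of_set X)) ?P endpoints U s"
  let ?tr = "\<lambda>U s. transversal (U \<times> {0..1}) (cylinder_atlas U A) X A (\<lambda>(u, t). s u t) Z"
  have "(\<exists>s. ?sec U s) \<longleftrightarrow> (\<exists>s. ?sec U s \<and> ?tr U s)" if "openin ?P U" for U
    using transversal_section_exists[OF assms that] by metis
  then have "(\<forall>i\<in>{1..k}. \<exists>s. ?sec (U i) s) \<longleftrightarrow> (\<forall>i\<in>{1..k}. \<exists>s. ?sec (U i) s \<and> ?tr (U i) s)"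
    if "open_cover ?P k U" for k and U :: "nat \<Rightarrow> ('a \<times> 'a) set"
    using that unfolding open_cover_def by blast
  then show ?thesis
    unfolding topological_complexity_def sectional_category_def
    by (intro arg_cong[where f = Inf] Collect_cong ex_cong1 conj_cong refl) blast
qed

end
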